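(* Let $K$ be a real compact nc convex set with complexification $K_c$. If $x\in K$ and $x$ (i.e. $x+i0$) is pure (resp. nc extreme) in the complex nc convex set $K_c$, then $x$ is pure (resp. nc extreme) in $K$. The converse is false: there exist a real compact nc convex set $K$ and a point $x\in K$ which is pure in $K$ but not pure in $K_c$, and there exist a real compact nc convex set $K$ and $x\in K$ which is nc extreme in $K$ but not nc extreme in $K_c$. In particular, $K\cap\partial_{\mathbb C}K_c\subseteq\partial_{\mathbb R}K$ always, and in general this inclusion is proper.
   Context: Let $\mathbb F=\mathbb R$ or $\mathbb C$. $M_{m,n}(\mathbb F)$ denotes the bounded operators $\ell^2_n\to\ell^2_m$ (possibly infinite cardinals, nonzero and bounded by a fixed large enough infinite cardinal $\kappa$); for an operator space $E$, $M_n(E)$ is the space of $n\times n$ matrices over $E$ whose finitely supported submatrices are uniformly bounded, and $\mathcal M(E)=\bigsqcup_{n\le\kappa}M_n(E)$. A real (resp. complex) nc convex set over a real (resp. complex) dual operator space $E$ is $K=\bigsqcup_nK_n\subseteq\mathcal M(E)$ closed under direct sums ($\sum_i\alpha_ix_i\alpha_i^*\in K_n$ for bounded families $x_i\in K_{n_i}$ and isometries $\alpha_i\in M_{n,n_i}(\mathbb F)$ with $\sum_i\alpha_i\alpha_i^*=1_n$) and compressions ($\beta^*x\beta\in K_m$ for $x\in K_n$, $\beta\in M_{n,m}(\mathbb F)$ an isometry). It is compact if each $K_n$ is weak* compact. For $x,y\in M_n(E)$, $c(x,y)=\begin{bmatrix} x & -y \\ y & x \end{bmatrix}$, and the complexification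 of a real nc convex set $K\subseteq \mathcal M(E)$ is the complex nc convex set $K_c\subseteq\mathcal M(E_c)$ with $(K_c)_n=\{x+iy:c(x,y)\in K_{2n}\}$; $K\subseteq K_c$ via $x\mapsto x+i0$. A point $x\in K_n$ is pure if whenever $x=\sum_i\alpha_i^*x_i\alpha_i$ is a finite sum with $x_i\in K_{n_i}$, nonzero $\alpha_i\in M_{n_i,n}(\mathbb F)$ and $\sum_i\alpha_i^*\alpha_i=1_n$, then each $\alpha_i=c_i\beta_i$ with $c_i$ a positive scalar and $\beta_i$ an isometry with $\beta_i^*x_i\beta_i=x$. (In the complex case this uses complex matrices, in the real case real matrices.) It is nc extreme if moreover, in each such situation, $x_i$ commutes with $\beta_i\beta_i^*$ for each $i$. $\partial_{\mathbb R}K$ is the set of nc extreme points of a real nc convex set $K$ and $\partial_{\mathbb C}K_c$ the set of nc extreme points of the complex nc convex set $K_c$. *)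

theory Defs
  imports "HOL-Analysis.Analysis"
begin

section \<open>Scalars\<close>

text \<open>Up to isomorphism the only instances of this class are, by Gelfand--Mazur, the real and the complex
  numbers, and the last axiom forces \<open>cj\<close> to be the usual conjugation.\<close>

class rc_field = real_normed_field +
  fixes cj :: "'a \<Rightarrow> 'a"
  assumes cj_add: "cj (a + b) = cj a + cj b"
    and cj_mult: "cj (a * b) = cj a * cj b"
    and cj_cj: "cj (cj a) = a"
    and mult_cj: "a * cj a = (norm a)\<^sup>2 *\<^sub>R 1"

instantiation real :: rc_field
begin
definition cj_real :: "real \<Rightarrow> real" where "cj_real a = a"
instance by standard (simp_all add: cj_real_def power2_eq_square)
end

instantiation complex :: rc_field
begin
definition cj_complex :: "complex \<Rightarrow> complex" where "cj_complex = cnj"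
instance
proof
  fix a :: complex
  show "a * cj a = (norm a)\<^sup>2 *\<^sub>R 1"
    unfolding cj_complex_def scaleR_conv_of_real mult_1_right by (rule complex_norm_square[symmetric])
qed (simp_all add: cj_complex_def)
end


section \<open>Scalar matrices\<close>

text \<open>\<open>op_bound F G a C\<close>: the finite matrix \<open>a\<close>, as an operator from \<open>\<ell>\<^sup>2(G)\<close> to \<open>\<ell>\<^sup>2(F)\<close>, has norm at
  most \<open>C\<close>.\<close>

definition op_bound :: "'a set \<Rightarrow> 'b set \<Rightarrow> ('a \<Rightarrow> 'b \<Rightarrow> 'f::rc_field) \<Rightarrow> real \<Rightarrow> bool" where
  "op_bound F G a C \<longleftrightarrow> 0 \<le> C \<and>
     (\<forall>\<xi>. L2_set (\<lambda>i. norm (\<Sum>j\<in>G. a i j * \<xi> j)) F \<le> C * L2_set (\<lambda>j. norm (\<xi> j)) G)"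

definition op_norm :: "'a set \<Rightarrow> 'b set \<Rightarrow> ('a \<Rightarrow> 'b \<Rightarrow> 'f::rc_field) \<Rightarrow> real" where
  "op_norm F G a = Inf {C. op_bound F G a C}"

text \<open>The bounded operators from \<open>\<ell>\<^sup>2(N)\<close> to \<open>\<ell>\<^sup>2(M)\<close>. Throughout, a matrix over an index set is
  extended by zero outside that set, so that equality of matrices is equality of functions.\<close>

definition scalar_mats :: "'k set \<Rightarrow> 'k set \<Rightarrow> ('k \<Rightarrow> 'k \<Rightarrow> 'f::rc_field) set" where
  "scalar_mats M N = {a. (\<forall>i j. i \<notin> M \<or> j \<notin> N \<longrightarrow> a i j = 0) \<and>
     (\<exists>C. \<forall>F G. finite F \<and> F \<subseteq> M \<and> finite G \<and> G \<subseteq> N \<longrightarrow> op_bound F G a C)}"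

definition adj :: "('k \<Rightarrow> 'k \<Rightarrow> 'f::rc_field) \<Rightarrow> 'k \<Rightarrow> 'k \<Rightarrow> 'f" where
  "adj a = (\<lambda>i j. cj (a j i))"

definition mat_prod :: "'k set \<Rightarrow> ('k \<Rightarrow> 'k \<Rightarrow> 'f::rc_field) \<Rightarrow> ('k \<Rightarrow> 'k \<Rightarrow> 'f) \<Rightarrow> 'k \<Rightarrow> 'k \<Rightarrow> 'f" where
  "mat_prod N a b = (\<lambda>i k. \<Sum>\<^sub>\<infinity>j\<in>N. a i j * b j k)"

definition id_mat :: "'k set \<Rightarrow> 'k \<Rightarrow> 'k \<Rightarrow> 'f::rc_field" where
  "id_mat N = (\<lambda>i j. if i \<in> N \<and> i = j then 1 else 0)"

definition isometries :: "'k set \<Rightarrow> 'k set \<Rightarrow> ('k \<Rightarrow> 'k \<Rightarrow> 'f::rc_field) set" where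
  "isometries M N = {b \<in> scalar_mats M N. mat_prod M (adj b) b = id_mat N}"


section \<open>Dual operator spaces\<close>

text \<open>\<open>mnorm E n\<close> is the norm of \<open>M\<^sub>n(E)\<close>, a matrix being a function of which only the entries with
  indices below \<open>n\<close> matter; \<open>predual E\<close> is the space \<open>E\<^sub>*\<close>, viewed inside the space of bounded
  functionals on \<open>E\<close>.\<close>

record ('f, 'e) opspace =
  scal :: "'f \<Rightarrow> 'e \<Rightarrow> 'e"
  mnorm :: "nat \<Rightarrow> (nat \<Rightarrow> nat \<Rightarrow> 'e) \<Rightarrow> real"
  predual :: "('e \<Rightarrow> 'f) set"

definition bimod :: "('f::rc_field, 'e::ab_group_add) opspace \<Rightarrow> nat \<Rightarrow>
    (nat \<Rightarrow> nat \<Rightarrow> 'f) \<Rightarrow> (nat \<Rightarrow> nat \<Rightarrow> 'e) \<Rightarrow> (nat \<Rightarrow> nat \<Rightarrow> 'f) \<Rightarrow> nat \<Rightarrow> nat \<Rightarrow> 'e" where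
  "bimod E n a x b = (\<lambda>k l. \<Sum>i<n. \<Sum>j<n. scal E (a k i * b j l) (x i j))"

definition diag_sum :: "nat \<Rightarrow> nat \<Rightarrow> (nat \<Rightarrow> nat \<Rightarrow> 'e::ab_group_add) \<Rightarrow> (nat \<Rightarrow> nat \<Rightarrow> 'e) \<Rightarrow>
    nat \<Rightarrow> nat \<Rightarrow> 'e" where
  "diag_sum m n x y = (\<lambda>i j. if i < m \<and> j < m then x i j
     else if m \<le> i \<and> m \<le> j then y (i - m) (j - m) else 0)"

text \<open>Ruan's axioms. They are the same over both fields. Completeness is not listed: it is automatic
  for the dual spaces below.\<close>

definition operator_space :: "('f::rc_field, 'e::ab_group_add) opspace \<Rightarrow> bool" where
  "operator_space E \<longleftrightarrow> vector_space (scal E) \<and>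
     (\<forall>n x y. (\<forall>i<n. \<forall>j<n. x i j = y i j) \<longrightarrow> mnorm E n x = mnorm E n y) \<and>
     (\<forall>n x. 0 \<le> mnorm E n x) \<and>
     (\<forall>n x. mnorm E n x = 0 \<longleftrightarrow> (\<forall>i<n. \<forall>j<n. x i j = 0)) \<and>
     (\<forall>n x y. mnorm E n (\<lambda>i j. x i j + y i j) \<le> mnorm E n x + mnorm E n y) \<and>
     (\<forall>n c x. mnorm E n (\<lambda>i j. scal E c (x i j)) = norm c * mnorm E n x) \<and>
     (\<forall>m n a x b. mnorm E m (bimod E n a x b)
        \<le> op_norm {..<m} {..<n} a * mnorm E n x * op_norm {..<n} {..<m} b) \<and>
     (\<forall>m n x y. mnorm E (m + n) (diag_sum m n x y) = max (mnorm E m x) (mnorm E n y))"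

text \<open>The scalar matrix \<open>[\<phi>\<^bsub>k l\<^esub>(x\<^bsub>i j\<^esub>)]\<close> with rows \<open>(k, i)\<close> and columns \<open>(l, j)\<close>.\<close>

definition pair_mat :: "(nat \<Rightarrow> nat \<Rightarrow> 'e \<Rightarrow> 'f::rc_field) \<Rightarrow> (nat \<Rightarrow> nat \<Rightarrow> 'e) \<Rightarrow>
    nat \<times> nat \<Rightarrow> nat \<times> nat \<Rightarrow> 'f" where
  "pair_mat \<phi> x = (\<lambda>(k, i) (l, j). \<phi> k l (x i j))"

definition pair_norm :: "nat \<Rightarrow> nat \<Rightarrow> (nat \<Rightarrow> nat \<Rightarrow> 'e \<Rightarrow> 'f::rc_field) \<Rightarrow> (nat \<Rightarrow> nat \<Rightarrow> 'e) \<Rightarrow>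
    real" where
  "pair_norm m n \<phi> x =
     op_norm ({..<m} \<times> {..<n}) ({..<m} \<times> {..<n}) (pair_mat \<phi> x)"

text \<open>The norm of \<open>[\<phi>\<^bsub>k l\<^esub>]\<close> in \<open>M\<^sub>m(E\<^sup>*) = CB(E, M\<^sub>m)\<close>.\<close>

definition cb_norm :: "('f::rc_field, 'e::ab_group_add) opspace \<Rightarrow> nat \<Rightarrow>
    (nat \<Rightarrow> nat \<Rightarrow> 'e \<Rightarrow> 'f) \<Rightarrow> real" where
  "cb_norm E m \<phi> = (SUP (n, x)\<in>{(n, x). mnorm E n x \<le> 1}. pair_norm m n \<phi> x)"

text \<open>Closure of a set of functionals on \<open>X\<close> in the dual norm, when \<open>X\<close> carries the norm \<open>\<nu>\<close>.\<close>

definition norm_closure :: "'x set \<Rightarrow> ('x \<Rightarrow> real) \<Rightarrow> ('x \<Rightarrow> 'f::rc_field) set \<Rightarrow> ('x \<Rightarrow> 'f) set" where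
  "norm_closure X \<nu> S = {\<psi>. \<forall>\<epsilon>>0. \<exists>\<phi>\<in>S. \<forall>x\<in>X. norm (\<psi> x - \<phi> x) \<le> \<epsilon> * \<nu> x}"

text \<open>\<open>E\<close> is the operator space dual of \<open>E\<^sub>*\<close>: the latter is a Banach space of bounded functionals,
  evaluation maps \<open>E\<close> bijectively onto the bounded functionals on \<open>E\<^sub>*\<close>, and the norm of \<open>M\<^sub>n(E)\<close> is
  that of \<open>CB(E\<^sub>*, M\<^sub>n)\<close>. The matrix norms on \<open>E\<^sub>*\<close> are those inherited from \<open>E\<^sup>*\<close>; this is no
  restriction since an operator space embeds completely isometrically in its second dual.\<close>

definition dual_operator_space :: "('f::rc_field, 'e::ab_group_add) opspace \<Rightarrow> bool" where
  "dual_operator_space E \<longleftrightarrow> operator_space E \<and>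
     (\<forall>\<phi>\<in>predual E. Vector_Spaces.linear (scal E) (*) \<phi> \<and>
        (\<exists>C. \<forall>e. norm (\<phi> e) \<le> C * mnorm E 1 (\<lambda>_ _. e))) \<and>
     (\<lambda>_. 0) \<in> predual E \<and>
     (\<forall>\<phi>\<in>predual E. \<forall>\<psi>\<in>predual E. (\<lambda>e. \<phi> e + \<psi> e) \<in> predual E) \<and>
     (\<forall>c. \<forall>\<phi>\<in>predual E. (\<lambda>e. c * \<phi> e) \<in> predual E) \<and>
     norm_closure UNIV (\<lambda>e. mnorm E 1 (\<lambda>_ _. e)) (predual E) \<subseteq> predual E \<and>
     (\<forall>T. (\<forall>\<phi>\<in>predual E. \<forall>\<psi>\<in>predual E. T (\<lambda>e. \<phi> e + \<psi> e) = T \<phi> + T \<psi>) \<and>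
          (\<forall>c. \<forall>\<phi>\<in>predual E. T (\<lambda>e. c * \<phi> e) = c * T \<phi>) \<and>
          (\<exists>C. \<forall>\<phi>\<in>predual E. norm (T \<phi>) \<le> C * cb_norm E 1 (\<lambda>_ _. \<phi>))
          \<longrightarrow> (\<exists>!e. \<forall>\<phi>\<in>predual E. T \<phi> = \<phi> e)) \<and>
     (\<forall>n x. mnorm E n x =
        (SUP (m, \<phi>)\<in>{(m, \<phi>). (\<forall>k<m. \<forall>l<m. \<phi> k l \<in> predual E) \<and> cb_norm E m \<phi> \<le> 1}.
           pair_norm m n \<phi> x))"


section \<open>Matrices over an operator space\<close>

text \<open>The cardinals \<open>n \<le> \<kappa>\<close> are represented by the nonempty sets \<open>N\<close> of elements of an infinite type
  \<open>'k\<close> of cardinality \<open>\<kappa>\<close>. An nc convex set is invariant under unitary equivalence (the direct sum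
  axiom with one summand), in particular under bijections of index sets, so having one level for each
  index set rather than for each cardinal carries no additional information. The finite submatrices
  of \<open>x\<close> are selected by injections \<open>f\<close> of an initial segment of the naturals into \<open>N\<close>.\<close>

definition submat :: "(nat \<Rightarrow> 'k) \<Rightarrow> ('k \<Rightarrow> 'k \<Rightarrow> 'e) \<Rightarrow> nat \<Rightarrow> nat \<Rightarrow> 'e" where
  "submat f x = (\<lambda>i j. x (f i) (f j))"

definition selections :: "'k set \<Rightarrow> (nat \<times> (nat \<Rightarrow> 'k)) set" where
  "selections N = {(n, f). inj_on f {..<n} \<and> f ` {..<n} \<subseteq> N}"

definition mats :: "('f::rc_field, 'e::ab_group_add) opspace \<Rightarrow> 'k set \<Rightarrow> ('k \<Rightarrow> 'k \<Rightarrow> 'e) set" where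
  "mats E N = {x. (\<forall>i j. i \<notin> N \<or> j \<notin> N \<longrightarrow> x i j = 0) \<and>
     (\<exists>C. \<forall>(n, f)\<in>selections N. mnorm E n (submat f x) \<le> C)}"

definition mats_norm :: "('f::rc_field, 'e::ab_group_add) opspace \<Rightarrow> 'k set \<Rightarrow>
    ('k \<Rightarrow> 'k \<Rightarrow> 'e) \<Rightarrow> real" where
  "mats_norm E N x = (SUP (n, f)\<in>selections N. mnorm E n (submat f x))"

definition all_mats :: "('f::rc_field, 'e::ab_group_add) opspace \<Rightarrow>
    ('k set \<times> ('k \<Rightarrow> 'k \<Rightarrow> 'e)) set" where
  "all_mats E = (SIGMA N:{N. N \<noteq> {}}. mats E N)"

text \<open>\<open>M\<^sub>N(E) = CB(E\<^sub>*, B(\<ell>\<^sup>2(N)))\<close> is the dual of the projective tensor product of \<open>E\<^sub>*\<close> with the trace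
  class operators on \<open>\<ell>\<^sup>2(N)\<close>. Inside the dual of \<open>M\<^sub>N(E)\<close> this predual is the norm closure of the
  span of the functionals \<open>x \<mapsto> \<phi>(x\<^bsub>i j\<^esub>)\<close> with \<open>\<phi>\<close> in \<open>E\<^sub>*\<close>.\<close>

definition mats_predual :: "('f::rc_field, 'e::ab_group_add) opspace \<Rightarrow> 'k set \<Rightarrow>
    (('k \<Rightarrow> 'k \<Rightarrow> 'e) \<Rightarrow> 'f) set" where
  "mats_predual E N = norm_closure (mats E N) (mats_norm E N)
     {\<lambda>x. \<Sum>i\<in>F. \<Sum>j\<in>F. \<phi> i j (x i j) |F \<phi>.
        finite F \<and> F \<subseteq> N \<and> (\<forall>i\<in>F. \<forall>j\<in>F. \<phi> i j \<in> predual E)}"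

definition weak_star :: "('f::rc_field, 'e::ab_group_add) opspace \<Rightarrow> 'k set \<Rightarrow>
    ('k \<Rightarrow> 'k \<Rightarrow> 'e) topology" where
  "weak_star E N = topology_generated_by
     {{x \<in> mats E N. \<psi> x \<in> U} |\<psi> U. \<psi> \<in> mats_predual E N \<and> open U}"

text \<open>Unconditional sums in \<open>E\<close> with respect to the weak* topology.\<close>

definition ws_sum :: "('f::rc_field, 'e::ab_group_add) opspace \<Rightarrow> ('i \<Rightarrow> 'e) \<Rightarrow> 'i set \<Rightarrow> 'e" where
  "ws_sum E f A = (THE e. \<forall>\<phi>\<in>predual E. ((\<lambda>a. \<phi> (f a)) has_sum \<phi> e) A)"

definition lmult :: "('f::rc_field, 'e::ab_group_add) opspace \<Rightarrow> 'k set \<Rightarrow>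
    ('k \<Rightarrow> 'k \<Rightarrow> 'f) \<Rightarrow> ('k \<Rightarrow> 'k \<Rightarrow> 'e) \<Rightarrow> 'k \<Rightarrow> 'k \<Rightarrow> 'e" where
  "lmult E N a x = (\<lambda>k l. ws_sum E (\<lambda>i. scal E (a k i) (x i l)) N)"

definition rmult :: "('f::rc_field, 'e::ab_group_add) opspace \<Rightarrow> 'k set \<Rightarrow>
    ('k \<Rightarrow> 'k \<Rightarrow> 'e) \<Rightarrow> ('k \<Rightarrow> 'k \<Rightarrow> 'f) \<Rightarrow> 'k \<Rightarrow> 'k \<Rightarrow> 'e" where
  "rmult E N x b = (\<lambda>k l. ws_sum E (\<lambda>j. scal E (b j l) (x k j)) N)"

text \<open>\<open>b\<^sup>* x b\<close> for \<open>x\<close> in \<open>M\<^sub>N(E)\<close>.\<close>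

definition conjug :: "('f::rc_field, 'e::ab_group_add) opspace \<Rightarrow> 'k set \<Rightarrow>
    ('k \<Rightarrow> 'k \<Rightarrow> 'f) \<Rightarrow> ('k \<Rightarrow> 'k \<Rightarrow> 'e) \<Rightarrow> 'k \<Rightarrow> 'k \<Rightarrow> 'e" where
  "conjug E N b x = lmult E N (adj b) (rmult E N x b)"


section \<open>Noncommutative convex sets\<close>

type_synonym ('k, 'e) graded_set = "('k set \<times> ('k \<Rightarrow> 'k \<Rightarrow> 'e)) set"

definition level :: "('k, 'e) graded_set \<Rightarrow> 'k set \<Rightarrow> ('k \<Rightarrow> 'k \<Rightarrow> 'e) set" where
  "level K N = {x. (N, x) \<in> K}"

text \<open>The summands of a direct sum have nonzero orthogonal ranges in \<open>\<ell>\<^sup>2(N)\<close>, so there are at most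
  \<open>\<kappa>\<close> of them and they can be indexed by a subset \<open>I\<close> of \<open>'k\<close>. Since the rows of the \<open>\<alpha> i\<close> are jointly
  square summable, the entries of the infinite sums below converge unconditionally.\<close>

definition nc_convex :: "('f::rc_field, 'e::ab_group_add) opspace \<Rightarrow> ('k, 'e) graded_set \<Rightarrow> bool" where
  "nc_convex E K \<longleftrightarrow> K \<subseteq> all_mats E \<and>
     (\<forall>N (I :: 'k set) Ns x \<alpha>. N \<noteq> {} \<and>
        (\<forall>i\<in>I. x i \<in> level K (Ns i) \<and> \<alpha> i \<in> isometries N (Ns i)) \<and>
        (\<exists>C. \<forall>i\<in>I. mats_norm E (Ns i) (x i) \<le> C) \<and>
        (\<forall>k l. ((\<lambda>i. mat_prod (Ns i) (\<alpha> i) (adj (\<alpha> i)) k l) has_sum id_mat N k l) I)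
        \<longrightarrow> (\<lambda>k l. ws_sum E (\<lambda>i. conjug E (Ns i) (adj (\<alpha> i)) (x i) k l) I) \<in> level K N) \<and>
     (\<forall>N M x \<beta>. M \<noteq> {} \<and> x \<in> level K N \<and> \<beta> \<in> isometries N M
        \<longrightarrow> conjug E N \<beta> x \<in> level K M)"

definition compact_nc_convex ::
    "('f::rc_field, 'e::ab_group_add) opspace \<Rightarrow> ('k, 'e) graded_set \<Rightarrow> bool" where
  "compact_nc_convex E K \<longleftrightarrow> nc_convex E K \<and>
     (\<forall>N. N \<noteq> {} \<longrightarrow> compactin (weak_star E N) (level K N))"

text \<open>\<open>x = \<Sum>\<^bsub>i<m\<^esub> \<alpha>\<^sub>i\<^sup>* x\<^sub>i \<alpha>\<^sub>i\<close> as a finite nc convex combination with nonzero coefficients.\<close>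

definition nc_comb :: "('f::rc_field, 'e::ab_group_add) opspace \<Rightarrow> ('k, 'e) graded_set \<Rightarrow>
    'k set \<Rightarrow> ('k \<Rightarrow> 'k \<Rightarrow> 'e) \<Rightarrow> nat \<Rightarrow> (nat \<Rightarrow> 'k set) \<Rightarrow> (nat \<Rightarrow> 'k \<Rightarrow> 'k \<Rightarrow> 'e) \<Rightarrow>
    (nat \<Rightarrow> 'k \<Rightarrow> 'k \<Rightarrow> 'f) \<Rightarrow> bool" where
  "nc_comb E K N x m Ns xs \<alpha> \<longleftrightarrow>
     (\<forall>i<m. xs i \<in> level K (Ns i) \<and> \<alpha> i \<in> scalar_mats (Ns i) N \<and> \<alpha> i \<noteq> (\<lambda>_ _. 0)) \<and>
     (\<lambda>k l. \<Sum>i<m. mat_prod (Ns i) (adj (\<alpha> i)) (\<alpha> i) k l) = id_mat N \<and>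
     x = (\<lambda>k l. \<Sum>i<m. conjug E (Ns i) (\<alpha> i) (xs i) k l)"

definition pure_factor :: "('f::rc_field, 'e::ab_group_add) opspace \<Rightarrow> 'k set \<Rightarrow>
    ('k \<Rightarrow> 'k \<Rightarrow> 'e) \<Rightarrow> 'k set \<Rightarrow> ('k \<Rightarrow> 'k \<Rightarrow> 'e) \<Rightarrow> ('k \<Rightarrow> 'k \<Rightarrow> 'f) \<Rightarrow>
    real \<Rightarrow> ('k \<Rightarrow> 'k \<Rightarrow> 'f) \<Rightarrow> bool" where
  "pure_factor E N x M y \<alpha> c \<beta> \<longleftrightarrow> c > 0 \<and> \<beta> \<in> isometries M N \<and>
     \<alpha> = (\<lambda>i j. of_real c * \<beta> i j) \<and> conjug E M \<beta> y = x"

definition pure :: "('f::rc_field, 'e::ab_group_add) opspace \<Rightarrow> ('k, 'e) graded_set \<Rightarrow>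
    'k set \<times> ('k \<Rightarrow> 'k \<Rightarrow> 'e) \<Rightarrow> bool" where
  "pure E K = (\<lambda>(N, x). (N, x) \<in> K \<and>
     (\<forall>m Ns xs \<alpha>. nc_comb E K N x m Ns xs \<alpha> \<longrightarrow>
        (\<forall>i<m. \<exists>c \<beta>. pure_factor E N x (Ns i) (xs i) (\<alpha> i) c \<beta>)))"

definition nc_extreme :: "('f::rc_field, 'e::ab_group_add) opspace \<Rightarrow> ('k, 'e) graded_set \<Rightarrow>
    'k set \<times> ('k \<Rightarrow> 'k \<Rightarrow> 'e) \<Rightarrow> bool" where
  "nc_extreme E K = (\<lambda>(N, x). pure E K (N, x) \<and>
     (\<forall>m Ns xs \<alpha>. nc_comb E K N x m Ns xs \<alpha> \<longrightarrow>
        (\<forall>i<m. \<forall>c \<beta>. pure_factor E N x (Ns i) (xs i) (\<alpha> i) c \<beta> \<longrightarrow>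
           lmult E (Ns i) (mat_prod N \<beta> (adj \<beta>)) (xs i) =
           rmult E (Ns i) (xs i) (mat_prod N \<beta> (adj \<beta>)))))"

definition nc_boundary :: "('f::rc_field, 'e::ab_group_add) opspace \<Rightarrow> ('k, 'e) graded_set \<Rightarrow>
    ('k, 'e) graded_set" where
  "nc_boundary E K = {p. nc_extreme E K p}"


section \<open>Complexification\<close>

text \<open>The block matrix with rows \<open>x, -y\<close> and \<open>y, x\<close>; \<open>Inl\<close> and \<open>Inr\<close> mark the two blocks.\<close>

fun c_mat :: "('a \<Rightarrow> 'a \<Rightarrow> 'e::ab_group_add) \<Rightarrow> ('a \<Rightarrow> 'a \<Rightarrow> 'e) \<Rightarrow> 'a + 'a \<Rightarrow> 'a + 'a \<Rightarrow> 'e" where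
  "c_mat x y (Inl i) (Inl j) = x i j"
| "c_mat x y (Inl i) (Inr j) = - y i j"
| "c_mat x y (Inr i) (Inl j) = y i j"
| "c_mat x y (Inr i) (Inr j) = x i j"

definition halves :: "nat \<Rightarrow> nat \<Rightarrow> nat + nat" where
  "halves n i = (if i < n then Inl i else Inr (i - n))"

text \<open>\<open>E\<^sub>c\<close> consists of the pairs \<open>(x, y)\<close>, read as \<open>x + i y\<close>, with the norms
  \<open>\<parallel>x + i y\<parallel> = \<parallel>c(x, y)\<parallel>\<close>; its predual is the complexification of \<open>E\<^sub>*\<close>.\<close>

definition cx_space :: "(real, 'e::ab_group_add) opspace \<Rightarrow> (complex, 'e \<times> 'e) opspace" where
  "cx_space E = \<lparr>
     scal = (\<lambda>c (x, y). (scal E (Re c) x - scal E (Im c) y, scal E (Re c) y + scal E (Im c) x)),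
     mnorm = (\<lambda>n z. mnorm E (2 * n) (\<lambda>i j.
        c_mat (\<lambda>k l. fst (z k l)) (\<lambda>k l. snd (z k l)) (halves n i) (halves n j))),
     predual = {\<lambda>(x, y). Complex (\<phi> x - \<psi> y) (\<phi> y + \<psi> x) |\<phi> \<psi>.
        \<phi> \<in> predual E \<and> \<psi> \<in> predual E}\<rparr>"

text \<open>The level \<open>2n\<close> is any level whose index set \<open>N'\<close> is in bijection with two copies of \<open>N\<close>; as
  an nc convex set is unitarily invariant the choice of \<open>N'\<close> and \<open>g\<close> is immaterial.\<close>

definition cx_set :: "(real, 'e::ab_group_add) opspace \<Rightarrow> ('k, 'e) graded_set \<Rightarrow>
    ('k, 'e \<times> 'e) graded_set" where
  "cx_set E K = {(N, z) \<in> all_mats (cx_space E). \<exists>N' g. bij_betw g N' (N <+> N) \<and>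
     (\<lambda>i j. if i \<in> N' \<and> j \<in> N'
        then c_mat (\<lambda>k l. fst (z k l)) (\<lambda>k l. snd (z k l)) (g i) (g j) else 0) \<in> level K N'}"

definition cx_incl :: "'k set \<times> ('k \<Rightarrow> 'k \<Rightarrow> 'e::ab_group_add) \<Rightarrow>
    'k set \<times> ('k \<Rightarrow> 'k \<Rightarrow> 'e \<times> 'e)" where
  "cx_incl = (\<lambda>(N, x). (N, \<lambda>i j. (x i j, 0)))"

end

(*
  Purity and nc extremality descend because a real nc convex combination is a complex one: weak*
  convergent sums in E remain convergent in E_c, with vanishing imaginary part, and coefficient
  matrices that are multiples of real matrices are real. Convergence itself follows from Ruan's
  axioms: a functional phi in the predual turns x in M_N(E) into a bounded bilinear form
  sum t_i phi(x_ij) s_j on l^2(N).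

  For the converse let K be the set of all real contractions and J the rotation by a right angle
  in K_2. If J is the sum of a_i* x_i a_i, then equality holds in the Cauchy-Schwarz inequality for
  the vectors a_i e_1 and a_i e_2. This forces x_i to act as J on the range of a_i and a_i* a_i to be
  a scalar; so J is nc extreme in K. Over the complex numbers J commutes with its two rank one
  spectral projections P and 1 - P, so J = PJP + (1-P)J(1-P) shows that J is not pure.
*)
theory Submission
  imports Defs
begin

section \<open>Square summable families and bounded bilinear forms\<close>

text \<open>The products \<open>lmult\<close>, \<open>rmult\<close> and \<open>conjug\<close> have
  values of \<open>ws_sum\<close> as entries, a definite description: nothing can be computed with
  them before the sum is known to converge weak* to an element of E. Summability against each
  functional does not by itself produce that element; the representation clause of a dual space
  does, provided the limit is bounded by a multiple of \<open>cb_norm\<close> that is uniform in the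
  functional. Hence the estimates keep track of their constants, and identities in E are checked by
  applying functionals, where they become identities between real forms. Membership of x + i0 in the
  complexification is a claim about K itself: c(x, 0) is the sum of two copies of x, and an infinite
  index type has room for them. The counterexample lives over E = R, where the points at level N are
  ordinary operators and weak* compactness of the unit ball reduces to compactness of a product of
  intervals. The rotation is chosen because it is irreducible over the reals, while its complex
  commutant contains nontrivial projections.\<close>

definition square_summable :: "'a set \<Rightarrow> ('a \<Rightarrow> real) \<Rightarrow> bool" where
  "square_summable N a \<longleftrightarrow> (\<lambda>i. (a i)\<^sup>2) summable_on N"

definition l2_norm :: "'a set \<Rightarrow> ('a \<Rightarrow> real) \<Rightarrow> real" where
  "l2_norm N a = sqrt (\<Sum>\<^sub>\<infinity>i\<in>N. (a i)\<^sup>2)"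

lemma l2_norm_nonneg [simp]: "0 \<le> l2_norm N a"
  by (simp add: l2_norm_def infsum_nonneg)

lemma l2_norm_power2: "(l2_norm N a)\<^sup>2 = (\<Sum>\<^sub>\<infinity>i\<in>N. (a i)\<^sup>2)"
  by (simp add: l2_norm_def infsum_nonneg)

lemma L2_set_power2: "(L2_set a F)\<^sup>2 = (\<Sum>i\<in>F. (a i)\<^sup>2)"
  by (simp add: L2_set_def sum_nonneg)

lemma L2_set_le_l2_norm:
  assumes "square_summable N a" "finite F" "F \<subseteq> N"
  shows "L2_set a F \<le> l2_norm N a"
  using assms finite_sum_le_infsum[of "\<lambda>i. (a i)\<^sup>2" N F]
  by (simp add: L2_set_def l2_norm_def square_summable_def)

lemma square_summableI:
  assumes "\<And>F. finite F \<Longrightarrow> F \<subseteq> N \<Longrightarrow> L2_set a F \<le> C"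
  shows "square_summable N a"
  unfolding square_summable_def
proof (rule nonneg_bdd_above_summable_on)
  have "(\<Sum>i\<in>F. (a i)\<^sup>2) \<le> C\<^sup>2" if "finite F" "F \<subseteq> N" for F
    using power_mono[OF assms[OF that] L2_set_nonneg, of 2] by (simp add: L2_set_power2)
  then show "bdd_above (sum (\<lambda>i. (a i)\<^sup>2) ` {F. F \<subseteq> N \<and> finite F})"
    by (intro bdd_aboveI[of _ "C\<^sup>2"]) auto
qed simp

lemma square_summable_add:
  assumes "square_summable N a" "square_summable N b"
  shows "square_summable N (\<lambda>i. a i + b i)"
  unfolding square_summable_def
proof (rule summable_on_comparison_test)
  show "(\<lambda>i. 2 * (a i)\<^sup>2 + 2 * (b i)\<^sup>2) summable_on N"
    using assms unfolding square_summable_def by (intro summable_on_add summable_on_cmult_right)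
  show "(a i + b i)\<^sup>2 \<le> 2 * (a i)\<^sup>2 + 2 * (b i)\<^sup>2" for i
    using sum_squares_bound[of "a i" "b i"] by (simp add: power2_sum)
qed simp

lemma square_summable_cmult:
  assumes "square_summable N a"
  shows "square_summable N (\<lambda>i. c * a i)"
  using summable_on_cmult_right[of "\<lambda>i. (a i)\<^sup>2" N "c\<^sup>2"] assms
  by (simp add: square_summable_def power_mult_distrib)

lemma square_summable_sum:
  assumes "\<And>k. k \<in> F \<Longrightarrow> square_summable N (a k)"
  shows "square_summable N (\<lambda>i. \<Sum>k\<in>F. a k i)"
  using assms
proof (induction F rule: infinite_finite_induct)
  case (insert k F)
  then show ?case by (simp add: square_summable_add)
qed (simp_all add: square_summable_def)

lemma square_summable_indicator: "square_summable N (\<lambda>i. if i = k then c else 0)"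
  unfolding square_summable_def
  by (rule finite_nonzero_values_imp_summable_on) (auto intro: finite_subset[of _ "{k}"] split: if_splits)

text \<open>Polarisation: the product is half of (a + b)^2 - a^2 - b^2, a combination of three
  summable families.\<close>

lemma square_summable_mult:
  assumes "square_summable N a" "square_summable N b"
  shows "(\<lambda>i. a i * b i) summable_on N"
proof -
  have "(\<lambda>i. (1/2) * ((a i + b i)\<^sup>2 - (a i)\<^sup>2 - (b i)\<^sup>2)) summable_on N"
    using assms square_summable_add[OF assms] unfolding square_summable_def diff_conv_add_uminus
    by (intro summable_on_add summable_on_uminus[THEN iffD2] summable_on_cmult_right)
  then show ?thesis by (simp add: power2_sum)
qed

lemma abs_bounded_infsum:
  fixes f :: "'a \<Rightarrow> real"
  assumes "\<And>F. finite F \<Longrightarrow> F \<subseteq> N \<Longrightarrow> (\<Sum>i\<in>F. \<bar>f i\<bar>) \<le> C"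
  shows "f summable_on N" and "\<bar>\<Sum>\<^sub>\<infinity>i\<in>N. f i\<bar> \<le> C"
proof -
  have abs: "(\<lambda>i. \<bar>f i\<bar>) summable_on N"
    by (rule nonneg_bdd_above_summable_on) (use assms in \<open>auto intro!: bdd_aboveI[of _ C]\<close>)
  then show "f summable_on N"
    using abs_summable_summable[of f N] by simp
  have "\<bar>\<Sum>\<^sub>\<infinity>i\<in>N. f i\<bar> \<le> (\<Sum>\<^sub>\<infinity>i\<in>N. \<bar>f i\<bar>)"
    using norm_infsum_bound[of f N] abs by simp
  also have "\<dots> \<le> C"
    by (rule infsum_le_finite_sums[OF abs assms])
  finally show "\<bar>\<Sum>\<^sub>\<infinity>i\<in>N. f i\<bar> \<le> C" .
qed

lemma has_sum_sum:
  fixes f :: "'b \<Rightarrow> 'a \<Rightarrow> 'c::{topological_comm_monoid_add}"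
  assumes "\<And>k. k \<in> F \<Longrightarrow> (f k has_sum s k) A"
  shows "((\<lambda>x. \<Sum>k\<in>F. f k x) has_sum (\<Sum>k\<in>F. s k)) A"
  using assms by (induction F rule: infinite_finite_induct) (auto intro: has_sum_add)

lemma has_sum_single:
  fixes f :: "'a \<Rightarrow> 'b::topological_comm_monoid_add"
  assumes "k \<in> N" "\<And>j. j \<in> N \<Longrightarrow> j \<noteq> k \<Longrightarrow> f j = 0"
  shows "(f has_sum f k) N"
  using has_sum_cong_neutral[of N "{k}" f f "f k"] assms has_sum_finite[of "{k}" f] by auto

lemma infsum_single:
  fixes f :: "'a \<Rightarrow> 'b::{topological_comm_monoid_add, t2_space}"
  assumes "k \<in> N" "\<And>j. j \<in> N \<Longrightarrow> j \<noteq> k \<Longrightarrow> f j = 0"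
  shows "infsum f N = f k"
  using has_sum_single[of k N f] assms by (blast intro: infsumI)

text \<open>Bounds on partial sums pass to the limit, for the family and for its negative. Only
  signed partial sums are controlled here, not sums of absolute values.\<close>

lemma has_sum_abs_le:
  fixes f :: "'a \<Rightarrow> real"
  assumes "(f has_sum s) N" and "\<And>F. finite F \<Longrightarrow> F \<subseteq> N \<Longrightarrow> \<bar>sum f F\<bar> \<le> C"
  shows "\<bar>s\<bar> \<le> C"
proof -
  have *: "s \<le> C" if "(f has_sum s) N" "\<And>F. finite F \<Longrightarrow> F \<subseteq> N \<Longrightarrow> sum f F \<le> C" for f s
    using has_sum_le_finite_sums[OF that] .
  show ?thesis
    using *[OF assms(1)] *[of "\<lambda>i. - f i" "- s"] assms
    by (force simp: has_sum_uminus sum_negf)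
qed

text \<open>The matrix X is bounded by C as an operator on square summable families over N. Only
  finite sections occur, so no convergence is presupposed and the condition is closed in the
  entries; independent sets F and G allow a single row or column to be tested.\<close>

definition form_bound :: "'a set \<Rightarrow> ('a \<Rightarrow> 'a \<Rightarrow> real) \<Rightarrow> real \<Rightarrow> bool" where
  "form_bound N X C \<longleftrightarrow> (\<forall>F G t s. finite F \<and> F \<subseteq> N \<and> finite G \<and> G \<subseteq> N \<longrightarrow>
     \<bar>\<Sum>i\<in>F. \<Sum>j\<in>G. t i * s j * X i j\<bar> \<le> C * L2_set t F * L2_set s G)"

lemma form_boundD:
  assumes "form_bound N X C" "finite F" "F \<subseteq> N" "finite G" "G \<subseteq> N"
  shows "\<bar>\<Sum>i\<in>F. \<Sum>j\<in>G. t i * s j * X i j\<bar> \<le> C * L2_set t F * L2_set s G"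
  using assms by (simp add: form_bound_def)

text \<open>Vectors on F and G are extended by zero to the union of F and G, so square sections
  suffice.\<close>

lemma form_boundI:
  assumes "\<And>F t s. finite F \<Longrightarrow> F \<subseteq> N \<Longrightarrow>
    \<bar>\<Sum>i\<in>F. \<Sum>j\<in>F. t i * s j * X i j\<bar> \<le> C * L2_set t F * L2_set s F"
  shows "form_bound N X C"
  unfolding form_bound_def
proof (intro allI impI, elim conjE)
  fix F G :: "'a set" and t s :: "'a \<Rightarrow> real"
  assume FG: "finite F" "F \<subseteq> N" "finite G" "G \<subseteq> N"
  define t' s' where "t' = (\<lambda>i. if i \<in> F then t i else 0)" and "s' = (\<lambda>i. if i \<in> G then s i else 0)"
  have L2: "L2_set t' (F \<union> G) = L2_set t F" "L2_set s' (F \<union> G) = L2_set s G"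
    unfolding L2_set_def t'_def s'_def using FG
    by (auto intro!: arg_cong[of _ _ sqrt] sum.mono_neutral_cong_right)
  have "(\<Sum>i\<in>F \<union> G. \<Sum>j\<in>F \<union> G. t' i * s' j * X i j) = (\<Sum>i\<in>F. \<Sum>j\<in>F \<union> G. t' i * s' j * X i j)"
    using FG by (intro sum.mono_neutral_right) (auto simp: t'_def)
  also have "\<dots> = (\<Sum>i\<in>F. \<Sum>j\<in>G. t i * s j * X i j)"
    using FG by (intro sum.cong refl sum.mono_neutral_cong_right) (auto simp: t'_def s'_def)
  finally show "\<bar>\<Sum>i\<in>F. \<Sum>j\<in>G. t i * s j * X i j\<bar> \<le> C * L2_set t F * L2_set s G"
    using assms[of "F \<union> G" t' s'] FG by (simp add: L2)
qed

lemma L2_set_sgn_le: "L2_set (\<lambda>i. b i * sgn (c i)) F \<le> L2_set b F"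
  unfolding L2_set_def
  by (intro real_sqrt_le_mono sum_mono) (auto simp: power_mult_distrib sgn_if)

lemma form_bound_row_summable:
  assumes X: "form_bound N X C" and C: "0 \<le> C" and s: "square_summable N s" and i: "i \<in> N"
  shows "(\<lambda>j. s j * X i j) summable_on N"
proof (rule abs_bounded_infsum(1))
  fix G assume G: "finite G" "G \<subseteq> N"
  \<comment> \<open>With these signs every term is nonnegative, and the basis vector at i isolates
    the row.\<close>
  define s' where "s' = (\<lambda>j. s j * sgn (s j * X i j))"
  have "(\<Sum>j\<in>G. \<bar>s j * X i j\<bar>) = (\<Sum>k\<in>{i}. \<Sum>j\<in>G. 1 * s' j * X k j)"
    by (simp add: s'_def abs_sgn mult_ac)
  also have "\<dots> \<le> \<bar>\<Sum>k\<in>{i}. \<Sum>j\<in>G. 1 * s' j * X k j\<bar>"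
    by simp
  also have "\<dots> \<le> C * L2_set (\<lambda>_. 1) {i} * L2_set s' G"
    by (rule form_boundD[OF X _ _ G]) (use i in auto)
  also have "\<dots> \<le> C * l2_norm N s"
    using L2_set_sgn_le[of s "\<lambda>j. s j * X i j" G] L2_set_le_l2_norm[OF s G] C
    by (auto simp: s'_def intro!: mult_left_mono)
  finally show "(\<Sum>j\<in>G. \<bar>s j * X i j\<bar>) \<le> C * l2_norm N s" .
qed

text \<open>The value of the form at two vectors, summed over columns first, in the order in which
  \<open>conjug\<close> multiplies. The sum is iterated because the family indexed by pairs need not
  be summable for a bounded X.\<close>

definition form :: "'a set \<Rightarrow> ('a \<Rightarrow> 'a \<Rightarrow> real) \<Rightarrow> ('a \<Rightarrow> real) \<Rightarrow> ('a \<Rightarrow> real) \<Rightarrow> real" where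
  "form N X t s = (\<Sum>\<^sub>\<infinity>i\<in>N. t i * (\<Sum>\<^sub>\<infinity>j\<in>N. s j * X i j))"

text \<open>With finitely many rows the sum over columns converges row by row, so the bounds on
  finite sections pass to the limit.\<close>

lemma form_bound_finite_row:
  assumes X: "form_bound N X C" and C: "0 \<le> C" and s: "square_summable N s"
    and F: "finite F" "F \<subseteq> N"
  shows "\<bar>\<Sum>i\<in>F. t i * (\<Sum>\<^sub>\<infinity>j\<in>N. s j * X i j)\<bar> \<le> C * L2_set t F * l2_norm N s"
proof (rule has_sum_abs_le)
  show "((\<lambda>j. \<Sum>i\<in>F. t i * (s j * X i j)) has_sum (\<Sum>i\<in>F. t i * (\<Sum>\<^sub>\<infinity>j\<in>N. s j * X i j))) N"
    using F form_bound_row_summable[OF X C s]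
    by (intro has_sum_sum has_sum_cmult_right has_sum_infsum) auto
  fix G assume G: "finite G" "G \<subseteq> N"
  have "\<bar>\<Sum>j\<in>G. \<Sum>i\<in>F. t i * (s j * X i j)\<bar> = \<bar>\<Sum>i\<in>F. \<Sum>j\<in>G. t i * s j * X i j\<bar>"
    by (subst sum.swap) (simp add: mult.assoc)
  also have "\<dots> \<le> C * L2_set t F * L2_set s G"
    by (rule form_boundD[OF X F G])
  also have "\<dots> \<le> C * L2_set t F * l2_norm N s"
    using C L2_set_le_l2_norm[OF s G] by (intro mult_left_mono) auto
  finally show "\<bar>\<Sum>j\<in>G. \<Sum>i\<in>F. t i * (s j * X i j)\<bar> \<le> C * L2_set t F * l2_norm N s" .
qed

lemma form_bound_summable:
  assumes X: "form_bound N X C" and C: "0 \<le> C" and s: "square_summable N s"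
    and t: "square_summable N t"
  shows "(\<lambda>i. t i * (\<Sum>\<^sub>\<infinity>j\<in>N. s j * X i j)) summable_on N"
    and "\<bar>form N X t s\<bar> \<le> C * l2_norm N t * l2_norm N s"
proof -
  have "(\<Sum>i\<in>F. \<bar>t i * (\<Sum>\<^sub>\<infinity>j\<in>N. s j * X i j)\<bar>) \<le> C * l2_norm N t * l2_norm N s"
    if F: "finite F" "F \<subseteq> N" for F
  proof -
    \<comment> \<open>The sign trick again, now on rows whose sums over the columns are already
      formed.\<close>
    define t' where "t' = (\<lambda>i. t i * sgn (t i * (\<Sum>\<^sub>\<infinity>j\<in>N. s j * X i j)))"
    have "(\<Sum>i\<in>F. \<bar>t i * (\<Sum>\<^sub>\<infinity>j\<in>N. s j * X i j)\<bar>) = (\<Sum>i\<in>F. t' i * (\<Sum>\<^sub>\<infinity>j\<in>N. s j * X i j))"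
      by (simp only: t'_def abs_sgn mult_ac)
    also have "\<dots> \<le> C * L2_set t' F * l2_norm N s"
      using form_bound_finite_row[OF X C s F, of t'] by linarith
    also have "\<dots> \<le> C * l2_norm N t * l2_norm N s"
      using L2_set_sgn_le[of t "\<lambda>i. t i * (\<Sum>\<^sub>\<infinity>j\<in>N. s j * X i j)" F] L2_set_le_l2_norm[OF t F] C
      by (intro mult_right_mono mult_left_mono) (auto simp: t'_def)
    finally show ?thesis .
  qed
  from abs_bounded_infsum[OF this]
  show "(\<lambda>i. t i * (\<Sum>\<^sub>\<infinity>j\<in>N. s j * X i j)) summable_on N"
    and "\<bar>form N X t s\<bar> \<le> C * l2_norm N t * l2_norm N s"
    by (simp_all add: form_def)
qed

text \<open>Bilinearity is wanted for finite combinations: a test vector for a compression becomes a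
  combination of columns of the compressing matrix.\<close>

lemma form_sum:
  assumes X: "form_bound N X C" and C: "0 \<le> C"
    and s: "\<And>l. l \<in> G \<Longrightarrow> square_summable N (s l)" and t: "\<And>k. k \<in> F \<Longrightarrow> square_summable N (t k)"
  shows "form N X (\<lambda>i. \<Sum>k\<in>F. a k * t k i) (\<lambda>j. \<Sum>l\<in>G. b l * s l j) =
    (\<Sum>k\<in>F. \<Sum>l\<in>G. a k * b l * form N X (t k) (s l))"
proof -
  have inner: "(\<Sum>\<^sub>\<infinity>j\<in>N. (\<Sum>l\<in>G. b l * s l j) * X i j) = (\<Sum>l\<in>G. b l * (\<Sum>\<^sub>\<infinity>j\<in>N. s l j * X i j))"
    if "i \<in> N" for i
  proof (rule infsumI)
    have "((\<lambda>j. \<Sum>l\<in>G. b l * (s l j * X i j)) has_sum (\<Sum>l\<in>G. b l * (\<Sum>\<^sub>\<infinity>j\<in>N. s l j * X i j))) N"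
      using that form_bound_row_summable[OF X C s]
      by (intro has_sum_sum has_sum_cmult_right has_sum_infsum) auto
    then show "((\<lambda>j. (\<Sum>l\<in>G. b l * s l j) * X i j) has_sum
        (\<Sum>l\<in>G. b l * (\<Sum>\<^sub>\<infinity>j\<in>N. s l j * X i j))) N"
      by (simp add: sum_distrib_right mult.assoc)
  qed
  have "((\<lambda>i. \<Sum>k\<in>F. \<Sum>l\<in>G. a k * b l * (t k i * (\<Sum>\<^sub>\<infinity>j\<in>N. s l j * X i j))) has_sum
      (\<Sum>k\<in>F. \<Sum>l\<in>G. a k * b l * form N X (t k) (s l))) N"
    unfolding form_def using form_bound_summable(1)[OF X C s t]
    by (intro has_sum_sum has_sum_cmult_right has_sum_infsum) auto
  also have "(\<lambda>i. \<Sum>k\<in>F. \<Sum>l\<in>G. a k * b l * (t k i * (\<Sum>\<^sub>\<infinity>j\<in>N. s l j * X i j))) =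
      (\<lambda>i. (\<Sum>k\<in>F. a k * t k i) * (\<Sum>l\<in>G. b l * (\<Sum>\<^sub>\<infinity>j\<in>N. s l j * X i j)))"
    by (simp add: sum_product mult_ac)
  finally have "(\<Sum>\<^sub>\<infinity>i\<in>N. (\<Sum>k\<in>F. a k * t k i) * (\<Sum>l\<in>G. b l * (\<Sum>\<^sub>\<infinity>j\<in>N. s l j * X i j))) =
      (\<Sum>k\<in>F. \<Sum>l\<in>G. a k * b l * form N X (t k) (s l))"
    by (rule infsumI)
  then show ?thesis
    unfolding form_def by (simp add: inner cong: infsum_cong)
qed

lemma form_add_cmult:
  assumes "form_bound N X C" "0 \<le> C" "square_summable N s" "square_summable N t"
    "square_summable N t'"
  shows "form N X (\<lambda>i. t i + c * t' i) s = form N X t s + c * form N X t' s"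
    and "form N X s (\<lambda>i. t i + c * t' i) = form N X s t + c * form N X s t'"
  \<comment> \<open>A sum of two vectors is a combination over the index set {True, False}; the
    fixed vector is a combination over a single point.\<close>
  using form_sum[OF assms(1,2), of "{()}" "\<lambda>_. s" "{True, False}" "\<lambda>k. if k then t else t'"
      "\<lambda>k. if k then 1 else c" "\<lambda>_. 1"]
    form_sum[OF assms(1,2), of "{True, False}" "\<lambda>k. if k then t else t'" "{()}" "\<lambda>_. s"
      "\<lambda>_. 1" "\<lambda>k. if k then 1 else c"] assms(3-5)
  by simp_all

text \<open>The coefficients are the entries of the Gram matrix of the vectors; for the columns of a
  matrix b this is b* b.\<close>

lemma l2_norm_sum_power2:
  assumes "\<And>k. k \<in> F \<Longrightarrow> square_summable N (s k)"
  shows "(l2_norm N (\<lambda>i. \<Sum>k\<in>F. a k * s k i))\<^sup>2 =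
    (\<Sum>k\<in>F. \<Sum>l\<in>F. a k * a l * (\<Sum>\<^sub>\<infinity>i\<in>N. s k i * s l i))"
proof -
  have "((\<lambda>i. \<Sum>k\<in>F. \<Sum>l\<in>F. a k * a l * (s k i * s l i)) has_sum
      (\<Sum>k\<in>F. \<Sum>l\<in>F. a k * a l * (\<Sum>\<^sub>\<infinity>i\<in>N. s k i * s l i))) N"
    using assms by (intro has_sum_sum has_sum_cmult_right has_sum_infsum square_summable_mult) auto
  also have "(\<lambda>i. \<Sum>k\<in>F. \<Sum>l\<in>F. a k * a l * (s k i * s l i)) = (\<lambda>i. (\<Sum>k\<in>F. a k * s k i)\<^sup>2)"
    by (simp add: power2_eq_square sum_product mult_ac)
  finally show ?thesis
    by (simp add: l2_norm_power2 infsumI)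
qed

section \<open>First order conditions at vectors where a contraction attains its norm\<close>

lemma linear_term_zero:
  fixes A B :: real
  assumes "\<And>c. 2 * c * A + c\<^sup>2 * B \<le> 0"
  shows "A = 0"
proof (rule ccontr)
  assume "A \<noteq> 0"
  \<comment> \<open>Both k and \<open>2 * k + B\<close> are positive for either sign of B, so at c =
    A / k the linear term dominates.\<close>
  define k where "k = 1 + \<bar>B\<bar>"
  have k: "k > 0" "2 * k + B > 0"
    using abs_ge_minus_self[of B] abs_ge_zero[of B] unfolding k_def distrib_left by linarith+
  define c where "c = A / k"
  have "2 * c * A + c\<^sup>2 * B = A\<^sup>2 * (2 * k + B) / k\<^sup>2"
    using k(1) unfolding c_def by (simp add: field_simps power2_eq_square)
  also have "\<dots> > 0"
    using \<open>A \<noteq> 0\<close> k by (intro divide_pos_pos mult_pos_pos) auto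
  finally show False using assms[of c] by simp
qed

lemma l2_norm_perturb:
  assumes "square_summable N t" "l2_norm N t = 1" "k \<in> N"
  shows "(l2_norm N (\<lambda>i. t i + c * (if i = k then 1 else 0)))\<^sup>2 = 1 + 2 * c * t k + c\<^sup>2"
proof -
  let ?e = "\<lambda>i. if i = k then 1 else (0::real)"
  have ee: "(\<Sum>\<^sub>\<infinity>i\<in>N. ?e i * ?e i) = 1" and te: "(\<Sum>\<^sub>\<infinity>i\<in>N. t i * ?e i) = t k"
    and et: "(\<Sum>\<^sub>\<infinity>i\<in>N. ?e i * t i) = t k"
    using \<open>k \<in> N\<close> by (subst infsum_single[of k]; auto)+
  have tt: "(\<Sum>\<^sub>\<infinity>i\<in>N. t i * t i) = 1"
    using l2_norm_power2[of N t] assms(2) by (simp add: power2_eq_square)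
  have "(l2_norm N (\<lambda>i. \<Sum>b\<in>{True, False}. (if b then 1 else c) * (if b then t else ?e) i))\<^sup>2 =
      1 + 2 * c * t k + c\<^sup>2"
    using assms(1) by (subst l2_norm_sum_power2)
      (auto simp: square_summable_indicator ee te et tt power2_eq_square algebra_simps)
  then show ?thesis by simp
qed

text \<open>Both equations come from the first order term of \<open>\<bar>\<langle>X s, t\<rangle>\<bar> \<le> \<parallel>s\<parallel> \<parallel>t\<parallel>\<close> when \<open>t\<close> or \<open>s\<close> is
  perturbed by a multiple of a basis vector.\<close>

lemma contraction_attains:
  assumes X: "form_bound N X 1" and s: "square_summable N s" "l2_norm N s = 1"
    and t: "square_summable N t" "l2_norm N t = 1"
    and attains: "form N X t s = 1" and k: "k \<in> N"
  shows "(\<Sum>\<^sub>\<infinity>j\<in>N. s j * X k j) = t k" and "(\<Sum>\<^sub>\<infinity>i\<in>N. t i * X i k) = s k"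
proof -
  let ?e = "\<lambda>i. if i = k then 1 else (0::real)"
  have *: "y = u k" if u: "square_summable N u" "l2_norm N u = 1"
    and bd: "\<And>c. \<bar>1 + c * y\<bar> \<le> l2_norm N (\<lambda>i. u i + c * ?e i)" for u and y :: real
  proof -
    have "2 * c * (y - u k) + c\<^sup>2 * (y\<^sup>2 - 1) \<le> 0" for c
    proof -
      have "(1 + c * y)\<^sup>2 \<le> 1 + 2 * c * u k + c\<^sup>2"
        using power_mono[OF bd[of c] abs_ge_zero, of 2] l2_norm_perturb[OF u k, of c] by simp
      then show ?thesis by (simp add: power2_eq_square algebra_simps)
    qed
    from linear_term_zero[OF this] show ?thesis by simp
  qed
  have e: "square_summable N ?e" by (rule square_summable_indicator)
  have sq: "square_summable N (\<lambda>i. u i + c * ?e i)" if "square_summable N u" for u c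
    by (intro square_summable_add that square_summable_cmult e)
  have row: "form N X ?e s = (\<Sum>\<^sub>\<infinity>j\<in>N. s j * X k j)"
    unfolding form_def using k by (subst infsum_single[of k]) auto
  have col: "form N X t ?e = (\<Sum>\<^sub>\<infinity>i\<in>N. t i * X i k)"
  proof -
    have "(\<Sum>\<^sub>\<infinity>j\<in>N. ?e j * X i j) = X i k" for i
      using k by (subst infsum_single[of k]) auto
    then show ?thesis by (simp add: form_def)
  qed
  show "(\<Sum>\<^sub>\<infinity>j\<in>N. s j * X k j) = t k"
  proof (rule *[OF t])
    fix c
    show "\<bar>1 + c * (\<Sum>\<^sub>\<infinity>j\<in>N. s j * X k j)\<bar> \<le> l2_norm N (\<lambda>i. t i + c * ?e i)"
      using form_bound_summable(2)[OF X zero_le_one s(1) sq[OF t(1), of c]] s(2)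
        form_add_cmult(1)[OF X zero_le_one s(1) t(1) e, of c] by (simp only: row attains)
  qed
  show "(\<Sum>\<^sub>\<infinity>i\<in>N. t i * X i k) = s k"
  proof (rule *[OF s])
    fix c
    show "\<bar>1 + c * (\<Sum>\<^sub>\<infinity>i\<in>N. t i * X i k)\<bar> \<le> l2_norm N (\<lambda>i. s i + c * ?e i)"
      using form_bound_summable(2)[OF X zero_le_one sq[OF s(1), of c] t(1)] t(2)
        form_add_cmult(2)[OF X zero_le_one t(1) s(1) e, of c] by (simp only: col attains)
  qed
qed


section \<open>Multiplication by scalar matrices\<close>

lemma op_norm_le:
  assumes "op_bound F G a C"
  shows "op_norm F G a \<le> C"
  unfolding op_norm_def using assms
  by (intro cInf_lower bdd_belowI[of _ 0]) (auto simp: op_bound_def)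

text \<open>The infimum defining the norm is attained: the estimate for a vector of positive norm
  can be divided by that norm, and for a vector of norm zero the given bound C already forces the
  left side to vanish.\<close>

lemma op_bound_op_norm:
  assumes "op_bound F G a C"
  shows "op_bound F G a (op_norm F G a)"
  unfolding op_bound_def
proof (intro conjI allI)
  have ne: "{C. op_bound F G a C} \<noteq> {}" using assms by blast
  then show "0 \<le> op_norm F G a"
    unfolding op_norm_def by (rule cInf_greatest) (simp add: op_bound_def)
  fix \<xi>
  let ?u = "L2_set (\<lambda>i. norm (\<Sum>j\<in>G. a i j * \<xi> j)) F" and ?v = "L2_set (\<lambda>j. norm (\<xi> j)) G"
  have le: "?u \<le> C' * ?v" if "op_bound F G a C'" for C'
    using that by (simp add: op_bound_def)
  show "?u \<le> op_norm F G a * ?v"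
  proof (cases "?v = 0")
    case True
    then show ?thesis using le[OF assms] by simp
  next
    case False
    then have v: "?v > 0" by (simp add: order_less_le)
    have "?u / ?v \<le> op_norm F G a"
      unfolding op_norm_def using ne le v by (intro cInf_greatest) (auto simp: divide_le_eq)
    then show ?thesis using v by (simp add: divide_le_eq)
  qed
qed

lemma abs_sum_mult_le_L2_set: "\<bar>\<Sum>i\<in>F. t i * s i\<bar> \<le> L2_set t F * L2_set s F"
  using L2_set_mult_ineq[of t s F] sum_abs[of "\<lambda>i. t i * s i" F] by (simp add: abs_mult)

lemma L2_set_abs [simp]: "L2_set (\<lambda>i. \<bar>f i :: real\<bar>) A = L2_set f A"
  by (simp add: L2_set_def)

text \<open>Duality: one direction is Cauchy-Schwarz, and in the other the image of s is paired with
  itself. The bilinear form treats rows and columns alike and is the shape in which functionals are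
  applied.\<close>

lemma op_bound_real_iff:
  fixes a :: "'a \<Rightarrow> 'b \<Rightarrow> real"
  shows "op_bound F G a C \<longleftrightarrow> 0 \<le> C \<and>
    (\<forall>t s. \<bar>\<Sum>i\<in>F. \<Sum>j\<in>G. t i * s j * a i j\<bar> \<le> C * L2_set t F * L2_set s G)"
proof -
  have eq: "(\<Sum>i\<in>F. \<Sum>j\<in>G. t i * s j * a i j) = (\<Sum>i\<in>F. t i * (\<Sum>j\<in>G. a i j * s j))" for t s
    by (simp add: sum_distrib_left mult_ac)
  have "\<bar>\<Sum>i\<in>F. \<Sum>j\<in>G. t i * s j * a i j\<bar> \<le> C * L2_set t F * L2_set s G"
    if "op_bound F G a C" for t s
  proof -
    have "\<bar>\<Sum>i\<in>F. \<Sum>j\<in>G. t i * s j * a i j\<bar> \<le> L2_set t F * L2_set (\<lambda>i. \<Sum>j\<in>G. a i j * s j) F"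
      unfolding eq by (rule abs_sum_mult_le_L2_set)
    also have "\<dots> \<le> L2_set t F * (C * L2_set s G)"
      using that by (intro mult_left_mono) (auto simp: op_bound_def)
    finally show ?thesis by (simp add: mult_ac)
  qed
  moreover have "L2_set (\<lambda>i. \<Sum>j\<in>G. a i j * s j) F \<le> C * L2_set s G"
    if "0 \<le> C" and le: "\<And>t s. \<bar>\<Sum>i\<in>F. \<Sum>j\<in>G. t i * s j * a i j\<bar> \<le> C * L2_set t F * L2_set s G" for s
  proof -
    define v where "v i = (\<Sum>j\<in>G. a i j * s j)" for i
    have "L2_set v F * L2_set v F = (\<Sum>i\<in>F. v i * v i)"
      using L2_set_power2[of v F] by (simp add: power2_eq_square)
    also have "\<dots> \<le> L2_set v F * (C * L2_set s G)"
      using abs_le_D1[OF le[of v s]] unfolding eq v_def[symmetric] by (simp only: mult_ac)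
    finally show ?thesis
      unfolding v_def[symmetric] using \<open>0 \<le> C\<close>
      by (cases "L2_set v F = 0") (simp_all add: mult_le_cancel_left order_less_le)
  qed
  ultimately show ?thesis
    by (auto simp: op_bound_def)
qed

text \<open>A single functional is the case m = 1 of \<open>pair_mat\<close>, whose indices are
  pairs with first component 0; this fact and the next two remove that component.\<close>

lemma lessThan_Suc_0_Times: "{..<Suc 0} \<times> F = Pair 0 ` F"
  by (auto simp: image_iff)

lemma L2_set_unit_times: "L2_set f ({..<Suc 0} \<times> F) = L2_set (\<lambda>i. f (0, i)) F"
  by (simp add: lessThan_Suc_0_Times L2_set_def sum.reindex inj_on_def)

lemma sum_unit_times: "sum f ({..<Suc 0} \<times> F) = (\<Sum>i\<in>F. f (0, i))"
  by (simp add: lessThan_Suc_0_Times sum.reindex inj_on_def)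

lemma form_bound_transpose:
  assumes "form_bound N X C"
  shows "form_bound N (\<lambda>i j. X j i) C"
  unfolding form_bound_def
proof (intro allI impI, elim conjE)
  fix F G and t s :: "'a \<Rightarrow> real"
  assume FG: "finite F" "F \<subseteq> N" "finite G" "G \<subseteq> N"
  have "(\<Sum>i\<in>F. \<Sum>j\<in>G. t i * s j * X j i) = (\<Sum>j\<in>G. \<Sum>i\<in>F. s j * t i * X j i)"
    by (subst sum.swap) (simp add: mult_ac)
  then show "\<bar>\<Sum>i\<in>F. \<Sum>j\<in>G. t i * s j * X j i\<bar> \<le> C * L2_set t F * L2_set s G"
    using form_boundD[OF assms FG(3,4,1,2), of s t] by (simp add: mult_ac)
qed


section \<open>Weak* convergence in a dual operator space\<close>

context
  fixes E :: "(real, 'e::ab_group_add) opspace"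
  assumes E: "dual_operator_space E"
begin

lemma operator_space: "operator_space E"
  using E by (simp add: dual_operator_space_def)

lemma scal_module: "module (scal E)"
  using operator_space by (simp add: operator_space_def module_iff_vector_space)

lemmas scal_simps [simp] = module.scale_zero_left[OF scal_module]
  module.scale_zero_right[OF scal_module] module.scale_one[OF scal_module]

lemma predual_linear: "\<phi> \<in> predual E \<Longrightarrow> Vector_Spaces.linear (scal E) (*) \<phi>"
  using E by (auto simp: dual_operator_space_def)

lemma predual_add: "\<phi> \<in> predual E \<Longrightarrow> \<phi> (x + y) = \<phi> x + \<phi> y"
  and predual_scal: "\<phi> \<in> predual E \<Longrightarrow> \<phi> (scal E c x) = c * \<phi> x"
  using predual_linear[of \<phi>]
  by (auto simp: linear_iff_module_hom module_hom_iff)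

lemma predual_0: "\<phi> \<in> predual E \<Longrightarrow> \<phi> 0 = 0"
  using predual_scal[of \<phi> 0 0] by simp

lemma predual_diff: "\<phi> \<in> predual E \<Longrightarrow> \<phi> (x - y) = \<phi> x - \<phi> y"
  using predual_add[of \<phi> "x - y" y] by simp

lemma predual_sum: "\<phi> \<in> predual E \<Longrightarrow> \<phi> (\<Sum>i\<in>F. x i) = (\<Sum>i\<in>F. \<phi> (x i))"
  by (induction F rule: infinite_finite_induct) (auto simp: predual_0 predual_add)

lemma mnorm_cong: "(\<And>i j. i < n \<Longrightarrow> j < n \<Longrightarrow> x i j = y i j) \<Longrightarrow> mnorm E n x = mnorm E n y"
  and mnorm_nonneg: "0 \<le> mnorm E n x"
  and mnorm_eq_0_iff: "mnorm E n x = 0 \<longleftrightarrow> (\<forall>i<n. \<forall>j<n. x i j = 0)"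
  and mnorm_scal: "mnorm E n (\<lambda>i j. scal E c (x i j)) = norm c * mnorm E n x"
  and mnorm_bimod: "mnorm E m (bimod E n a x b) \<le>
    op_norm {..<m} {..<n} a * mnorm E n x * op_norm {..<n} {..<m} b"
  and mnorm_diag_sum: "mnorm E (m + n) (diag_sum m n x y) = max (mnorm E m x) (mnorm E n y)"
  using operator_space by (simp_all add: operator_space_def)

lemma predual_bounded:
  assumes "\<phi> \<in> predual E"
  obtains C where "0 \<le> C" "\<And>e. \<bar>\<phi> e\<bar> \<le> C * mnorm E 1 (\<lambda>_ _. e)"
proof -
  obtain C where C: "\<And>e. \<bar>\<phi> e\<bar> \<le> C * mnorm E 1 (\<lambda>_ _. e)"
    using E assms unfolding dual_operator_space_def by force
  have "\<bar>\<phi> e\<bar> \<le> max C 0 * mnorm E 1 (\<lambda>_ _. e)" for e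
  proof -
    have "C * mnorm E 1 (\<lambda>_ _. e) \<le> max C 0 * mnorm E 1 (\<lambda>_ _. e)"
      by (intro mult_right_mono mnorm_nonneg) simp
    then show ?thesis using C[of e] by linarith
  qed
  then show ?thesis using that[of "max C 0"] by simp
qed

text \<open>The representation clause of \<open>dual_operator_space\<close> as a rule. It is the
  source of limits in E: a bounded linear map on the predual is evaluation at a unique
  element.\<close>

lemma predual_represents:
  fixes T :: "('e \<Rightarrow> real) \<Rightarrow> real"
  assumes "\<And>\<phi> \<psi>. \<phi> \<in> predual E \<Longrightarrow> \<psi> \<in> predual E \<Longrightarrow> T (\<lambda>e. \<phi> e + \<psi> e) = T \<phi> + T \<psi>"
    and "\<And>c \<phi>. \<phi> \<in> predual E \<Longrightarrow> T (\<lambda>e. c * \<phi> e) = c * T \<phi>"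
    and "\<And>\<phi>. \<phi> \<in> predual E \<Longrightarrow> \<bar>T \<phi>\<bar> \<le> C * cb_norm E 1 (\<lambda>_ _. \<phi>)"
  shows "\<exists>!e. \<forall>\<phi>\<in>predual E. T \<phi> = \<phi> e"
proof -
  have rep: "\<forall>T. (\<forall>\<phi>\<in>predual E. \<forall>\<psi>\<in>predual E. T (\<lambda>e. \<phi> e + \<psi> e) = T \<phi> + T \<psi>) \<and>
          (\<forall>c. \<forall>\<phi>\<in>predual E. T (\<lambda>e. c * \<phi> e) = c * T \<phi>) \<and>
          (\<exists>C. \<forall>\<phi>\<in>predual E. norm (T \<phi>) \<le> C * cb_norm E 1 (\<lambda>_ _. \<phi>))
          \<longrightarrow> (\<exists>!e. \<forall>\<phi>\<in>predual E. T \<phi> = \<phi> e)"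
    using E unfolding dual_operator_space_def by (elim conjE) assumption
  show ?thesis
    by (rule rep[rule_format]) (use assms in \<open>auto intro!: exI[of _ C]\<close>)
qed

text \<open>The bimodule axiom with m = 1: x is multiplied by the row t and the column s, whose
  operator norms are at most their Euclidean norms.\<close>

lemma mnorm_form_le:
  "mnorm E 1 (\<lambda>_ _. \<Sum>i<n. \<Sum>j<n. scal E (t i * s j) (x i j)) \<le>
    L2_set t {..<n} * mnorm E n x * L2_set s {..<n}"
proof -
  have row: "op_bound {..<1::nat} {..<n} (\<lambda>_ i. t i) (L2_set t {..<n})"
    using abs_sum_mult_le_L2_set[of t _ "{..<n}"] by (simp add: op_bound_def lessThan_Suc)
  have col: "op_norm {..<n} {..<1::nat} (\<lambda>j _. s j) \<le> L2_set s {..<n}"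
  proof (rule op_norm_le)
    have "L2_set (\<lambda>i. \<bar>s i * \<xi> 0\<bar>) {..<n} = L2_set s {..<n} * \<bar>\<xi> (0::nat)\<bar>" for \<xi>
      by (simp add: L2_set_left_distrib) (simp add: L2_set_def power_mult_distrib)
    then show "op_bound {..<n} {..<1::nat} (\<lambda>j _. s j) (L2_set s {..<n})"
      by (simp add: op_bound_def lessThan_Suc)
  qed
  have "mnorm E 1 (bimod E n (\<lambda>_ i. t i) x (\<lambda>j _. s j)) \<le>
      op_norm {..<1::nat} {..<n} (\<lambda>_ i. t i) * mnorm E n x * op_norm {..<n} {..<1::nat} (\<lambda>j _. s j)"
    by (rule mnorm_bimod)
  also have "\<dots> \<le> op_norm {..<1::nat} {..<n} (\<lambda>_ i. t i) * mnorm E n x * L2_set s {..<n}"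
  proof (rule mult_left_mono[OF col mult_nonneg_nonneg[OF _ mnorm_nonneg]])
    from op_bound_op_norm[OF row] show "0 \<le> op_norm {..<1::nat} {..<n} (\<lambda>_ i. t i)"
      unfolding op_bound_def by (rule conjunct1)
  qed
  also have "\<dots> \<le> L2_set t {..<n} * mnorm E n x * L2_set s {..<n}"
    by (intro mult_right_mono op_norm_le row mnorm_nonneg L2_set_nonneg)
  finally show ?thesis
    by (simp add: bimod_def)
qed

lemma predual_form_le:
  assumes \<phi>: "\<phi> \<in> predual E" and C: "0 \<le> C" "\<And>e. \<bar>\<phi> e\<bar> \<le> C * mnorm E 1 (\<lambda>_ _. e)"
  shows "\<bar>\<Sum>i<n. \<Sum>j<n. t i * s j * \<phi> (x i j)\<bar> \<le>
    C * mnorm E n x * L2_set t {..<n} * L2_set s {..<n}"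
proof -
  have "(\<Sum>i<n. \<Sum>j<n. t i * s j * \<phi> (x i j)) = \<phi> (\<Sum>i<n. \<Sum>j<n. scal E (t i * s j) (x i j))"
    using \<phi> by (simp add: predual_sum predual_scal)
  then show ?thesis
    using C(2)[of "\<Sum>i<n. \<Sum>j<n. scal E (t i * s j) (x i j)"]
      mult_left_mono[OF mnorm_form_le[where n = n and t = t and s = s and x = x] C(1)] by (simp add: mult_ac)
qed

text \<open>A bounded functional is completely bounded with the same constant. This shows that the
  supremum in \<open>cb_norm\<close> is taken over a set bounded above.\<close>

lemma predual_pair_norm_le:
  assumes \<phi>: "\<phi> \<in> predual E" and C: "0 \<le> C" "\<And>e. \<bar>\<phi> e\<bar> \<le> C * mnorm E 1 (\<lambda>_ _. e)"
  shows "pair_norm 1 n (\<lambda>_ _. \<phi>) x \<le> C * mnorm E n x"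
  unfolding pair_norm_def
proof (rule op_norm_le, unfold op_bound_real_iff, intro conjI allI)
  show "0 \<le> C * mnorm E n x" using C(1) mnorm_nonneg by simp
  fix t s :: "nat \<times> nat \<Rightarrow> real"
  show "\<bar>\<Sum>i\<in>{..<1} \<times> {..<n}. \<Sum>j\<in>{..<1} \<times> {..<n}. t i * s j * pair_mat (\<lambda>_ _. \<phi>) x i j\<bar> \<le>
      C * mnorm E n x * L2_set t ({..<1} \<times> {..<n}) * L2_set s ({..<1} \<times> {..<n})"
    unfolding One_nat_def sum_unit_times L2_set_unit_times pair_mat_def
    using predual_form_le[OF assms] by simp
qed

lemma predual_le_cb_norm:
  assumes \<phi>: "\<phi> \<in> predual E"
  shows "\<bar>\<phi> e\<bar> \<le> cb_norm E 1 (\<lambda>_ _. \<phi>) * mnorm E 1 (\<lambda>_ _. e)"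
proof (cases "e = 0")
  case True
  have "mnorm E 1 (\<lambda>_ _. 0) = 0"
    by (simp add: mnorm_eq_0_iff)
  then show ?thesis using True \<phi> by (simp add: predual_0)
next
  case False
  obtain C where C: "0 \<le> C" "\<And>e. \<bar>\<phi> e\<bar> \<le> C * mnorm E 1 (\<lambda>_ _. e)"
    using predual_bounded[OF \<phi>] by blast
  let ?r = "mnorm E 1 (\<lambda>_ _. e)"
  have "?r \<noteq> 0"
    using False by (simp add: mnorm_eq_0_iff)
  then have r: "?r > 0" using mnorm_nonneg[of 1 "\<lambda>_ _. e"] by simp
  let ?x = "\<lambda>_ _. scal E (1 / ?r) e"
  have "mnorm E 1 ?x = norm (1 / ?r) * ?r"
    by (rule mnorm_scal)
  with r have x: "mnorm E 1 ?x = 1" by simp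
  have "\<bar>\<phi> (scal E (1 / ?r) e)\<bar> \<le> pair_norm 1 1 (\<lambda>_ _. \<phi>) ?x"
  proof -
    have "op_bound ({..<1} \<times> {..<1}) ({..<1} \<times> {..<1}) (pair_mat (\<lambda>_ _. \<phi>) ?x) \<bar>\<phi> (scal E (1 / ?r) e)\<bar>"
      by (simp add: op_bound_def sum_unit_times L2_set_unit_times pair_mat_def lessThan_Suc
          abs_mult)
    from op_bound_op_norm[OF this, folded pair_norm_def, unfolded op_bound_def, THEN conjunct2,
        rule_format, of "\<lambda>_. 1"]
    show ?thesis
      by (simp add: sum_unit_times L2_set_unit_times pair_mat_def lessThan_Suc)
  qed
  also have "\<dots> \<le> cb_norm E 1 (\<lambda>_ _. \<phi>)"
  proof -
    have "pair_norm 1 n (\<lambda>_ _. \<phi>) x \<le> C" if "mnorm E n x \<le> 1" for n x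
      using predual_pair_norm_le[OF \<phi> C, of n x] mult_left_mono[OF that C(1)] by simp
    then have "bdd_above ((\<lambda>(n, x). pair_norm 1 n (\<lambda>_ _. \<phi>) x) ` {(n, x). mnorm E n x \<le> 1})"
      by (intro bdd_aboveI[of _ C]) auto
    from cSUP_upper[OF _ this, of "(1, ?x)"] show ?thesis
      unfolding cb_norm_def using x by simp
  qed
  finally show ?thesis
    using r \<phi> by (simp add: predual_scal abs_mult divide_le_eq)
qed

text \<open>The zero map on the predual is represented by one element only, and both 0 and
  \<open>e - e'\<close> represent it.\<close>

lemma predual_separates:
  assumes "\<And>\<phi>. \<phi> \<in> predual E \<Longrightarrow> \<phi> e = \<phi> e'"
  shows "e = e'"
proof -
  have "\<exists>!e. \<forall>\<phi>\<in>predual E. 0 = \<phi> e"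
    by (rule predual_represents[where T = "\<lambda>_. 0" and C = 0]) simp_all
  moreover have "\<forall>\<phi>\<in>predual E. 0 = \<phi> (e - e')" "\<forall>\<phi>\<in>predual E. 0 = \<phi> 0"
    using assms by (auto simp: predual_0 predual_diff)
  ultimately have "e - e' = 0"
    by blast
  then show ?thesis by simp
qed

lemma ws_sum_eqI:
  assumes "\<And>\<phi>. \<phi> \<in> predual E \<Longrightarrow> ((\<lambda>a. \<phi> (f a)) has_sum \<phi> e) A"
  shows "ws_sum E f A = e"
  unfolding ws_sum_def
proof (rule the_equality)
  show "\<forall>\<phi>\<in>predual E. ((\<lambda>a. \<phi> (f a)) has_sum \<phi> e) A" using assms by blast
  show "e' = e" if "\<forall>\<phi>\<in>predual E. ((\<lambda>a. \<phi> (f a)) has_sum \<phi> e') A" for e'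
    using that assms has_sum_unique by (intro predual_separates) blast
qed

lemma predual_ws_sum:
  assumes f: "\<And>\<phi>. \<phi> \<in> predual E \<Longrightarrow> (\<lambda>a. \<phi> (f a)) summable_on A"
    and C: "\<And>\<phi>. \<phi> \<in> predual E \<Longrightarrow> \<bar>\<Sum>\<^sub>\<infinity>a\<in>A. \<phi> (f a)\<bar> \<le> C * cb_norm E 1 (\<lambda>_ _. \<phi>)"
    and \<phi>: "\<phi> \<in> predual E"
  shows "((\<lambda>a. \<phi> (f a)) has_sum \<phi> (ws_sum E f A)) A"
proof -
  \<comment> \<open>The limit is found as the element that represents the map sending a functional
    to its scalar sum.\<close>
  define T where "T = (\<lambda>\<phi>::'e \<Rightarrow> real. \<Sum>\<^sub>\<infinity>a\<in>A. \<phi> (f a))"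
  have "\<exists>!e. \<forall>\<phi>\<in>predual E. T \<phi> = \<phi> e"
    unfolding T_def by (rule predual_represents[where C = C])
      (simp add: infsum_add f, simp add: infsum_cmult_right', rule C)
  then obtain e where e: "\<And>\<phi>. \<phi> \<in> predual E \<Longrightarrow> T \<phi> = \<phi> e" by blast
  have "((\<lambda>a. \<phi> (f a)) has_sum \<phi> e) A" if "\<phi> \<in> predual E" for \<phi>
    using f[OF that] e[OF that] by (simp add: T_def has_sum_iff)
  then show ?thesis using ws_sum_eqI \<phi> by metis
qed

text \<open>One constant C serves all functionals, up to the factor \<open>cb_norm\<close>; this
  uniformity is what the representation clause asks for.\<close>

lemma mats_form_bound:
  assumes x: "x \<in> mats E N"
  obtains C where "0 \<le> C"
    "\<And>\<phi>. \<phi> \<in> predual E \<Longrightarrow> form_bound N (\<lambda>i j. \<phi> (x i j)) (C * cb_norm E 1 (\<lambda>_ _. \<phi>))"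
    "\<And>\<phi>. \<phi> \<in> predual E \<Longrightarrow> 0 \<le> C * cb_norm E 1 (\<lambda>_ _. \<phi>)"
proof -
  obtain C where C: "\<And>n f. (n, f) \<in> selections N \<Longrightarrow> mnorm E n (submat f x) \<le> C"
    using x unfolding mats_def by blast
  have "(0, undefined) \<in> selections N" by (simp add: selections_def)
  from C[OF this] have C0: "0 \<le> C" using mnorm_nonneg order_trans by blast
  \<comment> \<open>A supremum of reals does not inherit a sign by itself: for a nonzero functional
    nonnegativity follows from \<open>predual_le_cb_norm\<close>, and for the zero functional all
    terms of the nonempty family vanish.\<close>
  have cb: "0 \<le> cb_norm E 1 (\<lambda>_ _. \<phi>)" if \<phi>: "\<phi> \<in> predual E" for \<phi>
  proof (cases "\<exists>e. \<phi> e \<noteq> 0")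
    case True
    then obtain e where "0 < \<bar>\<phi> e\<bar>" by auto
    also have "\<dots> \<le> cb_norm E 1 (\<lambda>_ _. \<phi>) * mnorm E 1 (\<lambda>_ _. e)"
      by (rule predual_le_cb_norm[OF \<phi>])
    finally show ?thesis
      using mnorm_nonneg[of 1 "\<lambda>_ _. e"] by (simp add: zero_less_mult_iff)
  next
    case False
    have "op_norm F G (\<lambda>i j. 0::real) = 0" for F G :: "(nat \<times> nat) set"
    proof (rule antisym)
      have *: "op_bound F G (\<lambda>i j. 0::real) 0" by (simp add: op_bound_def L2_set_def)
      show "op_norm F G (\<lambda>i j. 0::real) \<le> 0" by (rule op_norm_le[OF *])
      show "0 \<le> op_norm F G (\<lambda>i j. 0::real)"
        using op_bound_op_norm[OF *] by (simp add: op_bound_def)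
    qed
    then have pn: "pair_norm 1 n (\<lambda>_ _. \<phi>) x = 0" for n x
      using False by (simp add: pair_norm_def pair_mat_def case_prod_unfold)
    have "mnorm E 0 (\<lambda>_ _. 0) \<le> 1"
      by (simp add: mnorm_eq_0_iff[THEN iffD2])
    then have "{(n, x). mnorm E n x \<le> 1} \<noteq> {}" by blast
    then show ?thesis unfolding cb_norm_def pn by (simp add: case_prod_unfold)
  qed
  have "form_bound N (\<lambda>i j. \<phi> (x i j)) (C * cb_norm E 1 (\<lambda>_ _. \<phi>))" if \<phi>: "\<phi> \<in> predual E" for \<phi>
  proof (rule form_boundI)
    fix F :: "'a set" and t s :: "'a \<Rightarrow> real"
    assume F: "finite F" "F \<subseteq> N"
    \<comment> \<open>The matrix norms of E are indexed by natural numbers, so the finite set F is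
      enumerated.\<close>
    from ex_bij_betw_nat_finite[OF F(1)] obtain f where f: "bij_betw f {..<card F} F"
      by (auto simp: atLeast0LessThan)
    then have "(card F, f) \<in> selections N"
      using F by (auto simp: selections_def bij_betw_def)
    note le = C[OF this]
    have L2: "L2_set u F = L2_set (\<lambda>i. u (f i)) {..<card F}" for u
      by (simp add: L2_set_def sum.reindex_bij_betw[OF f, symmetric])
    have "(\<Sum>i\<in>F. \<Sum>j\<in>F. t i * s j * \<phi> (x i j)) =
        (\<Sum>i<card F. \<Sum>j<card F. t (f i) * s (f j) * \<phi> (submat f x i j))"
      by (simp add: sum.reindex_bij_betw[OF f, symmetric] submat_def)
    then have "\<bar>\<Sum>i\<in>F. \<Sum>j\<in>F. t i * s j * \<phi> (x i j)\<bar> \<le>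
        cb_norm E 1 (\<lambda>_ _. \<phi>) * mnorm E (card F) (submat f x) * L2_set t F * L2_set s F"
      using predual_form_le[OF \<phi> cb[OF \<phi>] predual_le_cb_norm[OF \<phi>]] by (simp only: L2)
    also have "\<dots> \<le> cb_norm E 1 (\<lambda>_ _. \<phi>) * C * L2_set t F * L2_set s F"
      by (intro mult_right_mono mult_left_mono le cb[OF \<phi>] L2_set_nonneg)
    finally show "\<bar>\<Sum>i\<in>F. \<Sum>j\<in>F. t i * s j * \<phi> (x i j)\<bar> \<le>
        C * cb_norm E 1 (\<lambda>_ _. \<phi>) * L2_set t F * L2_set s F"
      by (simp add: mult_ac)
  qed
  with C0 cb show ?thesis by (intro that[of C]) auto
qed

lemma predual_rmult:
  assumes x: "x \<in> mats E N" and b: "square_summable N (\<lambda>j. b j l)" and \<phi>: "\<phi> \<in> predual E"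
  shows "((\<lambda>j. b j l * \<phi> (x k j)) has_sum \<phi> (rmult E N x b k l)) N"
\<comment> \<open>For k in N the unit vector at k turns the row into the case of finitely many rows;
  for other k the row of x is zero.\<close>
proof (cases "k \<in> N")
  case k: True
  obtain C where C: "0 \<le> C"
    "\<And>\<phi>. \<phi> \<in> predual E \<Longrightarrow> form_bound N (\<lambda>i j. \<phi> (x i j)) (C * cb_norm E 1 (\<lambda>_ _. \<phi>))"
    "\<And>\<phi>. \<phi> \<in> predual E \<Longrightarrow> 0 \<le> C * cb_norm E 1 (\<lambda>_ _. \<phi>)"
    by (rule mats_form_bound[OF x]) (rule that)
  have "((\<lambda>j. \<phi> (scal E (b j l) (x k j))) has_sum \<phi> (rmult E N x b k l)) N"
    unfolding rmult_def
  proof (rule predual_ws_sum[OF _ _ \<phi>])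
    fix \<phi> assume \<phi>: "\<phi> \<in> predual E"
    show "(\<lambda>j. \<phi> (scal E (b j l) (x k j))) summable_on N"
      using form_bound_row_summable[OF C(2,3)[OF \<phi>] b k] \<phi> by (simp add: predual_scal)
    have "\<bar>\<Sum>i\<in>{k}. 1 * (\<Sum>\<^sub>\<infinity>j\<in>N. b j l * \<phi> (x i j))\<bar> \<le>
        C * cb_norm E 1 (\<lambda>_ _. \<phi>) * L2_set (\<lambda>_. 1) {k} * l2_norm N (\<lambda>j. b j l)"
      using k by (intro form_bound_finite_row[OF C(2,3)[OF \<phi>] b]) auto
    then show "\<bar>\<Sum>\<^sub>\<infinity>j\<in>N. \<phi> (scal E (b j l) (x k j))\<bar> \<le>
        (C * l2_norm N (\<lambda>j. b j l)) * cb_norm E 1 (\<lambda>_ _. \<phi>)"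
      using \<phi> by (simp add: predual_scal mult_ac)
  qed
  then show ?thesis using \<phi> by (simp add: predual_scal)
next
  case False
  then have "x k j = 0" for j using x by (simp add: mats_def)
  moreover have "ws_sum E (\<lambda>j. 0) N = 0" by (rule ws_sum_eqI) (simp add: predual_0)
  ultimately show ?thesis using \<phi> by (simp add: rmult_def predual_0)
qed

text \<open>The right product supplies the inner sums of \<open>form\<close>, and the outer sum then
  obeys the bound of the whole form. Through the second equation, computations with
  \<open>conjug\<close> become computations with real bilinear forms.\<close>

lemma predual_conjug:
  assumes x: "x \<in> mats E N" and b: "\<And>l. square_summable N (\<lambda>j. b j l)" and \<phi>: "\<phi> \<in> predual E"
  shows "((\<lambda>i. b i k * \<phi> (rmult E N x b i l)) has_sum \<phi> (conjug E N b x k l)) N"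
    and "\<phi> (conjug E N b x k l) = form N (\<lambda>i j. \<phi> (x i j)) (\<lambda>i. b i k) (\<lambda>j. b j l)"
proof -
  obtain C where C: "0 \<le> C"
    "\<And>\<phi>. \<phi> \<in> predual E \<Longrightarrow> form_bound N (\<lambda>i j. \<phi> (x i j)) (C * cb_norm E 1 (\<lambda>_ _. \<phi>))"
    "\<And>\<phi>. \<phi> \<in> predual E \<Longrightarrow> 0 \<le> C * cb_norm E 1 (\<lambda>_ _. \<phi>)"
    by (rule mats_form_bound[OF x]) (rule that)
  have r: "\<phi> (rmult E N x b i l) = (\<Sum>\<^sub>\<infinity>j\<in>N. b j l * \<phi> (x i j))" if "\<phi> \<in> predual E" for \<phi> i
    by (rule infsumI[symmetric]) (rule predual_rmult[OF x b that])
  have "((\<lambda>i. \<phi> (scal E (adj b k i) (rmult E N x b i l))) has_sum \<phi> (conjug E N b x k l)) N"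
    unfolding conjug_def lmult_def
  proof (rule predual_ws_sum[OF _ _ \<phi>])
    fix \<phi> assume \<phi>: "\<phi> \<in> predual E"
    note fb = form_bound_summable[OF C(2,3)[OF \<phi>] b b, of k l]
    show "(\<lambda>i. \<phi> (scal E (adj b k i) (rmult E N x b i l))) summable_on N"
      using fb(1) \<phi> by (simp add: predual_scal r adj_def cj_real_def)
    show "\<bar>\<Sum>\<^sub>\<infinity>i\<in>N. \<phi> (scal E (adj b k i) (rmult E N x b i l))\<bar> \<le>
        (C * l2_norm N (\<lambda>i. b i k) * l2_norm N (\<lambda>j. b j l)) * cb_norm E 1 (\<lambda>_ _. \<phi>)"
      using fb(2) \<phi> by (simp add: predual_scal r adj_def cj_real_def form_def mult_ac)
  qed
  then show *: "((\<lambda>i. b i k * \<phi> (rmult E N x b i l)) has_sum \<phi> (conjug E N b x k l)) N"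
    using \<phi> by (simp add: predual_scal adj_def cj_real_def)
  show "\<phi> (conjug E N b x k l) = form N (\<lambda>i j. \<phi> (x i j)) (\<lambda>i. b i k) (\<lambda>j. b j l)"
    unfolding form_def using infsumI[OF *] r[OF \<phi>] by simp
qed

lemma predual_lmult:
  assumes x: "x \<in> mats E N" and a: "square_summable N (\<lambda>i. a k i)" and \<phi>: "\<phi> \<in> predual E"
  shows "((\<lambda>i. a k i * \<phi> (x i l)) has_sum \<phi> (lmult E N a x k l)) N"
proof (cases "l \<in> N")
  case l: True
  obtain C where C: "0 \<le> C"
    "\<And>\<phi>. \<phi> \<in> predual E \<Longrightarrow> form_bound N (\<lambda>i j. \<phi> (x i j)) (C * cb_norm E 1 (\<lambda>_ _. \<phi>))"
    "\<And>\<phi>. \<phi> \<in> predual E \<Longrightarrow> 0 \<le> C * cb_norm E 1 (\<lambda>_ _. \<phi>)"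
    by (rule mats_form_bound[OF x]) (rule that)
  have "((\<lambda>i. \<phi> (scal E (a k i) (x i l))) has_sum \<phi> (lmult E N a x k l)) N"
    unfolding lmult_def
  proof (rule predual_ws_sum[OF _ _ \<phi>])
    fix \<phi> assume \<phi>: "\<phi> \<in> predual E"
    note fb = form_bound_transpose[OF C(2)[OF \<phi>]]
    show "(\<lambda>i. \<phi> (scal E (a k i) (x i l))) summable_on N"
      using form_bound_row_summable[OF fb C(3)[OF \<phi>] a l] \<phi> by (simp add: predual_scal)
    have "\<bar>\<Sum>j\<in>{l}. 1 * (\<Sum>\<^sub>\<infinity>i\<in>N. a k i * \<phi> (x i j))\<bar> \<le>
        C * cb_norm E 1 (\<lambda>_ _. \<phi>) * L2_set (\<lambda>_. 1) {l} * l2_norm N (\<lambda>i. a k i)"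
      using l by (intro form_bound_finite_row[OF fb C(3)[OF \<phi>] a]) auto
    then show "\<bar>\<Sum>\<^sub>\<infinity>i\<in>N. \<phi> (scal E (a k i) (x i l))\<bar> \<le>
        (C * l2_norm N (\<lambda>i. a k i)) * cb_norm E 1 (\<lambda>_ _. \<phi>)"
      using \<phi> by (simp add: predual_scal mult_ac)
  qed
  then show ?thesis using \<phi> by (simp add: predual_scal)
next
  case False
  then have "x j l = 0" for j using x by (simp add: mats_def)
  moreover have "ws_sum E (\<lambda>j. 0) N = 0" by (rule ws_sum_eqI) (simp add: predual_0)
  ultimately show ?thesis using \<phi> by (simp add: lmult_def predual_0)
qed

text \<open>A functional on \<open>cx_space E\<close> combines the two coordinates through a pair of
  functionals on E, so convergence of both coordinates suffices.\<close>

lemma ws_sum_cx: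
  assumes f: "\<And>\<phi>. \<phi> \<in> predual E \<Longrightarrow> ((\<lambda>a. \<phi> (f a)) has_sum \<phi> e) A"
    and g: "\<And>\<phi>. \<phi> \<in> predual E \<Longrightarrow> ((\<lambda>a. \<phi> (g a)) has_sum \<phi> e') A"
  shows "ws_sum (cx_space E) (\<lambda>a. (f a, g a)) A = (e, e')"
  unfolding ws_sum_def
proof (rule the_equality)
  have Complex: "Complex u v = of_real u + \<i> * of_real v" for u v
    by (simp add: complex_eq_iff)
  have hs: "((\<lambda>a. Complex (\<phi> (f a) - \<psi> (g a)) (\<phi> (g a) + \<psi> (f a))) has_sum
      Complex (\<phi> e - \<psi> e') (\<phi> e' + \<psi> e)) A"
    if "\<phi> \<in> predual E" "\<psi> \<in> predual E" for \<phi> \<psi>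
  proof -
    have re: "((\<lambda>a. \<phi> (f a) - \<psi> (g a)) has_sum (\<phi> e - \<psi> e')) A"
      using has_sum_add[OF f[OF that(1)] has_sum_uminusI[OF g[OF that(2)]]] by simp
    have im: "((\<lambda>a. \<phi> (g a) + \<psi> (f a)) has_sum (\<phi> e' + \<psi> e)) A"
      by (rule has_sum_add[OF g[OF that(1)] f[OF that(2)]])
    show ?thesis
      unfolding Complex
      by (rule has_sum_add[OF has_sum_of_real[OF re] has_sum_cmult_right[OF has_sum_of_real[OF im]]])
  qed
  then show "\<forall>\<phi>\<in>predual (cx_space E). ((\<lambda>a. \<phi> (f a, g a)) has_sum \<phi> (e, e')) A"
    by (auto simp: cx_space_def)
  fix z assume z: "\<forall>\<phi>\<in>predual (cx_space E). ((\<lambda>a. \<phi> (f a, g a)) has_sum \<phi> z) A"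
  obtain u v where uv: "z = (u, v)" by (cases z)
  have zero: "(\<lambda>_. 0) \<in> predual E"
    using E by (simp add: dual_operator_space_def)
  have "\<phi> u = \<phi> e \<and> \<phi> v = \<phi> e'" if \<phi>: "\<phi> \<in> predual E" for \<phi>
  proof -
    \<comment> \<open>With \<psi> = 0 the real and imaginary parts test the two coordinates
      separately, which gives uniqueness of the sum.\<close>
    have "(\<lambda>(x, y). Complex (\<phi> x - 0) (\<phi> y + 0)) \<in> predual (cx_space E)"
      unfolding cx_space_def opspace.simps
      by (rule CollectI, rule exI[of _ \<phi>], rule exI[of _ "\<lambda>_. 0"]) (simp add: \<phi> zero)
    with z uv have "((\<lambda>a. Complex (\<phi> (f a) - 0) (\<phi> (g a) + 0)) has_sum Complex (\<phi> u - 0) (\<phi> v + 0)) A"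
      by force
    from has_sum_unique[OF this hs[OF \<phi> zero]] show ?thesis by simp
  qed
  then show "z = (e, e')" unfolding uv using predual_separates by blast
qed

end


section \<open>Complexification\<close>

lemma L2_set_subset_le: "finite B \<Longrightarrow> A \<subseteq> B \<Longrightarrow> L2_set f A \<le> L2_set f B"
  unfolding L2_set_def by (intro real_sqrt_le_mono sum_mono2) auto

lemma op_bound_scalar_mats:
  assumes "b \<in> scalar_mats M N"
  obtains C where "0 \<le> C" "\<And>F G. finite F \<Longrightarrow> F \<subseteq> M \<Longrightarrow> finite G \<Longrightarrow> G \<subseteq> N \<Longrightarrow> op_bound F G b C"
proof -
  obtain C where C: "\<forall>F G. finite F \<and> F \<subseteq> M \<and> finite G \<and> G \<subseteq> N \<longrightarrow> op_bound F G b C"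
    using assms unfolding scalar_mats_def by blast
  from C[rule_format, of "{}" "{}"] have "0 \<le> C" by (simp add: op_bound_def)
  then show ?thesis
    by (rule that) (use C in simp)
qed

lemma scalar_matsI:
  assumes "\<And>i j. i \<notin> M \<or> j \<notin> N \<Longrightarrow> b i j = 0"
    and "\<And>F G. finite F \<Longrightarrow> F \<subseteq> M \<Longrightarrow> finite G \<Longrightarrow> G \<subseteq> N \<Longrightarrow> op_bound F G b C"
  shows "b \<in> scalar_mats M N"
  unfolding scalar_mats_def using assms by (intro CollectI conjI exI[of _ C]) simp_all

lemma scalar_mats_outside: "b \<in> scalar_mats M N \<Longrightarrow> i \<notin> M \<or> j \<notin> N \<Longrightarrow> b i j = 0"
  unfolding scalar_mats_def by blast

text \<open>A rectangular matrix vanishes outside its index sets, hence may be read as a square one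
  over their union, where the results on forms apply.\<close>

lemma scalar_mats_form_bound:
  fixes b :: "'k \<Rightarrow> 'k \<Rightarrow> real"
  assumes b: "b \<in> scalar_mats M N"
  obtains C where "0 \<le> C" "form_bound (M \<union> N) b C"
proof -
  obtain C where C: "0 \<le> C"
    "\<And>F G. finite F \<Longrightarrow> F \<subseteq> M \<Longrightarrow> finite G \<Longrightarrow> G \<subseteq> N \<Longrightarrow> op_bound F G b C"
    using op_bound_scalar_mats[OF b] by metis
  have "form_bound (M \<union> N) b C"
  proof (rule form_boundI)
    fix F :: "'k set" and t s :: "'k \<Rightarrow> real"
    assume F: "finite F"
    have "(\<Sum>i\<in>F. \<Sum>j\<in>F. t i * s j * b i j) = (\<Sum>i\<in>F \<inter> M. \<Sum>j\<in>F \<inter> N. t i * s j * b i j)"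
      using F scalar_mats_outside[OF b]
      by (intro sum.mono_neutral_cong_right) (auto intro!: sum.mono_neutral_right)
    also have "\<bar>\<dots>\<bar> \<le> C * L2_set t (F \<inter> M) * L2_set s (F \<inter> N)"
      using C(2)[of "F \<inter> M" "F \<inter> N"] F unfolding op_bound_real_iff by blast
    also have "\<dots> \<le> C * L2_set t F * L2_set s F"
      using F C(1) by (intro mult_mono L2_set_subset_le) auto
    finally show "\<bar>\<Sum>i\<in>F. \<Sum>j\<in>F. t i * s j * b i j\<bar> \<le> C * L2_set t F * L2_set s F" .
  qed
  with C(1) show ?thesis by (rule that)
qed

lemma form_bound_square_summable:
  assumes X: "form_bound N X C" and C: "0 \<le> C" and s: "square_summable N s"
  shows "square_summable N (\<lambda>i. \<Sum>\<^sub>\<infinity>j\<in>N. s j * X i j)"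
proof (rule square_summableI)
  fix F assume F: "finite F" "F \<subseteq> N"
  \<comment> \<open>The image y of s is tested against itself, which bounds its norm on F by
    \<open>C * l2_norm N s\<close>.\<close>
  define y where "y i = (\<Sum>\<^sub>\<infinity>j\<in>N. s j * X i j)" for i
  have "L2_set y F * L2_set y F = (\<Sum>i\<in>F. y i * y i)"
    using L2_set_power2[of y F] by (simp add: power2_eq_square)
  also have "\<dots> \<le> L2_set y F * (C * l2_norm N s)"
    using abs_le_D1[OF form_bound_finite_row[OF X C s F, of y]] unfolding y_def[symmetric]
    by (simp add: mult_ac)
  finally show "L2_set (\<lambda>i. \<Sum>\<^sub>\<infinity>j\<in>N. s j * X i j) F \<le> C * l2_norm N s"
    unfolding y_def[symmetric] using C
    by (cases "L2_set y F = 0") (simp_all add: mult_le_cancel_left order_less_le)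
qed

lemma square_summable_subset: "square_summable B a \<Longrightarrow> A \<subseteq> B \<Longrightarrow> square_summable A a"
  unfolding square_summable_def by (rule summable_on_subset_banach)

lemma square_summable_extend:
  assumes "square_summable A a" "\<And>i. i \<notin> A \<Longrightarrow> a i = 0"
  shows "square_summable B a"
proof -
  have "square_summable (A \<union> B) a"
    using assms summable_on_cong_neutral[of A "A \<union> B" "\<lambda>i. (a i)\<^sup>2" "\<lambda>i. (a i)\<^sup>2"]
    unfolding square_summable_def by auto
  then show ?thesis by (rule square_summable_subset) simp
qed

text \<open>A column is the image of a basis vector, and a row is a column of the transpose.\<close>

lemma scalar_mats_square_summable:
  fixes b :: "'k \<Rightarrow> 'k \<Rightarrow> real"
  assumes b: "b \<in> scalar_mats M N"
  shows "square_summable M (\<lambda>i. b i l)" and "square_summable N (\<lambda>j. b k j)"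
proof -
  obtain C where C: "0 \<le> C" "form_bound (M \<union> N) b C"
    using scalar_mats_form_bound[OF b] by blast
  have single: "(\<Sum>\<^sub>\<infinity>j\<in>M \<union> N. (if j = l then 1 else 0) * X j) = X l" if "l \<in> M \<union> N"
    for l and X :: "'k \<Rightarrow> real"
    using that by (subst infsum_single[of l]) auto
  have *: "square_summable (M \<union> N) (\<lambda>i. X i l)"
    if X: "form_bound (M \<union> N) X C" "\<And>i. l \<notin> M \<union> N \<Longrightarrow> X i l = 0" for X l
  proof (cases "l \<in> M \<union> N")
    case True
    then show ?thesis
      using form_bound_square_summable[OF X(1) C(1) square_summable_indicator[of _ l 1]]
      by (simp add: single)
  qed (simp add: X(2) square_summable_def)
  have "square_summable (M \<union> N) (\<lambda>i. b i l)"
    by (rule *[OF C(2)]) (simp add: scalar_mats_outside[OF b])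
  then show "square_summable M (\<lambda>i. b i l)"
    by (rule square_summable_subset) simp
  have "square_summable (M \<union> N) (\<lambda>j. b k j)"
    by (rule *[OF form_bound_transpose[OF C(2)]]) (simp add: scalar_mats_outside[OF b])
  then show "square_summable N (\<lambda>j. b k j)"
    by (rule square_summable_subset) simp
qed

text \<open>Column l of b b* is the image under b of row l of b, and the matrix is
  symmetric.\<close>

lemma range_projection_square_summable:
  fixes b :: "'k \<Rightarrow> 'k \<Rightarrow> real"
  assumes b: "b \<in> scalar_mats M N"
  shows "square_summable M (\<lambda>i. mat_prod N b (adj b) i l)"
    and "square_summable M (\<lambda>i. mat_prod N b (adj b) k i)"
proof -
  have sym: "mat_prod N b (adj b) k i = mat_prod N b (adj b) i k" for i k
    by (simp add: mat_prod_def adj_def cj_real_def mult.commute)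
  show *: "square_summable M (\<lambda>i. mat_prod N b (adj b) i l)" for l
  proof -
    obtain C where C: "0 \<le> C" "form_bound (M \<union> N) b C"
      using scalar_mats_form_bound[OF b] by blast
    have "square_summable (M \<union> N) (\<lambda>j. b l j)"
      by (rule square_summable_extend[OF scalar_mats_square_summable(2)[OF b]])
        (simp add: scalar_mats_outside[OF b])
    from form_bound_square_summable[OF C(2,1) this]
    have "square_summable M (\<lambda>i. \<Sum>\<^sub>\<infinity>j\<in>M \<union> N. b l j * b i j)"
      by (rule square_summable_subset) simp
    also have "(\<lambda>i. \<Sum>\<^sub>\<infinity>j\<in>M \<union> N. b l j * b i j) = (\<lambda>i. mat_prod N b (adj b) i l)"
      using scalar_mats_outside[OF b]
      by (auto simp: mat_prod_def adj_def cj_real_def mult.commute intro!: ext infsum_cong_neutral)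
    finally show ?thesis .
  qed
  show "square_summable M (\<lambda>i. mat_prod N b (adj b) k i)"
    using * by (simp add: sym[of k])
qed


section \<open>Real matrices as complex matrices\<close>

definition of_real_mat :: "('k \<Rightarrow> 'k \<Rightarrow> real) \<Rightarrow> 'k \<Rightarrow> 'k \<Rightarrow> complex" where
  "of_real_mat a = (\<lambda>i j. complex_of_real (a i j))"

definition real_mat :: "('k \<Rightarrow> 'k \<Rightarrow> 'e::ab_group_add) \<Rightarrow> 'k \<Rightarrow> 'k \<Rightarrow> 'e \<times> 'e" where
  "real_mat x = (\<lambda>i j. (x i j, 0))"

lemma cx_incl_eq: "cx_incl (N, x) = (N, real_mat x)"
  by (simp add: cx_incl_def real_mat_def)

lemma of_real_mat_eq_iff [simp]: "of_real_mat a = of_real_mat b \<longleftrightarrow> a = b"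
  by (simp add: of_real_mat_def fun_eq_iff)

lemma real_mat_eq_iff [simp]: "real_mat x = real_mat y \<longleftrightarrow> x = y"
  by (simp add: real_mat_def fun_eq_iff)

lemma adj_of_real_mat: "adj (of_real_mat a) = of_real_mat (adj a)"
  by (simp add: adj_def of_real_mat_def cj_complex_def cj_real_def)

lemma id_mat_of_real: "id_mat N = of_real_mat (id_mat N)"
  by (auto simp: of_real_mat_def id_mat_def fun_eq_iff)

lemma infsum_complex_of_real: "(\<Sum>\<^sub>\<infinity>i\<in>A. complex_of_real (f i)) = of_real (infsum f A)"
proof (cases "f summable_on A")
  case True
  then show ?thesis by (intro infsumI has_sum_of_real has_sum_infsum)
next
  case False
  \<comment> \<open>Both sides take the default value 0 of a divergent sum.\<close>
  then have "\<not> (\<lambda>i. complex_of_real (f i)) summable_on A"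
    using summable_on_Re[of "\<lambda>i. complex_of_real (f i)" A] by auto
  with False show ?thesis by (simp add: infsum_not_exists)
qed

lemma mat_prod_of_real: "mat_prod N (of_real_mat a) (of_real_mat b) = of_real_mat (mat_prod N a b)"
  by (simp add: mat_prod_def of_real_mat_def flip: infsum_complex_of_real)

text \<open>A real matrix acts separately on the real and imaginary parts of a vector, whose squared
  norms add up; so the bound does not change.\<close>

lemma op_bound_of_real:
  assumes "op_bound F G a C"
  shows "op_bound F G (\<lambda>i j. complex_of_real (a i j)) C"
  unfolding op_bound_def
proof (intro conjI allI)
  show C: "0 \<le> C" using assms by (simp add: op_bound_def)
  fix \<xi> :: "_ \<Rightarrow> complex"
  have split: "(L2_set (\<lambda>i. norm (z i)) A)\<^sup>2 = (L2_set (\<lambda>i. Re (z i)) A)\<^sup>2 + (L2_set (\<lambda>i. Im (z i)) A)\<^sup>2"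
    for z :: "'z \<Rightarrow> complex" and A
    by (simp add: L2_set_power2 cmod_power2 sum.distrib)
  have le: "(L2_set (\<lambda>i. \<Sum>j\<in>G. a i j * v j) F)\<^sup>2 \<le> C\<^sup>2 * (L2_set v G)\<^sup>2" for v
    using assms power_mono[of "L2_set (\<lambda>i. \<Sum>j\<in>G. a i j * v j) F" "C * L2_set v G" 2]
    by (simp add: op_bound_def power_mult_distrib)
  have "(L2_set (\<lambda>i. norm (\<Sum>j\<in>G. complex_of_real (a i j) * \<xi> j)) F)\<^sup>2 \<le>
      (C * L2_set (\<lambda>j. norm (\<xi> j)) G)\<^sup>2"
    using le[of "\<lambda>j. Re (\<xi> j)"] le[of "\<lambda>j. Im (\<xi> j)"]
    by (simp add: split power_mult_distrib algebra_simps)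
  then show "L2_set (\<lambda>i. norm (\<Sum>j\<in>G. complex_of_real (a i j) * \<xi> j)) F \<le>
      C * L2_set (\<lambda>j. norm (\<xi> j)) G"
    by (rule power2_le_imp_le) (simp add: C)
qed

lemma of_real_mat_scalar_mats:
  assumes "a \<in> scalar_mats M N"
  shows "of_real_mat a \<in> scalar_mats M N"
proof -
  obtain C where "\<And>F G. finite F \<Longrightarrow> F \<subseteq> M \<Longrightarrow> finite G \<Longrightarrow> G \<subseteq> N \<Longrightarrow> op_bound F G a C"
    using op_bound_scalar_mats[OF assms] by metis
  then show ?thesis
    unfolding of_real_mat_def using scalar_mats_outside[OF assms]
    by (intro scalar_matsI[where C = C] op_bound_of_real) simp_all
qed

lemma of_real_mat_isometries_iff:
  assumes "b \<in> scalar_mats M N"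
  shows "of_real_mat b \<in> isometries M N \<longleftrightarrow> b \<in> isometries M N"
  using of_real_mat_scalar_mats[OF assms] assms
  by (simp add: isometries_def adj_of_real_mat mat_prod_of_real id_mat_of_real)

lemma scalar_mats_cmult:
  fixes a :: "'k \<Rightarrow> 'k \<Rightarrow> real"
  assumes "a \<in> scalar_mats M N"
  shows "(\<lambda>i j. c * a i j) \<in> scalar_mats M N"
proof -
  obtain C where C: "0 \<le> C" "\<And>F G. finite F \<Longrightarrow> F \<subseteq> M \<Longrightarrow> finite G \<Longrightarrow> G \<subseteq> N \<Longrightarrow> op_bound F G a C"
    using op_bound_scalar_mats[OF assms] by metis
  have "op_bound F G (\<lambda>i j. c * a i j) (\<bar>c\<bar> * C)" if "op_bound F G a C" for F G
  proof -
    have "L2_set (\<lambda>i. \<Sum>j\<in>G. c * a i j * \<xi> j) F = \<bar>c\<bar> * L2_set (\<lambda>i. \<Sum>j\<in>G. a i j * \<xi> j) F" for \<xi>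
    proof -
      have "L2_set (\<lambda>i. \<Sum>j\<in>G. c * a i j * \<xi> j) F = L2_set (\<lambda>i. \<bar>c\<bar> * \<bar>\<Sum>j\<in>G. a i j * \<xi> j\<bar>) F"
        by (simp add: L2_set_def power_mult_distrib sum_distrib_left[symmetric] mult.assoc)
      also have "\<dots> = \<bar>c\<bar> * L2_set (\<lambda>i. \<Sum>j\<in>G. a i j * \<xi> j) F"
        by (subst L2_set_right_distrib[symmetric]) simp_all
      finally show ?thesis .
    qed
    then show ?thesis
      using that by (auto simp: op_bound_def mult.assoc intro!: mult_left_mono)
  qed
  then show ?thesis
    using C(2) scalar_mats_outside[OF assms] by (intro scalar_matsI[where C = "\<bar>c\<bar> * C"]) simp_all
qed

text \<open>The isometry is determined by \<alpha> and c. Hence a complex factorisation of a real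
  \<alpha> has a real \<beta>, which is what allows purity to descend.\<close>

lemma pure_factor_cmult:
  assumes "pure_factor E N x M y \<alpha> c \<beta>"
  shows "\<beta> = (\<lambda>i j. of_real (1 / c) * \<alpha> i j)"
  using assms by (auto simp: pure_factor_def fun_eq_iff)

lemma sum_real_mat: "(\<Sum>i\<in>I. (f i, 0)) = (\<Sum>i\<in>I. f i, 0)"
  by (induction I rule: infinite_finite_induct) (auto simp: zero_prod_def)

text \<open>For f injective on N this is the isometry taking the basis vector j to the basis vector
  \<open>f j\<close>. Two of these with disjoint ranges assemble a direct sum.\<close>

definition inj_mat :: "('k \<Rightarrow> 'k) \<Rightarrow> 'k set \<Rightarrow> 'k \<Rightarrow> 'k \<Rightarrow> real" where
  "inj_mat f N = (\<lambda>k j. if j \<in> N \<and> k = f j then 1 else 0)"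

lemma inj_mat_isometry:
  assumes f: "inj_on f N" "f ` N \<subseteq> M"
  shows "inj_mat f N \<in> isometries M N"
proof -
  have "op_bound F G (inj_mat f N) 1" if FG: "finite F" "finite G" "G \<subseteq> N" for F G
    unfolding op_bound_real_iff
  proof (intro conjI allI)
    fix t s
    \<comment> \<open>Only the indices j of G whose image lies in F contribute.\<close>
    define H where "H = {j \<in> G. f j \<in> F}"
    have "(\<Sum>i\<in>F. \<Sum>j\<in>G. t i * s j * inj_mat f N i j) = (\<Sum>j\<in>G. \<Sum>i\<in>F. if i = f j then t (f j) * s j else 0)"
      using FG(3) by (subst sum.swap) (auto simp: inj_mat_def intro!: sum.cong)
    also have "\<dots> = (\<Sum>j\<in>H. t (f j) * s j)"
      unfolding H_def using FG by (auto simp: sum.delta split: if_splits intro!: sum.mono_neutral_cong_right)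
    also have "\<bar>\<dots>\<bar> \<le> L2_set (\<lambda>j. t (f j)) H * L2_set s H"
      by (rule abs_sum_mult_le_L2_set)
    also have "L2_set (\<lambda>j. t (f j)) H = L2_set t (f ` H)"
    proof -
      have "inj_on f H" by (rule inj_on_subset[OF f(1)]) (use FG(3) in \<open>auto simp: H_def\<close>)
      then show ?thesis by (simp add: L2_set_def sum.reindex)
    qed
    also have "L2_set t (f ` H) * L2_set s H \<le> L2_set t F * L2_set s G"
      using FG by (intro mult_mono L2_set_subset_le) (auto simp: H_def)
    finally show "\<bar>\<Sum>i\<in>F. \<Sum>j\<in>G. t i * s j * inj_mat f N i j\<bar> \<le> 1 * L2_set t F * L2_set s G"
      by simp
  qed simp
  then have "inj_mat f N \<in> scalar_mats M N"
    using f(2) by (intro scalar_matsI[where C = 1]) (auto simp: inj_mat_def)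
  moreover have "mat_prod M (adj (inj_mat f N)) (inj_mat f N) k l = id_mat N k l" for k l
  proof (cases "k \<in> N")
    case True
    then have "(\<Sum>\<^sub>\<infinity>i\<in>M. inj_mat f N i k * inj_mat f N i l) = inj_mat f N (f k) k * inj_mat f N (f k) l"
      using f(2) by (intro infsum_single) (auto simp: inj_mat_def)
    then show ?thesis
      using True f(1) by (auto simp: mat_prod_def adj_def cj_real_def id_mat_def inj_mat_def inj_on_def)
  qed (simp add: mat_prod_def adj_def cj_real_def id_mat_def inj_mat_def)
  ultimately show ?thesis by (auto simp: isometries_def)
qed

text \<open>The range projection is diagonal, so the projections for two disjoint images add up to
  the identity of their union.\<close>

lemma inj_mat_range:
  assumes f: "inj_on f N"
  shows "mat_prod N (inj_mat f N) (adj (inj_mat f N)) k l = (if k \<in> f ` N \<and> k = l then 1 else 0)"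
proof (cases "k \<in> f ` N")
  case True
  then obtain i where i: "i \<in> N" "k = f i" by blast
  then have "(\<Sum>\<^sub>\<infinity>j\<in>N. inj_mat f N k j * inj_mat f N l j) = inj_mat f N k i * inj_mat f N l i"
    using f by (intro infsum_single) (auto simp: inj_mat_def inj_on_def)
  then show ?thesis using i by (auto simp: mat_prod_def adj_def cj_real_def inj_mat_def)
next
  case False
  then have "inj_mat f N k j = 0" for j by (auto simp: inj_mat_def)
  with False show ?thesis by (simp add: mat_prod_def)
qed

lemma form_indicator:
  assumes "i \<in> N" "j \<in> N"
  shows "form N X (\<lambda>k. if k = i then 1 else 0) (\<lambda>k. if k = j then 1 else 0) = X i j"
proof -
  have *: "(\<Sum>\<^sub>\<infinity>k\<in>N. (if k = i then 1 else 0) * g k) = g i" if "i \<in> N" for i and g :: "'a \<Rightarrow> real"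
    using that by (subst infsum_single[of i]) auto
  show ?thesis using assms by (simp add: form_def *)
qed


section \<open>Real points of the complexification and descent of extremality\<close>

context
  fixes E :: "(real, 'e::ab_group_add) opspace"
  assumes E: "dual_operator_space E"
begin

lemma ws_sum_real_mat:
  assumes "\<And>\<phi>. \<phi> \<in> predual E \<Longrightarrow> ((\<lambda>a. \<phi> (f a)) has_sum \<phi> e) A"
  shows "ws_sum (cx_space E) (\<lambda>a. (f a, 0)) A = (e, 0)"
  using assms by (intro ws_sum_cx[OF E]) (simp_all add: predual_0[OF E])

lemma scal_cx_of_real: "scal (cx_space E) (complex_of_real c) (x, 0) = (scal E c x, 0)"
  by (simp add: cx_space_def scal_simps[OF E])

lemma cx_rmult:
  assumes "x \<in> mats E N" "\<And>l. square_summable N (\<lambda>j. b j l)"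
  shows "rmult (cx_space E) N (real_mat x) (of_real_mat b) = real_mat (rmult E N x b)"
  using predual_rmult[OF E assms]
  by (auto simp: rmult_def[of "cx_space E"] real_mat_def of_real_mat_def scal_cx_of_real predual_scal[OF E]
      intro!: ext ws_sum_real_mat)

lemma cx_lmult:
  assumes "x \<in> mats E N" "\<And>k. square_summable N (\<lambda>i. a k i)"
  shows "lmult (cx_space E) N (of_real_mat a) (real_mat x) = real_mat (lmult E N a x)"
  using predual_lmult[OF E assms]
  by (auto simp: lmult_def[of "cx_space E"] real_mat_def of_real_mat_def scal_cx_of_real predual_scal[OF E]
      intro!: ext ws_sum_real_mat)

lemma cx_conjug:
  assumes "x \<in> mats E N" "\<And>l. square_summable N (\<lambda>j. b j l)"
  shows "conjug (cx_space E) N (of_real_mat b) (real_mat x) = real_mat (conjug E N b x)"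
  unfolding conjug_def[of "cx_space E"] cx_rmult[OF assms] adj_of_real_mat
  using predual_conjug(1)[OF E assms]
  by (auto simp: lmult_def[of "cx_space E"] real_mat_def of_real_mat_def scal_cx_of_real predual_scal[OF E]
      adj_def cj_real_def intro!: ext ws_sum_real_mat)

lemma ws_sum_finite: "finite A \<Longrightarrow> ws_sum E f A = sum f A"
  by (rule ws_sum_eqI[OF E]) (simp add: predual_sum[OF E])

text \<open>The columns of the adjoint are basis vectors on the image of f and zero elsewhere, so x
  is copied to the block indexed by the image.\<close>

lemma conjug_inj_mat:
  assumes x: "x \<in> mats E N" and f: "inj_on f N"
  shows "i \<in> N \<Longrightarrow> j \<in> N \<Longrightarrow> conjug E N (adj (inj_mat f N)) x (f i) (f j) = x i j"
    and "k \<notin> f ` N \<or> l \<notin> f ` N \<Longrightarrow> conjug E N (adj (inj_mat f N)) x k l = 0"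
proof -
  have sq: "square_summable N (\<lambda>j. adj (inj_mat f N) j l)" for l
    using scalar_mats_square_summable(2)[of "inj_mat f N" "f ` N" N l] inj_mat_isometry[OF f, of "f ` N"]
    by (simp add: adj_def cj_real_def isometries_def)
  note \<phi> = predual_conjug(2)[OF E x sq]
  show "conjug E N (adj (inj_mat f N)) x (f i) (f j) = x i j" if "i \<in> N" "j \<in> N"
  proof (rule predual_separates[OF E])
    fix \<phi> assume "\<phi> \<in> predual E"
    have col: "adj (inj_mat f N) k (f i) = (if k = i then 1 else 0)" if "i \<in> N" for i k
      using f that by (auto simp: adj_def cj_real_def inj_mat_def inj_on_def)
    show "\<phi> (conjug E N (adj (inj_mat f N)) x (f i) (f j)) = \<phi> (x i j)"
      unfolding \<phi>[OF \<open>\<phi> \<in> predual E\<close>] using that by (simp add: col form_indicator)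
  qed
  show "conjug E N (adj (inj_mat f N)) x k l = 0" if "k \<notin> f ` N \<or> l \<notin> f ` N"
  proof (rule predual_separates[OF E])
    fix \<phi> assume "\<phi> \<in> predual E"
    have col: "adj (inj_mat f N) i k = 0" if "k \<notin> f ` N" for i k
      using that by (auto simp: adj_def cj_real_def inj_mat_def)
    from that show "\<phi> (conjug E N (adj (inj_mat f N)) x k l) = \<phi> 0"
      unfolding \<phi>[OF \<open>\<phi> \<in> predual E\<close>] predual_0[OF E \<open>\<phi> \<in> predual E\<close>]
      by (auto simp: col form_def)
  qed
qed

text \<open>The matrix c(x, 0) is the diagonal sum of x with itself, and the norm of a diagonal sum
  is the maximum of the two norms.\<close>

lemma real_mat_mats:
  assumes x: "x \<in> mats E N"
  shows "real_mat x \<in> mats (cx_space E) N"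
proof -
  have "mnorm (cx_space E) n (submat f (real_mat x)) = mnorm E n (submat f x)" for n f
  proof -
    have "mnorm (cx_space E) n (submat f (real_mat x)) = mnorm E (n + n) (diag_sum n n (submat f x) (submat f x))"
      unfolding cx_space_def opspace.simps mult_2
      by (rule mnorm_cong[OF E]) (auto simp: submat_def real_mat_def halves_def diag_sum_def)
    then show ?thesis by (simp add: mnorm_diag_sum[OF E])
  qed
  then show ?thesis using x by (simp add: mats_def) (simp add: real_mat_def zero_prod_def)
qed

text \<open>The matrix c(x, 0) is a direct sum of two copies of x, so it lies in K by the direct sum
  axiom. An infinite type contains a disjoint union of two copies of itself, which provides an index
  set for it.\<close>

lemma real_mat_cx_set:
  fixes K :: "('k, 'e) graded_set"
  assumes inf: "infinite (UNIV :: 'k set)" and K: "nc_convex E K" and x: "(N, x) \<in> K"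
  shows "(N, real_mat x) \<in> cx_set E K"
proof -
  have xN: "N \<noteq> {}" "x \<in> mats E N"
    using K x by (auto simp: nc_convex_def all_mats_def)
  obtain h :: "'k + 'k \<Rightarrow> 'k" where "bij_betw h (UNIV <+> UNIV) UNIV"
    using card_of_Plus_infinite1[OF inf card_of_mono1[OF subset_refl]] card_of_ordIso by metis
  then have h: "inj h" by (simp add: bij_betw_def UNIV_Plus_UNIV)
  define N' where "N' = h ` (N <+> N)"
  have g: "bij_betw (inv h) N' (N <+> N)"
    unfolding N'_def using h by (simp add: bij_betw_def image_image inj_on_def)
  \<comment> \<open>The direct sum axiom labels its summands by elements of the index type, here p
    and q. The map \<open>f i\<close> is the left copy for i = p and the right copy for every other
    label.\<close>
  define p where "p = h (Inl undefined)"
  define q where "q = h (Inr undefined)"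
  have pq: "p \<noteq> q" using h by (auto simp: p_def q_def dest: injD)
  define f where "f = (\<lambda>i. h \<circ> (if i = p then Inl else Inr))"
  have f: "inj_on (f i) N" "f i ` N \<subseteq> N'" for i
    using h by (auto simp: f_def N'_def inj_on_def inj_def)
  have fpq: "f p = h \<circ> Inl" "f q = h \<circ> Inr" using pq by (auto simp: f_def)
  have N'_eq: "N' = f p ` N \<union> f q ` N"
    unfolding N'_def Plus_def by (simp add: fpq image_Un image_image)
  have f_disjoint: "f p ` N \<inter> f q ` N = {}"
    using h by (auto simp: fpq dest: injD)
  define \<alpha> where "\<alpha> i = inj_mat (f i) N" for i
  define y where "y = (\<lambda>k l. ws_sum E (\<lambda>i. conjug E N (adj (\<alpha> i)) x k l) {p, q})"
  have "y \<in> level K N'"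
  proof -
    have "((\<lambda>i. mat_prod N (\<alpha> i) (adj (\<alpha> i)) k l) has_sum id_mat N' k l) {p, q}" for k l
    proof (rule has_sum_finiteI)
      show "id_mat N' k l = (\<Sum>i\<in>{p, q}. mat_prod N (\<alpha> i) (adj (\<alpha> i)) k l)"
        using pq N'_eq f_disjoint by (auto simp: \<alpha>_def inj_mat_range[OF f(1)] id_mat_def)
    qed simp
    moreover have "\<alpha> i \<in> isometries N' N" for i
      unfolding \<alpha>_def by (rule inj_mat_isometry[OF f])
    moreover have "N' \<noteq> {}" using xN by (auto simp: N'_def)
    moreover have "x \<in> level K N" using x by (simp add: level_def)
    ultimately show ?thesis
      using K[unfolded nc_convex_def, THEN conjunct2, THEN conjunct1, rule_format,
          of N' "{p, q}" "\<lambda>_. x" "\<lambda>_. N" \<alpha>]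
      unfolding y_def by blast
  qed
  moreover have "y = (\<lambda>i j. if i \<in> N' \<and> j \<in> N'
        then c_mat (\<lambda>k l. fst (real_mat x k l)) (\<lambda>k l. snd (real_mat x k l)) (inv h i) (inv h j) else 0)"
  proof (intro ext)
    fix k l
    have y: "y k l = conjug E N (adj (inj_mat (f p) N)) x k l + conjug E N (adj (inj_mat (f q) N)) x k l" for k l
      unfolding y_def \<alpha>_def using pq by (simp add: ws_sum_finite)
    have inv: "inv h (h z) = z" for z using h by simp
    note cj = conjug_inj_mat[OF xN(2) f(1)]
    show "y k l = (if k \<in> N' \<and> l \<in> N'
        then c_mat (\<lambda>k l. fst (real_mat x k l)) (\<lambda>k l. snd (real_mat x k l)) (inv h k) (inv h l) else 0)"
    proof (cases "k \<in> N' \<and> l \<in> N'")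
      case False
      then have "k \<notin> f i ` N \<or> l \<notin> f i ` N" for i using f(2) by blast
      then show ?thesis using False by (auto simp: y cj(2))
    next
      case True
      then obtain a b where ab: "a \<in> N <+> N" "b \<in> N <+> N" "k = h a" "l = h b"
        by (auto simp: N'_def)
      have rng: "h (Inr i) \<notin> f p ` N" "h (Inl i) \<notin> f q ` N" for i
        using h by (auto simp: fpq dest: injD)
      have at: "i \<in> N \<Longrightarrow> j \<in> N \<Longrightarrow> conjug E N (adj (inj_mat (f p) N)) x (h (Inl i)) (h (Inl j)) = x i j"
        "i \<in> N \<Longrightarrow> j \<in> N \<Longrightarrow> conjug E N (adj (inj_mat (f q) N)) x (h (Inr i)) (h (Inr j)) = x i j" for i j
        using cj(1)[of i j p] cj(1)[of i j q] by (simp_all add: fpq)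
      from ab True show ?thesis
        by (auto simp: y inv at cj(2) rng real_mat_def)
    qed
  qed
  ultimately have "(\<lambda>i j. if i \<in> N' \<and> j \<in> N'
        then c_mat (\<lambda>k l. fst (real_mat x k l)) (\<lambda>k l. snd (real_mat x k l)) (inv h i) (inv h j) else 0)
      \<in> level K N'" by simp
  then show ?thesis
    using g xN real_mat_mats[OF xN(2)] unfolding cx_set_def all_mats_def by blast
qed

lemma nc_convex_level_mats: "nc_convex E K \<Longrightarrow> x \<in> level K N \<Longrightarrow> x \<in> mats E N"
  by (auto simp: nc_convex_def level_def all_mats_def)

lemma nc_comb_cx:
  fixes K :: "('k, 'e) graded_set"
  assumes inf: "infinite (UNIV :: 'k set)" and K: "nc_convex E K"
    and comb: "nc_comb E K N x m Ns xs \<alpha>"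
  shows "nc_comb (cx_space E) (cx_set E K) N (real_mat x) m Ns (\<lambda>i. real_mat (xs i)) (\<lambda>i. of_real_mat (\<alpha> i))"
  unfolding nc_comb_def
proof (intro conjI allI impI)
  fix i assume i: "i < m"
  then show "real_mat (xs i) \<in> level (cx_set E K) (Ns i)"
    using comb real_mat_cx_set[OF inf K] by (simp add: nc_comb_def level_def)
  show "of_real_mat (\<alpha> i) \<in> scalar_mats (Ns i) N"
    using comb i by (simp add: nc_comb_def of_real_mat_scalar_mats)
  show "of_real_mat (\<alpha> i) \<noteq> (\<lambda>_ _. 0)"
    using comb i by (auto simp: nc_comb_def of_real_mat_def fun_eq_iff)
next
  have "(\<lambda>k l. \<Sum>i<m. mat_prod (Ns i) (adj (\<alpha> i)) (\<alpha> i) k l) = id_mat N"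
    using comb by (simp add: nc_comb_def)
  then have "of_real_mat (\<lambda>k l. \<Sum>i<m. mat_prod (Ns i) (adj (\<alpha> i)) (\<alpha> i) k l) = of_real_mat (id_mat N)"
    by simp
  then show "(\<lambda>k l. \<Sum>i<m. mat_prod (Ns i) (adj (of_real_mat (\<alpha> i))) (of_real_mat (\<alpha> i)) k l) = id_mat N"
    unfolding adj_of_real_mat mat_prod_of_real id_mat_of_real[symmetric]
    by (simp add: of_real_mat_def)
next
  have x: "x = (\<lambda>k l. \<Sum>i<m. conjug E (Ns i) (\<alpha> i) (xs i) k l)"
    using comb by (simp add: nc_comb_def)
  have "conjug (cx_space E) (Ns i) (of_real_mat (\<alpha> i)) (real_mat (xs i)) k l =
      (conjug E (Ns i) (\<alpha> i) (xs i) k l, 0)" if "i < m" for i k l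
  proof -
    have "xs i \<in> mats E (Ns i)" "\<alpha> i \<in> scalar_mats (Ns i) N"
      using comb that nc_convex_level_mats[OF K] by (simp_all add: nc_comb_def)
    from cx_conjug[OF this(1) scalar_mats_square_summable(1)[OF this(2)]]
    show ?thesis by (simp add: real_mat_def)
  qed
  then show "real_mat x = (\<lambda>k l. \<Sum>i<m. conjug (cx_space E) (Ns i) (of_real_mat (\<alpha> i)) (real_mat (xs i)) k l)"
    by (subst x) (simp add: real_mat_def sum_real_mat)
qed

text \<open>Read from left to right this serves purity, from right to left the commutation clause of
  nc extremality.\<close>

lemma pure_factor_cx:
  assumes y: "y \<in> mats E M" and \<alpha>: "\<alpha> \<in> scalar_mats M N"
  shows "pure_factor (cx_space E) N (real_mat x) M (real_mat y) (of_real_mat \<alpha>) c (of_real_mat \<beta>) \<longleftrightarrow>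
    pure_factor E N x M y \<alpha> c \<beta>"
proof -
  have eq: "of_real_mat \<alpha> = (\<lambda>i j. of_real c * of_real_mat \<beta> i j) \<longleftrightarrow> \<alpha> = (\<lambda>i j. of_real c * \<beta> i j)"
    by (simp add: of_real_mat_def fun_eq_iff flip: of_real_mult)
  show ?thesis
  \<comment> \<open>If c is not positive or \<alpha> is not c times \<beta>, both sides are false;
    otherwise \<beta> inherits boundedness from \<alpha>.\<close>
  proof (cases "c > 0 \<and> \<alpha> = (\<lambda>i j. of_real c * \<beta> i j)")
    case True
    then have "\<beta> = (\<lambda>i j. (1 / c) * \<alpha> i j)" by (simp add: fun_eq_iff)
    then have \<beta>: "\<beta> \<in> scalar_mats M N" using scalar_mats_cmult[OF \<alpha>] by metis
    show ?thesis
      unfolding pure_factor_def eq of_real_mat_isometries_iff[OF \<beta>]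
        cx_conjug[OF y scalar_mats_square_summable(1)[OF \<beta>]] real_mat_eq_iff by simp
  qed (auto simp: pure_factor_def eq)
qed

lemma pure_cx_imp_pure:
  fixes K :: "('k, 'e) graded_set"
  assumes inf: "infinite (UNIV :: 'k set)" and K: "nc_convex E K" and x: "(N, x) \<in> K"
    and pure: "pure (cx_space E) (cx_set E K) (N, real_mat x)"
  shows "pure E K (N, x)"
  unfolding pure_def prod.case
proof (intro conjI allI impI x)
  fix m Ns xs \<alpha> i
  assume comb: "nc_comb E K N x m Ns xs \<alpha>" and i: "i < m"
  then obtain c \<beta> where f: "pure_factor (cx_space E) N (real_mat x) (Ns i) (real_mat (xs i)) (of_real_mat (\<alpha> i)) c \<beta>"
    using pure[unfolded pure_def prod.case, THEN conjunct2, rule_format, OF nc_comb_cx[OF inf K comb] i]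
    by metis
  have "\<beta> = of_real_mat (\<lambda>k l. 1 / c * \<alpha> i k l)"
    using pure_factor_cmult[OF f] by (simp add: of_real_mat_def)
  moreover have "xs i \<in> mats E (Ns i)" "\<alpha> i \<in> scalar_mats (Ns i) N"
    using comb i nc_convex_level_mats[OF K] by (simp_all add: nc_comb_def)
  ultimately show "\<exists>c \<beta>. pure_factor E N x (Ns i) (xs i) (\<alpha> i) c \<beta>"
    using f pure_factor_cx by metis
qed

lemma nc_extreme_cx_imp_nc_extreme:
  fixes K :: "('k, 'e) graded_set"
  assumes inf: "infinite (UNIV :: 'k set)" and K: "nc_convex E K" and x: "(N, x) \<in> K"
    and ext: "nc_extreme (cx_space E) (cx_set E K) (N, real_mat x)"
  shows "nc_extreme E K (N, x)"
  unfolding nc_extreme_def prod.case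
proof (intro conjI allI impI)
  show "pure E K (N, x)"
    using pure_cx_imp_pure[OF inf K x] ext by (simp add: nc_extreme_def)
  fix m Ns xs \<alpha> i c \<beta>
  assume comb: "nc_comb E K N x m Ns xs \<alpha>" and i: "i < m"
    and f: "pure_factor E N x (Ns i) (xs i) (\<alpha> i) c \<beta>"
  have y: "xs i \<in> mats E (Ns i)" and \<alpha>: "\<alpha> i \<in> scalar_mats (Ns i) N"
    using comb i nc_convex_level_mats[OF K] by (auto simp: nc_comb_def)
  have "\<beta> \<in> scalar_mats (Ns i) N" using f by (simp add: pure_factor_def isometries_def)
  \<comment> \<open>The rows and columns of the range projection are square summable, so its complex
    products with a real point are the real ones.\<close>
  note sq = range_projection_square_summable[OF this]
  have "lmult (cx_space E) (Ns i) (mat_prod N (of_real_mat \<beta>) (adj (of_real_mat \<beta>))) (real_mat (xs i)) =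
      rmult (cx_space E) (Ns i) (real_mat (xs i)) (mat_prod N (of_real_mat \<beta>) (adj (of_real_mat \<beta>)))"
    by (rule ext[unfolded nc_extreme_def prod.case, THEN conjunct2, rule_format,
          OF nc_comb_cx[OF inf K comb] i f[folded pure_factor_cx[OF y \<alpha>]]])
  then show "lmult E (Ns i) (mat_prod N \<beta> (adj \<beta>)) (xs i) = rmult E (Ns i) (xs i) (mat_prod N \<beta> (adj \<beta>))"
    unfolding adj_of_real_mat mat_prod_of_real cx_lmult[OF y sq(2)] cx_rmult[OF y sq(1)] by simp
qed

end


section \<open>The real line as a dual operator space\<close>

text \<open>The sum of the absolute values of the entries is a crude bound; some bound is all that
  is required for the infimum \<open>op_norm\<close> to be attained.\<close>

lemma op_bound_real_finite:
  fixes a :: "'a \<Rightarrow> 'b \<Rightarrow> real"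
  assumes "finite F" "finite G"
  shows "op_bound F G a (op_norm F G a)"
proof (rule op_bound_op_norm)
  show "op_bound F G a (\<Sum>i\<in>F. \<Sum>j\<in>G. \<bar>a i j\<bar>)"
    unfolding op_bound_real_iff
  proof (intro conjI allI)
    show "0 \<le> (\<Sum>i\<in>F. \<Sum>j\<in>G. \<bar>a i j\<bar>)" by (intro sum_nonneg) simp
    fix t s
    have mem: "\<bar>t i\<bar> \<le> L2_set t F" "\<bar>s j\<bar> \<le> L2_set s G" if "i \<in> F" "j \<in> G" for i j
      using that assms member_le_L2_set[of F i "\<lambda>i. \<bar>t i\<bar>"] member_le_L2_set[of G j "\<lambda>i. \<bar>s i\<bar>"]
      by simp_all
    have "\<bar>\<Sum>i\<in>F. \<Sum>j\<in>G. t i * s j * a i j\<bar> \<le> (\<Sum>i\<in>F. \<Sum>j\<in>G. \<bar>t i\<bar> * \<bar>s j\<bar> * \<bar>a i j\<bar>)"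
      by (intro order_trans[OF sum_abs] sum_mono) (simp add: abs_mult)
    also have "\<dots> \<le> (\<Sum>i\<in>F. \<Sum>j\<in>G. L2_set t F * L2_set s G * \<bar>a i j\<bar>)"
      using mem by (intro sum_mono mult_right_mono mult_mono) auto
    also have "\<dots> = (\<Sum>i\<in>F. \<Sum>j\<in>G. \<bar>a i j\<bar>) * L2_set t F * L2_set s G"
      by (simp add: sum_distrib_left sum_distrib_right mult_ac)
    finally show "\<bar>\<Sum>i\<in>F. \<Sum>j\<in>G. t i * s j * a i j\<bar> \<le> \<dots>" .
  qed
qed

lemma op_norm_nonneg:
  fixes a :: "'a \<Rightarrow> 'b \<Rightarrow> real"
  shows "finite F \<Longrightarrow> finite G \<Longrightarrow> 0 \<le> op_norm F G a"
  using op_bound_real_finite[of F G a] by (simp add: op_bound_def)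

lemma form_le_op_norm:
  fixes a :: "'a \<Rightarrow> 'b \<Rightarrow> real"
  assumes "finite F" "finite G"
  shows "\<bar>\<Sum>i\<in>F. \<Sum>j\<in>G. t i * s j * a i j\<bar> \<le> op_norm F G a * L2_set t F * L2_set s G"
  using op_bound_real_finite[OF assms, of a] by (simp add: op_bound_real_iff)

lemma op_norm_cong:
  "(\<And>i j. i \<in> F \<Longrightarrow> j \<in> G \<Longrightarrow> a i j = b i j) \<Longrightarrow> op_norm F G a = op_norm F G b"
  by (simp add: op_norm_def op_bound_def cong: L2_set_cong_simp sum.cong)

lemma entry_le_op_norm:
  fixes a :: "'a \<Rightarrow> 'b \<Rightarrow> real"
  assumes "finite F" "finite G" "i \<in> F" "j \<in> G"
  shows "\<bar>a i j\<bar> \<le> op_norm F G a"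
proof -
  have L2: "L2_set (\<lambda>k. if k = l then 1 else 0) A = 1" if "finite A" "l \<in> A" for l :: 'c and A
  proof -
    have "(\<Sum>k\<in>A. (if k = l then 1 else 0 :: real)\<^sup>2) = (\<Sum>k\<in>A. if k = l then 1 else 0)"
      by (intro sum.cong) auto
    with that show ?thesis by (simp add: L2_set_def)
  qed
  have "(\<Sum>k\<in>F. \<Sum>l\<in>G. (if k = i then 1 else 0) * (if l = j then 1 else 0) * a k l) =
      (\<Sum>k\<in>F. if k = i then \<Sum>l\<in>G. if l = j then a k l else 0 else 0)"
    by (intro sum.cong refl) (auto intro!: sum.cong)
  also have "\<dots> = a i j"
    using assms by simp
  finally have "(\<Sum>k\<in>F. \<Sum>l\<in>G. (if k = i then 1 else 0) * (if l = j then 1 else 0) * a k l) = a i j" .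
  then show ?thesis
    using form_le_op_norm[OF assms(1,2), of "\<lambda>k. if k = i then 1 else 0" "\<lambda>l. if l = j then 1 else 0" a]
    using assms by (simp add: L2)
qed

lemma op_norm_eq_0_iff:
  fixes a :: "'a \<Rightarrow> 'b \<Rightarrow> real"
  assumes "finite F" "finite G"
  shows "op_norm F G a = 0 \<longleftrightarrow> (\<forall>i\<in>F. \<forall>j\<in>G. a i j = 0)"
proof
  assume "op_norm F G a = 0"
  then show "\<forall>i\<in>F. \<forall>j\<in>G. a i j = 0" using entry_le_op_norm[OF assms, of _ _ a] by force
next
  assume "\<forall>i\<in>F. \<forall>j\<in>G. a i j = 0"
  then have "op_norm F G a \<le> 0"
    by (intro op_norm_le) (simp add: op_bound_def L2_set_def)
  then show "op_norm F G a = 0" using op_norm_nonneg[OF assms, of a] by simp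
qed

lemma op_norm_add_le:
  fixes a b :: "'a \<Rightarrow> 'b \<Rightarrow> real"
  assumes "finite F" "finite G"
  shows "op_norm F G (\<lambda>i j. a i j + b i j) \<le> op_norm F G a + op_norm F G b"
proof (rule op_norm_le, unfold op_bound_real_iff, intro conjI allI)
  show "0 \<le> op_norm F G a + op_norm F G b" using op_norm_nonneg[OF assms] by (intro add_nonneg_nonneg)
  fix t s
  have "(\<Sum>i\<in>F. \<Sum>j\<in>G. t i * s j * (a i j + b i j)) =
      (\<Sum>i\<in>F. \<Sum>j\<in>G. t i * s j * a i j) + (\<Sum>i\<in>F. \<Sum>j\<in>G. t i * s j * b i j)"
    by (simp add: distrib_left sum.distrib)
  then show "\<bar>\<Sum>i\<in>F. \<Sum>j\<in>G. t i * s j * (a i j + b i j)\<bar> \<le>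
      (op_norm F G a + op_norm F G b) * L2_set t F * L2_set s G"
    using form_le_op_norm[OF assms, of t s a] form_le_op_norm[OF assms, of t s b]
    by (simp add: distrib_right)
qed

lemma op_norm_cmult:
  fixes a :: "'a \<Rightarrow> 'b \<Rightarrow> real"
  assumes "finite F" "finite G"
  shows "op_norm F G (\<lambda>i j. c * a i j) = \<bar>c\<bar> * op_norm F G a"
proof -
  have le: "op_norm F G (\<lambda>i j. c * a i j) \<le> \<bar>c\<bar> * op_norm F G a" for c and a :: "'a \<Rightarrow> 'b \<Rightarrow> real"
  proof (rule op_norm_le, unfold op_bound_real_iff, intro conjI allI)
    show "0 \<le> \<bar>c\<bar> * op_norm F G a" using op_norm_nonneg[OF assms] by simp
    fix t s
    have "(\<Sum>i\<in>F. \<Sum>j\<in>G. t i * s j * (c * a i j)) = c * (\<Sum>i\<in>F. \<Sum>j\<in>G. t i * s j * a i j)"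
      by (simp add: sum_distrib_left mult_ac)
    then show "\<bar>\<Sum>i\<in>F. \<Sum>j\<in>G. t i * s j * (c * a i j)\<bar> \<le> \<bar>c\<bar> * op_norm F G a * L2_set t F * L2_set s G"
      using mult_left_mono[OF form_le_op_norm[OF assms, of t s a] abs_ge_zero[of c]]
      by (simp add: abs_mult mult_ac)
  qed
  show ?thesis
  proof (cases "c = 0")
    case True
    then show ?thesis using op_norm_eq_0_iff[OF assms, of "\<lambda>_ _. 0"] by simp
  next
    case False
    \<comment> \<open>The reverse inequality is the first one applied to the scaled matrix and 1 /
      c.\<close>
    have "op_norm F G a \<le> \<bar>1 / c\<bar> * op_norm F G (\<lambda>i j. c * a i j)"
      using le[of "1 / c" "\<lambda>i j. c * a i j"] False by simp
    then have "\<bar>c\<bar> * op_norm F G a \<le> op_norm F G (\<lambda>i j. c * a i j)"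
      using False by (simp add: field_simps)
    with le[of c a] show ?thesis by linarith
  qed
qed

lemma op_bound_transpose:
  fixes a :: "'a \<Rightarrow> 'b \<Rightarrow> real"
  assumes "op_bound F G a C"
  shows "op_bound G F (\<lambda>j i. a i j) C"
  unfolding op_bound_real_iff
proof (intro conjI allI)
  show "0 \<le> C" using assms by (simp add: op_bound_def)
  fix t s
  have "(\<Sum>j\<in>G. \<Sum>i\<in>F. t j * s i * a i j) = (\<Sum>i\<in>F. \<Sum>j\<in>G. s i * t j * a i j)"
    by (subst sum.swap) (simp add: mult_ac)
  moreover have "\<bar>\<Sum>i\<in>F. \<Sum>j\<in>G. s i * t j * a i j\<bar> \<le> C * L2_set s F * L2_set t G"
    using assms by (simp add: op_bound_real_iff)
  ultimately show "\<bar>\<Sum>j\<in>G. \<Sum>i\<in>F. t j * s i * a i j\<bar> \<le> C * L2_set t G * L2_set s F"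
    by (simp add: mult_ac)
qed

text \<open>Vectors are transported along the injections and extended by zero. This covers both
  submatrices and changes of index set.\<close>

lemma op_bound_reindex:
  fixes a :: "'a \<Rightarrow> 'b \<Rightarrow> real" and f :: "'c \<Rightarrow> 'a" and g :: "'d \<Rightarrow> 'b"
  assumes a: "op_bound F' G' a C" and fin: "finite F'" "finite G'"
    and f: "inj_on f F" "f ` F \<subseteq> F'" and g: "inj_on g G" "g ` G \<subseteq> G'"
  shows "op_bound F G (\<lambda>i j. a (f i) (g j)) C"
  unfolding op_bound_real_iff
proof (intro conjI allI)
  show "0 \<le> C" using a by (simp add: op_bound_def)
  fix t :: "'c \<Rightarrow> real" and s :: "'d \<Rightarrow> real"
  define t' where "t' = (\<lambda>k. if k \<in> f ` F then t (the_inv_into F f k) else 0)"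
  define s' where "s' = (\<lambda>k. if k \<in> g ` G then s (the_inv_into G g k) else 0)"
  have t': "t' (f i) = t i" if "i \<in> F" for i using that f by (simp add: t'_def the_inv_into_f_f)
  have s': "s' (g j) = s j" if "j \<in> G" for j using that g by (simp add: s'_def the_inv_into_f_f)
  have sumF: "(\<Sum>k\<in>F'. h k) = (\<Sum>i\<in>F. h (f i))" if "\<And>k. k \<notin> f ` F \<Longrightarrow> h k = 0" for h :: "'a \<Rightarrow> real"
  proof -
    have "(\<Sum>k\<in>F'. h k) = (\<Sum>k\<in>f ` F. h k)"
      using that f(2) fin by (intro sum.mono_neutral_right) auto
    then show ?thesis by (simp add: sum.reindex[OF f(1)])
  qed
  have sumG: "(\<Sum>k\<in>G'. h k) = (\<Sum>i\<in>G. h (g i))" if "\<And>k. k \<notin> g ` G \<Longrightarrow> h k = 0" for h :: "'b \<Rightarrow> real"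
  proof -
    have "(\<Sum>k\<in>G'. h k) = (\<Sum>k\<in>g ` G. h k)"
      using that g(2) fin by (intro sum.mono_neutral_right) auto
    then show ?thesis by (simp add: sum.reindex[OF g(1)])
  qed
  have "(\<Sum>i\<in>F'. \<Sum>j\<in>G'. t' i * s' j * a i j) = (\<Sum>i\<in>F. \<Sum>j\<in>G'. t' (f i) * s' j * a (f i) j)"
    by (rule sumF) (simp add: t'_def)
  also have "\<dots> = (\<Sum>i\<in>F. \<Sum>j\<in>G. t' (f i) * s' (g j) * a (f i) (g j))"
    by (intro sum.cong refl sumG) (simp add: s'_def)
  finally have "(\<Sum>i\<in>F'. \<Sum>j\<in>G'. t' i * s' j * a i j) = (\<Sum>i\<in>F. \<Sum>j\<in>G. t i * s j * a (f i) (g j))"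
    by (simp add: t' s' cong: sum.cong)
  moreover have "L2_set t' F' = L2_set t F"
    unfolding L2_set_def by (subst sumF) (simp_all add: t'_def f the_inv_into_f_f cong: sum.cong)
  moreover have "L2_set s' G' = L2_set s G"
    unfolding L2_set_def by (subst sumG) (simp_all add: s'_def g the_inv_into_f_f cong: sum.cong)
  moreover have "\<bar>\<Sum>i\<in>F'. \<Sum>j\<in>G'. t' i * s' j * a i j\<bar> \<le> C * L2_set t' F' * L2_set s' G'"
    using a by (simp add: op_bound_real_iff)
  ultimately show "\<bar>\<Sum>i\<in>F. \<Sum>j\<in>G. t i * s j * a (f i) (g j)\<bar> \<le> C * L2_set t F * L2_set s G"
    by simp
qed

lemma sum_lessThan_add:
  fixes f :: "nat \<Rightarrow> 'a::comm_monoid_add"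
  shows "sum f {..<m + n} = sum f {..<m} + (\<Sum>i<n. f (m + i))"
  by (induction n) (simp_all add: add.assoc)

lemma L2_set_lessThan_add:
  fixes m n :: nat
  shows "L2_set t {..<m + n} = sqrt ((L2_set t {..<m})\<^sup>2 + (L2_set (\<lambda>i. t (m + i)) {..<n})\<^sup>2)"
  by (simp add: L2_set_power2) (simp add: L2_set_def sum_lessThan_add)

lemma Cauchy_Schwarz_2: "a * b + c * d \<le> sqrt (a\<^sup>2 + c\<^sup>2) * sqrt (b\<^sup>2 + d\<^sup>2)" for a b c d :: real
  using abs_sum_mult_le_L2_set[of "\<lambda>i. if i then a else c" "\<lambda>i. if i then b else d" "{True, False}"]
  by (simp add: L2_set_def)

text \<open>Vectors split into two parts whose squared norms add, so Cauchy-Schwarz in the plane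
  gives the upper bound; the two corners are submatrices, which gives the lower bound.\<close>

lemma op_norm_diag_sum:
  fixes x y :: "nat \<Rightarrow> nat \<Rightarrow> real"
  shows "op_norm {..<m + n} {..<m + n} (diag_sum m n x y) =
    max (op_norm {..<m} {..<m} x) (op_norm {..<n} {..<n} y)"
proof (rule antisym)
  let ?C = "max (op_norm {..<m} {..<m} x) (op_norm {..<n} {..<n} y)"
  have C: "0 \<le> ?C" using op_norm_nonneg[of "{..<m}" "{..<m}" x] by simp
  show "op_norm {..<m + n} {..<m + n} (diag_sum m n x y) \<le> ?C"
  proof (rule op_norm_le, unfold op_bound_real_iff, intro conjI allI C)
    fix t s :: "nat \<Rightarrow> real"
    let ?t1 = "L2_set t {..<m}" and ?t2 = "L2_set (\<lambda>i. t (m + i)) {..<n}"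
      and ?s1 = "L2_set s {..<m}" and ?s2 = "L2_set (\<lambda>i. s (m + i)) {..<n}"
    have eq: "(\<Sum>i<m + n. \<Sum>j<m + n. t i * s j * diag_sum m n x y i j) =
        (\<Sum>i<m. \<Sum>j<m. t i * s j * x i j) + (\<Sum>i<n. \<Sum>j<n. t (m + i) * s (m + j) * y i j)"
      by (simp add: sum_lessThan_add diag_sum_def)
    have "\<bar>\<Sum>i<m + n. \<Sum>j<m + n. t i * s j * diag_sum m n x y i j\<bar> \<le>
        op_norm {..<m} {..<m} x * ?t1 * ?s1 + op_norm {..<n} {..<n} y * ?t2 * ?s2"
      using form_le_op_norm[of "{..<m}" "{..<m}" t s x]
        form_le_op_norm[of "{..<n}" "{..<n}" "\<lambda>i. t (m + i)" "\<lambda>i. s (m + i)" y]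
      unfolding eq by simp
    also have "\<dots> \<le> ?C * ?t1 * ?s1 + ?C * ?t2 * ?s2"
      by (intro add_mono mult_right_mono max.cobounded1 max.cobounded2 L2_set_nonneg)
    also have "\<dots> = ?C * (?t1 * ?s1 + ?t2 * ?s2)"
      by (simp only: distrib_left mult.assoc)
    also have "\<dots> \<le> ?C * (L2_set t {..<m + n} * L2_set s {..<m + n})"
      unfolding L2_set_lessThan_add by (rule mult_left_mono[OF Cauchy_Schwarz_2 C])
    finally show "\<bar>\<Sum>i<m + n. \<Sum>j<m + n. t i * s j * diag_sum m n x y i j\<bar> \<le>
        ?C * L2_set t {..<m + n} * L2_set s {..<m + n}"
      by (simp only: mult.assoc)
  qed
next
  let ?D = "op_norm {..<m + n} {..<m + n} (diag_sum m n x y)"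
  have D: "op_bound {..<m + n} {..<m + n} (diag_sum m n x y) ?D"
    by (rule op_bound_real_finite) simp_all
  have "op_norm {..<m} {..<m} (\<lambda>i j. diag_sum m n x y (id i) (id j)) \<le> ?D"
    by (rule op_norm_le, rule op_bound_reindex[OF D]) auto
  moreover have "op_norm {..<m} {..<m} (\<lambda>i j. diag_sum m n x y (id i) (id j)) = op_norm {..<m} {..<m} x"
    by (rule op_norm_cong) (simp add: diag_sum_def)
  moreover have "op_norm {..<n} {..<n} (\<lambda>i j. diag_sum m n x y (m + i) (m + j)) \<le> ?D"
    by (rule op_norm_le, rule op_bound_reindex[OF D]) auto
  moreover have "op_norm {..<n} {..<n} (\<lambda>i j. diag_sum m n x y (m + i) (m + j)) = op_norm {..<n} {..<n} y"
    by (rule op_norm_cong) (simp add: diag_sum_def)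
  ultimately show "max (op_norm {..<m} {..<m} x) (op_norm {..<n} {..<n} y) \<le> ?D"
    by simp
qed

text \<open>The operator norm on real matrices makes the matrices over this space the bounded
  operators. Every linear functional on the line is multiplication by a scalar, hence the predual is
  the full dual.\<close>

definition real_space :: "(real, real) opspace" where
  "real_space = \<lparr>scal = (*), mnorm = (\<lambda>n. op_norm {..<n} {..<n}), predual = range (*)\<rparr>"

lemma real_space_simps [simp]:
  "scal real_space = (*)" "mnorm real_space n = op_norm {..<n} {..<n}" "predual real_space = range (*)"
  by (simp_all add: real_space_def)

text \<open>The form of a x b at t, s is the form of x at the transpose of a applied to t and at b
  applied to s.\<close>

lemma op_norm_bimod_le:
  "op_norm {..<m} {..<m} (bimod real_space n a x b) \<le>
    op_norm {..<m} {..<n} a * op_norm {..<n} {..<n} x * op_norm {..<n} {..<m} b"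
proof (rule op_norm_le, unfold op_bound_real_iff, intro conjI allI)
  show "0 \<le> op_norm {..<m} {..<n} a * op_norm {..<n} {..<n} x * op_norm {..<n} {..<m} b"
    by (intro mult_nonneg_nonneg op_norm_nonneg) simp_all
  fix t s :: "nat \<Rightarrow> real"
  define t' where "t' i = (\<Sum>k<m. a k i * t k)" for i
  define s' where "s' j = (\<Sum>l<m. b j l * s l)" for j
  have t': "L2_set t' {..<n} \<le> op_norm {..<m} {..<n} a * L2_set t {..<m}"
    using op_bound_transpose[OF op_bound_real_finite[of "{..<m}" "{..<n}" a]]
    by (simp add: op_bound_def t'_def[abs_def])
  have s': "L2_set s' {..<n} \<le> op_norm {..<n} {..<m} b * L2_set s {..<m}"
    using op_bound_real_finite[of "{..<n}" "{..<m}" b] by (simp add: op_bound_def s'_def[abs_def])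
  have "(\<Sum>k<m. \<Sum>l<m. t k * s l * bimod real_space n a x b k l) =
      (\<Sum>k<m. \<Sum>l<m. \<Sum>i<n. \<Sum>j<n. (a k i * t k) * (b j l * s l) * x i j)"
    by (simp add: bimod_def sum_distrib_left mult_ac)
  also have "\<dots> = (\<Sum>i<n. \<Sum>j<n. \<Sum>k<m. \<Sum>l<m. (a k i * t k) * (b j l * s l) * x i j)"
    by (simp only: sum.swap[of _ "{..<n}" "{..<m}"])
  also have "\<dots> = (\<Sum>i<n. \<Sum>j<n. t' i * s' j * x i j)"
    by (simp only: t'_def s'_def sum_product) (simp only: sum_distrib_right)
  also have "\<bar>\<dots>\<bar> \<le> op_norm {..<n} {..<n} x * L2_set t' {..<n} * L2_set s' {..<n}"
    by (rule form_le_op_norm) simp_all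
  also have "\<dots> \<le> op_norm {..<n} {..<n} x * (op_norm {..<m} {..<n} a * L2_set t {..<m}) *
      (op_norm {..<n} {..<m} b * L2_set s {..<m})"
    by (intro mult_mono t' s' mult_nonneg_nonneg op_norm_nonneg L2_set_nonneg order_refl) simp_all
  finally show "\<bar>\<Sum>k<m. \<Sum>l<m. t k * s l * bimod real_space n a x b k l\<bar> \<le>
      op_norm {..<m} {..<n} a * op_norm {..<n} {..<n} x * op_norm {..<n} {..<m} b *
      L2_set t {..<m} * L2_set s {..<m}"
    by (simp add: mult_ac)
qed

lemma operator_space_real: "operator_space real_space"
  unfolding operator_space_def real_space_simps
proof (intro conjI allI impI)
  show "vector_space ((*) :: real \<Rightarrow> real \<Rightarrow> real)"
    by unfold_locales (simp_all add: algebra_simps)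
  fix m n :: nat and c and a x y b :: "nat \<Rightarrow> nat \<Rightarrow> real"
  show "op_norm {..<n} {..<n} x = op_norm {..<n} {..<n} y" if "\<forall>i<n. \<forall>j<n. x i j = y i j"
    using that by (intro op_norm_cong) simp
  show "0 \<le> op_norm {..<n} {..<n} x" by (simp add: op_norm_nonneg)
  show "op_norm {..<n} {..<n} x = 0 \<longleftrightarrow> (\<forall>i<n. \<forall>j<n. x i j = 0)"
    by (simp add: op_norm_eq_0_iff Ball_def)
  show "op_norm {..<n} {..<n} (\<lambda>i j. x i j + y i j) \<le> op_norm {..<n} {..<n} x + op_norm {..<n} {..<n} y"
    by (simp add: op_norm_add_le)
  show "op_norm {..<n} {..<n} (\<lambda>i j. c * x i j) = norm c * op_norm {..<n} {..<n} x"
    by (simp add: op_norm_cmult)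
  show "op_norm {..<m} {..<m} (bimod real_space n a x b) \<le>
    op_norm {..<m} {..<n} a * op_norm {..<n} {..<n} x * op_norm {..<n} {..<m} b"
    by (rule op_norm_bimod_le)
  show "op_norm {..<m + n} {..<m + n} (diag_sum m n x y) =
    max (op_norm {..<m} {..<m} x) (op_norm {..<n} {..<n} y)"
    by (rule op_norm_diag_sum)
qed

lemma op_norm_const_1: "op_norm {..<Suc 0} {..<Suc 0} (\<lambda>_ _. e) = \<bar>e\<bar>" for e :: real
proof (rule antisym)
  show "op_norm {..<Suc 0} {..<Suc 0} (\<lambda>_ _. e) \<le> \<bar>e\<bar>"
    by (rule op_norm_le) (simp add: op_bound_def lessThan_Suc abs_mult)
  show "\<bar>e\<bar> \<le> op_norm {..<Suc 0} {..<Suc 0} (\<lambda>_ _. e)"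
    using entry_le_op_norm[of "{..<Suc 0}" "{..<Suc 0}" 0 0 "\<lambda>_ _. e"] by simp
qed

text \<open>The identity functional therefore has \<open>cb_norm\<close> at most one and attains the
  supremum by which a dual space recovers its matrix norms.\<close>

lemma pair_norm_one: "pair_norm (Suc 0) n (\<lambda>_ _ e. e) x = op_norm {..<n} {..<n} x" for x :: "nat \<Rightarrow> nat \<Rightarrow> real"
proof -
  have "op_bound ({..<Suc 0} \<times> {..<n}) ({..<Suc 0} \<times> {..<n}) (pair_mat (\<lambda>_ _ e. e) x) C \<longleftrightarrow>
      op_bound {..<n} {..<n} x C" for C
    unfolding op_bound_def
  proof (intro conj_cong refl iffI allI)
    fix \<xi> :: "nat \<Rightarrow> real"
    assume "\<forall>\<xi>. L2_set (\<lambda>i. norm (\<Sum>j\<in>{..<Suc 0} \<times> {..<n}. pair_mat (\<lambda>_ _ e. e) x i j * \<xi> j))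
        ({..<Suc 0} \<times> {..<n}) \<le> C * L2_set (\<lambda>j. norm (\<xi> j)) ({..<Suc 0} \<times> {..<n})"
    from this[rule_format, of "\<xi> \<circ> snd"]
    show "L2_set (\<lambda>i. norm (\<Sum>j<n. x i j * \<xi> j)) {..<n} \<le> C * L2_set (\<lambda>j. norm (\<xi> j)) {..<n}"
      by (simp add: sum_unit_times L2_set_unit_times pair_mat_def)
  next
    fix \<xi> :: "nat \<times> nat \<Rightarrow> real"
    assume "\<forall>\<xi>. L2_set (\<lambda>i. norm (\<Sum>j<n. x i j * \<xi> j)) {..<n} \<le> C * L2_set (\<lambda>j. norm (\<xi> j)) {..<n}"
    from this[rule_format, of "\<lambda>j. \<xi> (0, j)"]
    show "L2_set (\<lambda>i. norm (\<Sum>j\<in>{..<Suc 0} \<times> {..<n}. pair_mat (\<lambda>_ _ e. e) x i j * \<xi> j))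
        ({..<Suc 0} \<times> {..<n}) \<le> C * L2_set (\<lambda>j. norm (\<xi> j)) ({..<Suc 0} \<times> {..<n})"
      by (simp add: sum_unit_times L2_set_unit_times pair_mat_def)
  qed
  then show ?thesis by (simp add: pair_norm_def op_norm_def)
qed

text \<open>A crude estimate, entry by entry of \<gamma>. It bounds the supremum in
  \<open>cb_norm\<close> and settles matrices of norm zero; the sharp bound comes from
  scaling.\<close>

lemma pair_norm_real_le:
  fixes \<phi> :: "nat \<Rightarrow> nat \<Rightarrow> real \<Rightarrow> real"
  assumes \<phi>: "\<And>k l. k < m \<Longrightarrow> l < m \<Longrightarrow> \<phi> k l = (*) (\<gamma> k l)"
  shows "pair_norm m n \<phi> x \<le> (\<Sum>k<m. \<Sum>l<m. \<bar>\<gamma> k l\<bar>) * op_norm {..<n} {..<n} x"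
  unfolding pair_norm_def
proof (rule op_norm_le, unfold op_bound_real_iff, intro conjI allI)
  let ?N = "op_norm {..<n} {..<n} x" and ?P = "{..<m} \<times> {..<n}"
  have N: "0 \<le> ?N" by (simp add: op_norm_nonneg)
  then show "0 \<le> (\<Sum>k<m. \<Sum>l<m. \<bar>\<gamma> k l\<bar>) * ?N"
    by (intro mult_nonneg_nonneg sum_nonneg) simp_all
  fix t s :: "nat \<times> nat \<Rightarrow> real"
  have row: "L2_set (\<lambda>i. u (k, i)) {..<n} \<le> L2_set u ?P" if "k < m" for u k
  proof -
    have "L2_set (\<lambda>i. u (k, i)) {..<n} = L2_set u (Pair k ` {..<n})"
      by (simp add: L2_set_def sum.reindex inj_on_def)
    also have "\<dots> \<le> L2_set u ?P" using that by (intro L2_set_subset_le) auto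
    finally show ?thesis .
  qed
  have "(\<Sum>i\<in>?P. \<Sum>j\<in>?P. t i * s j * pair_mat \<phi> x i j) =
      (\<Sum>k<m. \<Sum>i<n. \<Sum>l<m. \<Sum>j<n. t (k, i) * s (l, j) * (\<gamma> k l * x i j))"
    unfolding sum.cartesian_product' pair_mat_def prod.case by (intro sum.cong refl) (simp add: \<phi>)
  also have "\<dots> = (\<Sum>k<m. \<Sum>l<m. \<gamma> k l * (\<Sum>i<n. \<Sum>j<n. t (k, i) * s (l, j) * x i j))"
    by (subst sum.swap[of _ "{..<m}" "{..<n}"]) (simp add: sum_distrib_left mult_ac)
  finally have eq: "(\<Sum>i\<in>?P. \<Sum>j\<in>?P. t i * s j * pair_mat \<phi> x i j) =
      (\<Sum>k<m. \<Sum>l<m. \<gamma> k l * (\<Sum>i<n. \<Sum>j<n. t (k, i) * s (l, j) * x i j))" .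
  have "\<bar>\<Sum>i\<in>?P. \<Sum>j\<in>?P. t i * s j * pair_mat \<phi> x i j\<bar> \<le>
      (\<Sum>k<m. \<Sum>l<m. \<bar>\<gamma> k l\<bar> * \<bar>\<Sum>i<n. \<Sum>j<n. t (k, i) * s (l, j) * x i j\<bar>)"
    unfolding eq by (intro order_trans[OF sum_abs] sum_mono) (simp add: abs_mult)
  also have "\<dots> \<le> (\<Sum>k<m. \<Sum>l<m. \<bar>\<gamma> k l\<bar> * (?N * L2_set t ?P * L2_set s ?P))"
  proof (intro sum_mono mult_left_mono abs_ge_zero)
    fix k l assume "k \<in> {..<m}" "l \<in> {..<m}"
    then show "\<bar>\<Sum>i<n. \<Sum>j<n. t (k, i) * s (l, j) * x i j\<bar> \<le> ?N * L2_set t ?P * L2_set s ?P"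
      by (intro order_trans[OF form_le_op_norm] mult_mono row mult_nonneg_nonneg N L2_set_nonneg order_refl)
        simp_all
  qed
  also have "\<dots> = (\<Sum>k<m. \<Sum>l<m. \<bar>\<gamma> k l\<bar>) * ?N * L2_set t ?P * L2_set s ?P"
    by (simp only: sum_distrib_right mult.assoc)
  finally show "\<bar>\<Sum>i\<in>?P. \<Sum>j\<in>?P. t i * s j * pair_mat \<phi> x i j\<bar> \<le>
      (\<Sum>k<m. \<Sum>l<m. \<bar>\<gamma> k l\<bar>) * ?N * L2_set t ?P * L2_set s ?P" .
qed

text \<open>The supremum runs over matrices of norm at most one, so x is divided by its norm when
  that is not zero.\<close>

lemma pair_norm_le_cb_norm_real:
  fixes \<phi> :: "nat \<Rightarrow> nat \<Rightarrow> real \<Rightarrow> real"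
  assumes \<phi>: "\<And>k l. k < m \<Longrightarrow> l < m \<Longrightarrow> \<phi> k l = (*) (\<gamma> k l)" and cb: "cb_norm real_space m \<phi> \<le> 1"
  shows "pair_norm m n \<phi> x \<le> op_norm {..<n} {..<n} x"
proof (cases "op_norm {..<n} {..<n} x = 0")
  case True
  then show ?thesis using pair_norm_real_le[of m \<phi> \<gamma> n x] \<phi> by simp
next
  case False
  let ?N = "op_norm {..<n} {..<n} x" and ?D = "\<Sum>k<m. \<Sum>l<m. \<bar>\<gamma> k l\<bar>"
  have N: "?N > 0" using False op_norm_nonneg[of "{..<n}" "{..<n}" x] by simp
  let ?y = "\<lambda>i j. 1 / ?N * x i j"
  have y: "op_norm {..<n} {..<n} ?y = 1" using N by (simp only: op_norm_cmult finite_lessThan) simp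
  have "pair_norm m n \<phi> z \<le> ?D" if "op_norm {..<n} {..<n} z \<le> 1" for n z
  proof -
    have "?D * op_norm {..<n} {..<n} z \<le> ?D * 1"
      by (rule mult_left_mono[OF that]) (intro sum_nonneg abs_ge_zero)
    then show ?thesis using pair_norm_real_le[of m \<phi> \<gamma> n z] \<phi> by simp
  qed
  then have "bdd_above ((\<lambda>(n, x). pair_norm m n \<phi> x) ` {(n, x). mnorm real_space n x \<le> 1})"
    by (intro bdd_aboveI[of _ ?D]) auto
  from cSUP_upper[OF _ this, of "(n, ?y)"] cb have "pair_norm m n \<phi> ?y \<le> 1"
    unfolding cb_norm_def using y by simp
  also have "pair_norm m n \<phi> ?y =
      op_norm ({..<m} \<times> {..<n}) ({..<m} \<times> {..<n}) (\<lambda>i j. 1 / ?N * pair_mat \<phi> x i j)"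
    unfolding pair_norm_def using \<phi> by (intro op_norm_cong) (auto simp: pair_mat_def)
  also have "\<dots> = 1 / ?N * pair_norm m n \<phi> x"
    unfolding pair_norm_def using N by (subst op_norm_cmult) simp_all
  finally show ?thesis using N by (simp add: divide_le_eq)
qed

lemma dual_operator_space_real: "dual_operator_space real_space"
  unfolding dual_operator_space_def real_space_simps
proof (intro conjI ballI allI impI)
  show "operator_space real_space" by (rule operator_space_real)
  show "(\<lambda>_. 0) \<in> range ((*) :: real \<Rightarrow> real \<Rightarrow> real)"
    by (intro image_eqI[of _ _ 0]) auto
  fix \<phi> :: "real \<Rightarrow> real" assume "\<phi> \<in> range (*)"
  then obtain c where c: "\<phi> = (*) c" by blast
  show "Vector_Spaces.linear (*) (*) \<phi>"
    unfolding c by unfold_locales (simp_all add: algebra_simps)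
  show "\<exists>C. \<forall>e. norm (\<phi> e) \<le> C * op_norm {..<1::nat} {..<1::nat} (\<lambda>_ _. e)"
    by (intro exI[of _ "\<bar>c\<bar>"]) (simp add: c op_norm_const_1 abs_mult)
  show "(\<lambda>e. d * \<phi> e) \<in> range (*)" for d
    by (intro image_eqI[of _ _ "d * c"]) (auto simp: c)
  fix \<psi> :: "real \<Rightarrow> real" assume "\<psi> \<in> range (*)"
  then obtain d where d: "\<psi> = (*) d" by blast
  show "(\<lambda>e. \<phi> e + \<psi> e) \<in> range (*)"
    by (intro image_eqI[of _ _ "c + d"]) (auto simp: c d algebra_simps)
next
  show "norm_closure UNIV (\<lambda>e. op_norm {..<1::nat} {..<1::nat} (\<lambda>_ _. e)) (range (*)) \<subseteq> range ((*) :: real \<Rightarrow> _)"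
  proof
    fix \<psi> :: "real \<Rightarrow> real"
    assume \<psi>: "\<psi> \<in> norm_closure UNIV (\<lambda>e. op_norm {..<1::nat} {..<1::nat} (\<lambda>_ _. e)) (range (*))"
    have "\<psi> e = \<psi> 1 * e" for e
    proof (rule ccontr)
      assume ne: "\<psi> e \<noteq> \<psi> 1 * e"
      \<comment> \<open>The errors at e and at 1 contribute at most
        \<open>\<epsilon> * \<bar>e\<bar>\<close> each; the summand 1 keeps the denominator positive
        and makes the contradiction strict.\<close>
      define \<epsilon> where "\<epsilon> = \<bar>\<psi> e - \<psi> 1 * e\<bar> / (2 * \<bar>e\<bar> + 1)"
      have "\<epsilon> > 0" unfolding \<epsilon>_def using ne by (intro divide_pos_pos) auto
      then obtain c where c: "\<And>e. \<bar>\<psi> e - c * e\<bar> \<le> \<epsilon> * \<bar>e\<bar>"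
        using \<psi> by (auto simp: norm_closure_def op_norm_const_1)
      have "\<bar>\<psi> e - \<psi> 1 * e\<bar> \<le> \<bar>\<psi> e - c * e\<bar> + \<bar>\<psi> 1 - c\<bar> * \<bar>e\<bar>"
        unfolding abs_mult[symmetric] by (simp add: algebra_simps)
      also have "\<dots> \<le> \<epsilon> * \<bar>e\<bar> + \<epsilon> * \<bar>e\<bar>"
        using c[of e] c[of 1] by (intro add_mono mult_right_mono) auto
      also have "\<dots> < \<epsilon> * (2 * \<bar>e\<bar> + 1)"
        using \<open>\<epsilon> > 0\<close> by (simp add: algebra_simps)
      also have "\<dots> = \<bar>\<psi> e - \<psi> 1 * e\<bar>" by (simp add: \<epsilon>_def)
      finally show False by simp
    qed
    then have "\<psi> = (*) (\<psi> 1)" by (rule ext)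
    then show "\<psi> \<in> range (*)" by (rule image_eqI) simp
  qed
next
  fix T :: "(real \<Rightarrow> real) \<Rightarrow> real"
  assume T: "(\<forall>\<phi>\<in>range (*). \<forall>\<psi>\<in>range (*). T (\<lambda>e. \<phi> e + \<psi> e) = T \<phi> + T \<psi>) \<and>
    (\<forall>c. \<forall>\<phi>\<in>range (*). T (\<lambda>e. c * \<phi> e) = c * T \<phi>) \<and>
    (\<exists>C. \<forall>\<phi>\<in>range (*). norm (T \<phi>) \<le> C * cb_norm real_space 1 (\<lambda>_ _. \<phi>))"
  \<comment> \<open>A homogeneous map on the one-dimensional predual is determined by its value at
    the identity, and that value is the representing element.\<close>
  have hom: "T ((*) c) = T ((*) 1) * c" for c
  proof -
    have "T (\<lambda>e. c * (1 * e)) = c * T ((*) 1)"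
      by (rule T[THEN conjunct2, THEN conjunct1, THEN spec, THEN bspec]) (rule rangeI)
    then show ?thesis by (simp only: mult_1_left mult.commute[of c "T _"])
  qed
  show "\<exists>!e. \<forall>\<phi>\<in>range (*). T \<phi> = \<phi> e"
  proof (rule ex1I)
    show "\<forall>\<phi>\<in>range (*). T \<phi> = \<phi> (T ((*) 1))"
    proof
      fix \<phi> :: "real \<Rightarrow> real" assume "\<phi> \<in> range (*)"
      then obtain c where "\<phi> = (*) c" by blast
      then show "T \<phi> = \<phi> (T ((*) 1))" using hom[of c] by (simp only: mult.commute)
    qed
    show "e = T ((*) 1)" if "\<forall>\<phi>\<in>range (*). T \<phi> = \<phi> e" for e
      using bspec[OF that, of "(*) 1"] by simp
  qed
next
  fix n and x :: "nat \<Rightarrow> nat \<Rightarrow> real"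
  let ?S = "{(m, \<phi>). (\<forall>k<m. \<forall>l<m. \<phi> k l \<in> range (*)) \<and> cb_norm real_space m \<phi> \<le> 1}"
  have le: "pair_norm m n \<phi> x \<le> op_norm {..<n} {..<n} x" if "(m, \<phi>) \<in> ?S" for m \<phi>
  proof -
    have "\<forall>k l. \<exists>c. k < m \<longrightarrow> l < m \<longrightarrow> \<phi> k l = (*) c" using that by blast
    then obtain \<gamma> where "\<And>k l. k < m \<Longrightarrow> l < m \<Longrightarrow> \<phi> k l = (*) (\<gamma> k l)" by metis
    with that show ?thesis by (intro pair_norm_le_cb_norm_real) auto
  qed
  have "cb_norm real_space 1 (\<lambda>_ _ e. e) \<le> 1"
  proof -
    let ?B = "{(n, x). mnorm real_space n x \<le> 1}"
    have "op_norm {..<0::nat} {..<0::nat} (\<lambda>_ _. 0::real) \<le> 1"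
      by (rule op_norm_le) (simp add: op_bound_def)
    then have "(0, \<lambda>_ _. 0) \<in> ?B" by simp
    then have "?B \<noteq> {}" by (metis empty_iff)
    then show ?thesis
      unfolding cb_norm_def by (rule cSUP_least) (auto simp: pair_norm_one)
  qed
  moreover have "(\<lambda>e. e) \<in> range ((*) :: real \<Rightarrow> real \<Rightarrow> real)" by (intro image_eqI[of _ _ 1]) auto
  ultimately have one: "(1, \<lambda>_ _ e. e) \<in> ?S" by simp
  show "op_norm {..<n} {..<n} x = (SUP (m, \<phi>)\<in>?S. pair_norm m n \<phi> x)"
  proof (rule antisym)
    show "(SUP (m, \<phi>)\<in>?S. pair_norm m n \<phi> x) \<le> op_norm {..<n} {..<n} x"
    proof (rule cSUP_least)
      show "?S \<noteq> {}" using one by (metis empty_iff)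
    qed (use le in auto)
    have "bdd_above ((\<lambda>(m, \<phi>). pair_norm m n \<phi> x) ` ?S)"
      using le by (intro bdd_aboveI[of _ "op_norm {..<n} {..<n} x"]) auto
    from cSUP_upper[OF one this] show "op_norm {..<n} {..<n} x \<le> (SUP (m, \<phi>)\<in>?S. pair_norm m n \<phi> x)"
      by (simp add: pair_norm_one)
  qed
qed


section \<open>Contractions\<close>

definition contractions :: "('k, real) graded_set" where
  "contractions = {(N, x). N \<noteq> {} \<and> (\<forall>i j. i \<notin> N \<or> j \<notin> N \<longrightarrow> x i j = 0) \<and> form_bound N x 1}"

lemma level_contractions_iff:
  "x \<in> level contractions N \<longleftrightarrow>
    N \<noteq> {} \<and> (\<forall>i j. i \<notin> N \<or> j \<notin> N \<longrightarrow> x i j = 0) \<and> form_bound N x 1"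
  by (simp add: level_def contractions_def)

lemma mnorm_submat_le_one:
  assumes x: "form_bound N x 1" and f: "(n, f) \<in> selections N"
  shows "mnorm real_space n (submat f x) \<le> 1"
proof -
  have f: "inj_on f {..<n}" "f ` {..<n} \<subseteq> N" using f by (auto simp: selections_def)
  have "op_bound (f ` {..<n}) (f ` {..<n}) x 1"
    unfolding op_bound_real_iff using form_boundD[OF x _ f(2) _ f(2)] by simp
  from op_bound_reindex[OF this _ _ f(1) _ f(1)] show ?thesis
    by (simp add: op_norm_le submat_def)
qed

lemma level_contractions_mats: "x \<in> level contractions N \<Longrightarrow> x \<in> mats real_space N"
  unfolding level_contractions_iff mats_def using mnorm_submat_le_one by blast

lemma mats_norm_le_one:
  assumes "x \<in> level contractions N"
  shows "mats_norm real_space N x \<le> 1"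
  unfolding mats_norm_def
proof (rule cSUP_least)
  have "(0, undefined) \<in> selections N" by (simp add: selections_def)
  then show "selections N \<noteq> {}" by (metis empty_iff)
qed (use assms mnorm_submat_le_one in \<open>auto simp: level_contractions_iff\<close>)

lemma ident_mem_predual: "(*) 1 \<in> predual real_space"
  by simp

lemma conjug_real_eq_form:
  assumes x: "x \<in> mats real_space N" and b: "\<And>l. square_summable N (\<lambda>j. b j l)"
  shows "conjug real_space N b x k l = form N x (\<lambda>i. b i k) (\<lambda>j. b j l)"
  using predual_conjug(2)[OF dual_operator_space_real x b ident_mem_predual, where k = k and l = l] by simp

text \<open>The form of b* x b at t, s is the form of x at the combinations of the columns of b with
  coefficients t and s. Compressions, direct sums and the extremality of the rotation all rest on
  this estimate.\<close>

lemma conjug_contraction_form_le: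
  assumes x: "x \<in> level contractions N" and b: "\<And>l. square_summable N (\<lambda>j. b j l)"
  shows "\<bar>\<Sum>k\<in>F. \<Sum>l\<in>G. t k * s l * conjug real_space N b x k l\<bar> \<le>
    l2_norm N (\<lambda>i. \<Sum>k\<in>F. t k * b i k) * l2_norm N (\<lambda>i. \<Sum>l\<in>G. s l * b i l)"
proof -
  have fb: "form_bound N x 1" using x by (simp add: level_contractions_iff)
  have sq: "square_summable N (\<lambda>i. \<Sum>k\<in>F. t k * b i k)" for F t
    by (intro square_summable_sum square_summable_cmult b)
  have "(\<Sum>k\<in>F. \<Sum>l\<in>G. t k * s l * conjug real_space N b x k l) =
      form N x (\<lambda>i. \<Sum>k\<in>F. t k * b i k) (\<lambda>i. \<Sum>l\<in>G. s l * b i l)"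
    unfolding conjug_real_eq_form[OF level_contractions_mats[OF x] b]
    by (rule form_sum[OF fb zero_le_one b b, symmetric])
  then show ?thesis
    using form_bound_summable(2)[OF fb zero_le_one sq[where F = G and t = s] sq[where F = F and t = t]] by simp
qed

lemma l2_norm_columns_power2:
  assumes "\<And>l. square_summable N (\<lambda>j. b j l)"
  shows "(l2_norm N (\<lambda>i. \<Sum>k\<in>F. t k * b i k))\<^sup>2 =
    (\<Sum>k\<in>F. \<Sum>l\<in>F. t k * t l * mat_prod N (adj b) b k l)"
  using l2_norm_sum_power2[of F N "\<lambda>k i. b i k" t] assms
  by (simp add: mat_prod_def adj_def cj_real_def)

lemma sum_id_mat:
  fixes t :: "'k \<Rightarrow> real"
  assumes "finite F" "F \<subseteq> M"
  shows "(\<Sum>k\<in>F. \<Sum>l\<in>F. t k * t l * id_mat M k l) = (L2_set t F)\<^sup>2"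
proof -
  have "(\<Sum>k\<in>F. \<Sum>l\<in>F. t k * t l * id_mat M k l) = (\<Sum>k\<in>F. \<Sum>l\<in>F. if k = l then t k * t k else 0)"
    using assms by (intro sum.cong refl) (auto simp: id_mat_def)
  then show ?thesis using assms(1) L2_set_power2[of t F] by (simp add: power2_eq_square)
qed

lemma contractions_compression:
  assumes x: "x \<in> level contractions N" and \<beta>: "\<beta> \<in> isometries N M" and M: "M \<noteq> {}"
  shows "conjug real_space N \<beta> x \<in> level contractions M"
proof -
  have b: "\<beta> \<in> scalar_mats N M" "mat_prod N (adj \<beta>) \<beta> = id_mat M"
    using \<beta> by (auto simp: isometries_def)
  note sq = scalar_mats_square_summable(1)[OF b(1)]
  have "form_bound M (conjug real_space N \<beta> x) 1"
  proof (rule form_boundI)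
    fix F :: "'a set" and t s :: "'a \<Rightarrow> real"
    assume F: "finite F" "F \<subseteq> M"
    have "l2_norm N (\<lambda>i. \<Sum>k\<in>F. t k * \<beta> i k) = L2_set t F" for t
      using l2_norm_columns_power2[where b = \<beta> and t = t and F = F, OF sq] sum_id_mat[OF F, of t]
      unfolding b(2) by (simp add: power2_eq_iff_nonneg)
    then show "\<bar>\<Sum>i\<in>F. \<Sum>j\<in>F. t i * s j * conjug real_space N \<beta> x i j\<bar> \<le> 1 * L2_set t F * L2_set s F"
      using conjug_contraction_form_le[where b = \<beta>, OF x sq, where F = F and G = F and t = t and s = s]
      by simp
  qed
  moreover have "conjug real_space N \<beta> x i j = 0" if "i \<notin> M \<or> j \<notin> M" for i j
    unfolding conjug_real_eq_form[where b = \<beta>, OF level_contractions_mats[OF x] sq]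
    using that scalar_mats_outside[OF b(1)] by (auto simp: form_def)
  ultimately show ?thesis using M by (simp add: level_contractions_iff)
qed

lemma ws_sum_real:
  fixes f :: "'i \<Rightarrow> real"
  assumes "(f has_sum s) A"
  shows "ws_sum real_space f A = s"
  using assms by (intro ws_sum_eqI[OF dual_operator_space_real]) (auto intro: has_sum_cmult_right)

text \<open>The form of summand i is bounded by the product of the norms of
  \<open>adj (\<alpha> i)\<close> applied to t and to s. The squares of these norms add up to the
  squared norms of t and s, so Cauchy-Schwarz over the summands gives the bound one.\<close>

lemma contractions_direct_sum:
  fixes N :: "'k set" and I :: "'i set"
  assumes N: "N \<noteq> {}"
    and x: "\<And>i. i \<in> I \<Longrightarrow> x i \<in> level contractions (Ns i)"
    and \<alpha>: "\<And>i. i \<in> I \<Longrightarrow> \<alpha> i \<in> isometries N (Ns i)"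
    and sum: "\<And>k l. ((\<lambda>i. mat_prod (Ns i) (\<alpha> i) (adj (\<alpha> i)) k l) has_sum id_mat N k l) I"
  shows "(\<lambda>k l. ws_sum real_space (\<lambda>i. conjug real_space (Ns i) (adj (\<alpha> i)) (x i) k l) I) \<in> level contractions N"
proof -
  define Q where "Q i k l = conjug real_space (Ns i) (adj (\<alpha> i)) (x i) k l" for i k l
  have \<alpha>': "\<alpha> i \<in> scalar_mats N (Ns i)" if "i \<in> I" for i
    using \<alpha>[OF that] by (simp add: isometries_def)
  have sq: "square_summable (Ns i) (\<lambda>j. adj (\<alpha> i) j l)" if "i \<in> I" for i l
    using scalar_mats_square_summable(2)[OF \<alpha>'[OF that]] by (simp add: adj_def cj_real_def)
  have adj2: "adj (adj a) = a" for a :: "'k \<Rightarrow> 'k \<Rightarrow> real" by (simp add: adj_def cj_real_def)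
  define v where "v F t i = l2_norm (Ns i) (\<lambda>j. \<Sum>k\<in>F. t k * adj (\<alpha> i) j k)" for F t i
  have v: "((\<lambda>i. (v F t i)\<^sup>2) has_sum (L2_set t F)\<^sup>2) I" if F: "finite F" "F \<subseteq> N" for F t
  proof -
    have "((\<lambda>i. \<Sum>k\<in>F. \<Sum>l\<in>F. t k * t l * mat_prod (Ns i) (\<alpha> i) (adj (\<alpha> i)) k l) has_sum
        (\<Sum>k\<in>F. \<Sum>l\<in>F. t k * t l * id_mat N k l)) I"
      by (intro has_sum_sum has_sum_cmult_right sum)
    also have "?this \<longleftrightarrow> ((\<lambda>i. (v F t i)\<^sup>2) has_sum (L2_set t F)\<^sup>2) I"
      unfolding sum_id_mat[OF F]
    proof (intro has_sum_cong)
      fix i assume "i \<in> I"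
      from l2_norm_columns_power2[where b = "adj (\<alpha> i)", OF sq[OF this], where F = F and t = t]
      show "(\<Sum>k\<in>F. \<Sum>l\<in>F. t k * t l * mat_prod (Ns i) (\<alpha> i) (adj (\<alpha> i)) k l) = (v F t i)\<^sup>2"
        by (simp add: v_def adj2)
    qed
    finally show ?thesis .
  qed
  have form_le: "\<bar>\<Sum>k\<in>F. \<Sum>l\<in>G. t k * s l * Q i k l\<bar> \<le> v F t i * v G s i" if "i \<in> I" for F G t s i
    unfolding Q_def v_def by (rule conjug_contraction_form_le[where b = "adj (\<alpha> i)", OF x[OF that] sq[OF that]])
  have Q0: "Q i k l = 0" if "i \<in> I" "k \<notin> N \<or> l \<notin> N" for i k l
    unfolding Q_def conjug_real_eq_form[where b = "adj (\<alpha> i)", OF level_contractions_mats[OF x[OF that(1)]] sq[OF that(1)]]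
    using that(2) scalar_mats_outside[OF \<alpha>'[OF that(1)]] by (auto simp: form_def adj_def cj_real_def)
  \<comment> \<open>Bounding absolute values yields at once the convergence of each entry and the
    contraction bound for the sum.\<close>
  have partial: "(\<Sum>i\<in>J. \<bar>\<Sum>k\<in>F. \<Sum>l\<in>G. t k * s l * Q i k l\<bar>) \<le> L2_set t F * L2_set s G"
    if F: "finite F" "F \<subseteq> N" and G: "finite G" "G \<subseteq> N" and J: "finite J" "J \<subseteq> I" for F G J t s
  proof -
    have L2_le: "L2_set (v F t) J \<le> L2_set t F" if F: "finite F" "F \<subseteq> N" for F t
    proof (rule power2_le_imp_le)
      show "(L2_set (v F t) J)\<^sup>2 \<le> (L2_set t F)\<^sup>2"
        unfolding L2_set_power2[of "v F t"] by (rule finite_sum_le_has_sum[OF v[OF F] J]) simp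
    qed simp
    have v0: "0 \<le> v F t i" for F t i by (simp add: v_def)
    have "(\<Sum>i\<in>J. \<bar>\<Sum>k\<in>F. \<Sum>l\<in>G. t k * s l * Q i k l\<bar>) \<le> (\<Sum>i\<in>J. v F t i * v G s i)"
      using form_le J(2) by (intro sum_mono) blast
    also have "\<dots> \<le> L2_set (v F t) J * L2_set (v G s) J"
      using abs_sum_mult_le_L2_set[of "v F t" "v G s" J] by simp
    also have "\<dots> \<le> L2_set t F * L2_set s G"
      by (intro mult_mono L2_le F G L2_set_nonneg)
    finally show ?thesis .
  qed
  have Q_sum: "((\<lambda>i. Q i k l) has_sum (\<Sum>\<^sub>\<infinity>i\<in>I. Q i k l)) I" for k l
  proof (cases "k \<in> N \<and> l \<in> N")
    case True
    have "(\<Sum>i\<in>J. \<bar>Q i k l\<bar>) \<le> 1" if "finite J" "J \<subseteq> I" for J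
      using partial[of "{k}" "{l}" J "\<lambda>_. 1" "\<lambda>_. 1"] that True by simp
    from abs_bounded_infsum(1)[OF this] show ?thesis by (rule has_sum_infsum)
  next
    case False
    then have "(\<lambda>i. Q i k l) summable_on I \<longleftrightarrow> (\<lambda>i. 0 :: real) summable_on I"
      using Q0 by (intro summable_on_cong) blast
    then show ?thesis by (intro has_sum_infsum) simp
  qed
  define y where "y k l = (\<Sum>\<^sub>\<infinity>i\<in>I. Q i k l)" for k l
  have "form_bound N y 1"
  proof (rule form_boundI)
    fix F :: "'k set" and t s :: "'k \<Rightarrow> real"
    assume F: "finite F" "F \<subseteq> N"
    show "\<bar>\<Sum>k\<in>F. \<Sum>l\<in>F. t k * s l * y k l\<bar> \<le> 1 * L2_set t F * L2_set s F"
    proof (rule has_sum_abs_le)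
      show "((\<lambda>i. \<Sum>k\<in>F. \<Sum>l\<in>F. t k * s l * Q i k l) has_sum (\<Sum>k\<in>F. \<Sum>l\<in>F. t k * s l * y k l)) I"
        unfolding y_def by (intro has_sum_sum has_sum_cmult_right Q_sum)
      fix J assume "finite J" "J \<subseteq> I"
      then show "\<bar>\<Sum>i\<in>J. \<Sum>k\<in>F. \<Sum>l\<in>F. t k * s l * Q i k l\<bar> \<le> 1 * L2_set t F * L2_set s F"
        using order_trans[OF sum_abs partial[OF F F]] by simp
    qed
  qed
  moreover have "y k l = 0" if "k \<notin> N \<or> l \<notin> N" for k l
    unfolding y_def using Q0 that by (intro infsum_0) blast
  ultimately have "y \<in> level contractions N"
    using N by (simp add: level_contractions_iff)
  also have "y = (\<lambda>k l. ws_sum real_space (\<lambda>i. conjug real_space (Ns i) (adj (\<alpha> i)) (x i) k l) I)"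
    unfolding y_def using ws_sum_real[OF Q_sum] by (simp add: Q_def fun_eq_iff)
  finally show ?thesis .
qed

lemma nc_convex_contractions: "nc_convex real_space (contractions :: ('k, real) graded_set)"
  unfolding nc_convex_def
proof (intro conjI allI impI)
  show "(contractions :: ('k, real) graded_set) \<subseteq> all_mats real_space"
  proof (rule subsetI)
    fix p :: "'k set \<times> ('k \<Rightarrow> 'k \<Rightarrow> real)" assume "p \<in> contractions"
    moreover obtain N x where "p = (N, x)" by (cases p)
    ultimately have "p = (N, x)" "x \<in> level contractions N" by (simp_all add: level_def)
    then show "p \<in> all_mats real_space"
      using level_contractions_mats[of x N] by (simp add: all_mats_def level_contractions_iff)
  qed
  show "(\<lambda>k l. ws_sum real_space (\<lambda>i. conjug real_space (Ns i) (adj (\<alpha> i)) (x i) k l) I) \<in> level contractions N"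
    if "N \<noteq> {} \<and> (\<forall>i\<in>I. x i \<in> level contractions (Ns i) \<and> \<alpha> i \<in> isometries N (Ns i)) \<and>
        (\<exists>C. \<forall>i\<in>I. mats_norm real_space (Ns i) (x i) \<le> C) \<and>
        (\<forall>k l. ((\<lambda>i. mat_prod (Ns i) (\<alpha> i) (adj (\<alpha> i)) k l) has_sum id_mat N k l) I)"
    for N and I :: "'k set" and Ns x \<alpha>
    using that by (intro contractions_direct_sum) auto
  show "conjug real_space N \<beta> x \<in> level contractions M"
    if "M \<noteq> {} \<and> x \<in> level contractions N \<and> \<beta> \<in> isometries N M" for N M :: "'k set" and x \<beta>
    using that by (intro contractions_compression) auto
qed

section \<open>Weak* compactness of the set of contractions\<close>

lemma continuous_on_entry: "continuous_on S (\<lambda>x :: 'a \<Rightarrow> 'b \<Rightarrow> real. x i j)"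
  by (rule continuous_on_product_then_coordinatewise) (rule continuous_on_product_then_coordinatewise, simp)

text \<open>Entries of a contraction lie in [-1, 1], so Tychonoff applies; each defining condition
  involves finitely many entries and is therefore closed in the product topology.\<close>

lemma compact_level_contractions: "compact (level contractions N :: ('k \<Rightarrow> 'k \<Rightarrow> real) set)"
proof (cases "N = {}")
  case True
  then show ?thesis by (simp add: level_def contractions_def)
next
  case False
  let ?B = "PiE UNIV (\<lambda>_ :: 'k. PiE UNIV (\<lambda>_ :: 'k. {-1..1 :: real}))"
  have "compactin (product_topology (\<lambda>_. product_topology (\<lambda>_. euclidean) UNIV) UNIV) ?B"
    by (simp add: compactin_PiE)
  then have B: "compact ?B"
    by (simp add: euclidean_product_topology)
  have impl: "closed {x. P \<longrightarrow> Q x}" if "P \<Longrightarrow> closed {x. Q x}" for P and Q :: "('k \<Rightarrow> 'k \<Rightarrow> real) \<Rightarrow> bool"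
    using that by (cases P) simp_all
  have "closed {x :: 'k \<Rightarrow> 'k \<Rightarrow> real. form_bound N x 1}"
    unfolding form_bound_def
    by (intro closed_Collect_all impl closed_Collect_le continuous_intros continuous_on_entry)
  moreover have "closed {x :: 'k \<Rightarrow> 'k \<Rightarrow> real. \<forall>i j. i \<notin> N \<or> j \<notin> N \<longrightarrow> x i j = 0}"
    by (intro closed_Collect_all impl closed_Collect_eq continuous_on_const continuous_on_entry)
  moreover have eq: "level contractions N =
      {x. \<forall>i j. i \<notin> N \<or> j \<notin> N \<longrightarrow> x i j = 0} \<inter> {x. form_bound N x 1}"
    using False by (auto simp: level_contractions_iff)
  ultimately have "closed (level contractions N :: ('k \<Rightarrow> 'k \<Rightarrow> real) set)"
    by (simp add: closed_Int)
  moreover have "x i j \<in> {-1..1}" if "x \<in> level contractions N" for x i j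
  proof (cases "i \<in> N \<and> j \<in> N")
    case True
    then have "\<bar>x i j\<bar> \<le> 1"
      using form_boundD[of N x 1 "{i}" "{j}" "\<lambda>_. 1" "\<lambda>_. 1"] that
      by (simp add: level_contractions_iff)
    then show ?thesis by auto
  next
    case False
    then show ?thesis using that by (auto simp: level_contractions_iff)
  qed
  then have "level contractions N \<subseteq> ?B"
    by (auto simp: PiE_def)
  ultimately show ?thesis
    using B by (metis compact_Int_closed inf.absorb_iff2)
qed

definition entry_form :: "'k set \<Rightarrow> ('k \<Rightarrow> 'k \<Rightarrow> real \<Rightarrow> real) \<Rightarrow> ('k \<Rightarrow> 'k \<Rightarrow> real) \<Rightarrow> real" where
  "entry_form F \<phi> = (\<lambda>x. \<Sum>i\<in>F. \<Sum>j\<in>F. \<phi> i j (x i j))"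

definition entry_forms :: "'k set \<Rightarrow> (('k \<Rightarrow> 'k \<Rightarrow> real) \<Rightarrow> real) set" where
  "entry_forms N = {entry_form F \<phi> |F \<phi>.
     finite F \<and> F \<subseteq> N \<and> (\<forall>i\<in>F. \<forall>j\<in>F. \<phi> i j \<in> predual real_space)}"

lemma mats_predual_real:
  "mats_predual real_space N = norm_closure (mats real_space N) (mats_norm real_space N) (entry_forms N)"
  by (simp add: mats_predual_def entry_forms_def entry_form_def)

lemma continuous_on_entry_forms:
  assumes "\<phi> \<in> entry_forms N"
  shows "continuous_on S \<phi>"
proof -
  obtain F f where \<phi>: "\<phi> = entry_form F f" and f: "\<forall>i\<in>F. \<forall>j\<in>F. f i j \<in> predual real_space"
    using assms unfolding entry_forms_def by blast
  have "continuous_on S (\<lambda>x. f i j (x i j))" if "i \<in> F" "j \<in> F" for i j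
  proof -
    have "f i j \<in> range (*)" using f that by simp
    then obtain c where "f i j = (*) c" by blast
    then show ?thesis by (simp add: continuous_on_mult_left continuous_on_entry)
  qed
  then show ?thesis unfolding \<phi> entry_form_def by (intro continuous_on_sum)
qed

text \<open>A functional in the predual is a norm limit of finite combinations of entries. On the
  unit ball this approximation is uniform, and uniform limits of continuous functions are
  continuous.\<close>

lemma continuous_on_mats_predual:
  assumes "\<psi> \<in> mats_predual real_space N"
  shows "continuous_on (level contractions N) \<psi>"
proof -
  have "\<exists>\<phi>\<in>entry_forms N. \<forall>x\<in>mats real_space N. norm (\<psi> x - \<phi> x) \<le> 1 / real (Suc n) * mats_norm real_space N x" for n
  proof -
    have "0 < 1 / real (Suc n)" by simp
    then show ?thesis using assms unfolding mats_predual_real norm_closure_def by blast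
  qed
  then obtain \<phi> where \<phi>: "\<And>n. \<phi> n \<in> entry_forms N"
    "\<And>n x. x \<in> mats real_space N \<Longrightarrow> norm (\<psi> x - \<phi> n x) \<le> 1 / real (Suc n) * mats_norm real_space N x"
    by metis
  have "dist (\<phi> n x) (\<psi> x) \<le> 1 / real (Suc n)" if x: "x \<in> level contractions N" for n x
  proof -
    have "norm (\<psi> x - \<phi> n x) \<le> 1 / real (Suc n) * mats_norm real_space N x"
      by (rule \<phi>(2)[OF level_contractions_mats[OF x]])
    also have "\<dots> \<le> 1 / real (Suc n) * 1"
      by (rule mult_left_mono[OF mats_norm_le_one[OF x]]) simp
    finally show ?thesis by (simp add: dist_norm norm_minus_commute)
  qed
  note dist_le = this
  have "uniform_limit (level contractions N) \<phi> \<psi> sequentially"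
  proof (rule uniform_limitI)
    fix e :: real assume "e > 0"
    then obtain m where m: "1 / real (Suc m) < e" using nat_approx_posE by metis
    have "dist (\<phi> n x) (\<psi> x) < e" if "n \<ge> m" "x \<in> level contractions N" for n x
    proof -
      have "1 / real (Suc n) \<le> 1 / real (Suc m)" using that(1) by (simp add: frac_le)
      with dist_le[OF that(2), of n] m show ?thesis by linarith
    qed
    then show "\<forall>\<^sub>F n in sequentially. \<forall>x\<in>level contractions N. dist (\<phi> n x) (\<psi> x) < e"
      unfolding eventually_sequentially by blast
  qed
  then show ?thesis
    by (rule uniform_limit_theorem[rotated]) (simp_all add: continuous_on_entry_forms[OF \<phi>(1)])
qed

lemma mats_norm_nonneg:
  assumes x: "x \<in> mats real_space N"
  shows "0 \<le> mats_norm real_space N x"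
proof -
  obtain C where "\<forall>(n, f)\<in>selections N. mnorm real_space n (submat f x) \<le> C"
    using x unfolding mats_def by blast
  then have bdd: "bdd_above ((\<lambda>(n, f). mnorm real_space n (submat f x)) ` selections N)"
    by (intro bdd_aboveI[of _ C]) auto
  have "(0, undefined) \<in> selections N" by (simp add: selections_def)
  from cSUP_upper[OF this bdd]
  have "op_norm {..<0::nat} {..<0::nat} (submat undefined x) \<le> mats_norm real_space N x"
    by (simp add: mats_norm_def)
  then show ?thesis
    using op_norm_nonneg[of "{..<0::nat}" "{..<0::nat}" "submat undefined x"] by simp
qed

lemma zero_mem_mats_predual: "(\<lambda>_. 0) \<in> mats_predual real_space N"
proof -
  have "entry_form {} (\<lambda>_ _ _. 0) \<in> entry_forms N"
    unfolding entry_forms_def by blast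
  then have "(\<lambda>_. 0) \<in> entry_forms N"
    by (simp add: entry_form_def)
  then show ?thesis
    unfolding mats_predual_real norm_closure_def
    by (intro CollectI allI impI bexI[of _ "\<lambda>_. 0"] ballI) (simp_all add: mats_norm_nonneg)
qed

text \<open>The identity map from the unit ball with the product topology to the weak* topology is
  continuous, so compactness is carried over.\<close>

lemma compactin_level_contractions:
  fixes N :: "'k set"
  shows "compactin (weak_star real_space N) (level contractions N)"
proof -
  let ?S = "level contractions N"
  have "continuous_map (subtopology euclidean ?S) (weak_star real_space N) (\<lambda>x. x)"
    unfolding weak_star_def
  proof (rule continuous_on_generated_topo)
    fix V :: "('k \<Rightarrow> 'k \<Rightarrow> real) set"
    assume "V \<in> {{x \<in> mats real_space N. \<psi> x \<in> U} |\<psi> U. \<psi> \<in> mats_predual real_space N \<and> open U}"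
    then obtain \<psi> U where V: "V = {x \<in> mats real_space N. \<psi> x \<in> U}"
      "\<psi> \<in> mats_predual real_space N" "open U" by blast
    have "(\<lambda>x. x) -` V \<inter> topspace (subtopology euclidean ?S) = ?S \<inter> \<psi> -` U"
      using level_contractions_mats by (auto simp: V(1))
    then show "openin (subtopology euclidean ?S) ((\<lambda>x. x) -` V \<inter> topspace (subtopology euclidean ?S))"
      using continuous_openin_preimage_gen[OF continuous_on_mats_predual[OF V(2)] V(3)] by simp
  next
    \<comment> \<open>A generated topology lives on the union of its generators; the zero functional
      shows that this union contains every element of \<open>mats\<close>.\<close>
    have "(\<lambda>_. 0) \<in> mats_predual real_space N" by (rule zero_mem_mats_predual)
    then have "mats real_space N \<in>
        {{x \<in> mats real_space N. \<psi> x \<in> U} |\<psi> U. \<psi> \<in> mats_predual real_space N \<and> open U}"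
      by (intro CollectI exI[of _ "\<lambda>_. 0"] exI[of _ UNIV]) simp
    then show "(\<lambda>x. x) ` topspace (subtopology euclidean ?S) \<subseteq>
        \<Union> {{x \<in> mats real_space N. \<psi> x \<in> U} |\<psi> U. \<psi> \<in> mats_predual real_space N \<and> open U}"
      using level_contractions_mats by auto
  qed
  moreover have "compactin (subtopology euclidean ?S) ?S"
    using compact_level_contractions by (simp add: compactin_subtopology)
  ultimately show ?thesis
    using image_compactin by fastforce
qed

lemma compact_nc_convex_contractions: "compact_nc_convex real_space contractions"
  by (simp add: compact_nc_convex_def nc_convex_contractions compactin_level_contractions)


section \<open>The rotation\<close>

definition rotation :: "'k \<Rightarrow> 'k \<Rightarrow> 'k \<Rightarrow> 'k \<Rightarrow> real" where
  "rotation p q = (\<lambda>i j. if i = q \<and> j = p then 1 else if i = p \<and> j = q then - 1 else 0)"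

lemma rotation_mem_contractions:
  assumes "p \<noteq> q"
  shows "({p, q}, rotation p q) \<in> contractions"
proof -
  have "form_bound {p, q} (rotation p q) 1"
  proof (rule form_boundI)
    fix F and t s :: "'a \<Rightarrow> real"
    assume "F \<subseteq> {p, q}"
    then consider "F = {}" | "F = {p}" | "F = {q}" | "F = {p, q}" by blast
    then show "\<bar>\<Sum>i\<in>F. \<Sum>j\<in>F. t i * s j * rotation p q i j\<bar> \<le> 1 * L2_set t F * L2_set s F"
    proof cases
      case 4
      \<comment> \<open>The two inequalities bound the form and its negative; smaller sets F see
        only zero diagonal entries.\<close>
      have "t q * s p + (- t p) * s q \<le> sqrt ((t q)\<^sup>2 + (- t p)\<^sup>2) * sqrt ((s p)\<^sup>2 + (s q)\<^sup>2)"
        "(- t q) * s p + t p * s q \<le> sqrt ((- t q)\<^sup>2 + (t p)\<^sup>2) * sqrt ((s p)\<^sup>2 + (s q)\<^sup>2)"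
        by (rule Cauchy_Schwarz_2)+
      with 4 assms show ?thesis
        by (simp add: rotation_def L2_set_def add.commute abs_le_iff)
    qed (use assms in \<open>simp_all add: rotation_def\<close>)
  qed
  then show ?thesis using assms by (auto simp: contractions_def rotation_def)
qed

text \<open>The hypothesis says that the matrix with rows \<open>a, -r\<close> and \<open>r, d\<close> is the compression of a
  contraction to two vectors with Gram matrix \<open>r, g; g, r\<close>; its off-diagonal entries are then as large
  as they can be.\<close>

lemma extremal_compression:
  fixes r g a d :: real
  assumes r: "0 \<le> r" and le: "\<And>t t' s s'. \<bar>t * s * a - t * s' * r + t' * s * r + t' * s' * d\<bar> \<le>
      sqrt (r * t\<^sup>2 + 2 * g * t * t' + r * t'\<^sup>2) * sqrt (r * s\<^sup>2 + 2 * g * s * s' + r * s'\<^sup>2)"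
  shows "g = 0" "a = 0" "d = 0"
proof -
  let ?R = "sqrt (2 * r - 2 * g) * sqrt (2 * r + 2 * g)"
  \<comment> \<open>The pairs of test vectors (-1, 1), (1, 1) and (1, 1), (1, -1) have the same
    right side, and adding the two bounds cancels d - a.\<close>
  have "2 * r + (d - a) \<le> ?R"
    using abs_le_D1[OF le[of "- 1" 1 1 1]] by (simp add: algebra_simps)
  moreover have "2 * r - (d - a) \<le> ?R"
    using abs_le_D1[OF le[of 1 1 "- 1" 1]] by (simp add: algebra_simps)
  ultimately have "2 * r \<le> ?R" by linarith
  then have le_sqrt: "2 * r \<le> sqrt ((2 * r - 2 * g) * (2 * r + 2 * g))" (is "_ \<le> sqrt ?X")
    by (simp add: real_sqrt_mult)
  with r have "0 \<le> sqrt ?X" by linarith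
  then have "0 \<le> ?X" by (simp only: real_sqrt_ge_0_iff)
  with power_mono[OF le_sqrt, of 2] r have "(2 * r)\<^sup>2 \<le> ?X"
    by (simp only: real_sqrt_pow2)
  then have "g\<^sup>2 \<le> 0" by (simp add: power2_eq_square algebra_simps)
  then show g: "g = 0" by simp
  have zero: "b = 0" if b: "b\<^sup>2 + r\<^sup>2 \<le> sqrt (r * b\<^sup>2 + r * r\<^sup>2) * sqrt r" for b
  proof (rule ccontr)
    assume "b \<noteq> 0"
    then have pos: "0 < b\<^sup>2 + r\<^sup>2" by (simp add: sum_power2_gt_zero_iff)
    have "sqrt (r * b\<^sup>2 + r * r\<^sup>2) * sqrt r = r * sqrt (b\<^sup>2 + r\<^sup>2)"
      using r by (simp add: distrib_left[symmetric] real_sqrt_mult)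
    with b have "sqrt (b\<^sup>2 + r\<^sup>2) * sqrt (b\<^sup>2 + r\<^sup>2) \<le> r * sqrt (b\<^sup>2 + r\<^sup>2)"
      using pos by simp
    then have "sqrt (b\<^sup>2 + r\<^sup>2) \<le> r"
      by (rule mult_right_le_imp_le) (simp only: real_sqrt_gt_0_iff pos)
    then have "b\<^sup>2 + r\<^sup>2 \<le> r\<^sup>2" by (rule sqrt_le_D)
    with \<open>b \<noteq> 0\<close> show False by simp
  qed
  \<comment> \<open>Each basis vector is tested against its image, (a, r) for the first and (- r, d)
    for the second.\<close>
  show "a = 0" using le[of a 1 0 r] r g by (intro zero) (simp add: power2_eq_square)
  show "d = 0" using le[of "- r" 0 1 d] r g by (intro zero) (simp add: power2_eq_square algebra_simps)
qed

lemma form_cmult: "form N X (\<lambda>i. c * t i) (\<lambda>j. d * s j) = c * d * form N X t s"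
  by (simp add: form_def mult.assoc infsum_cmult_right' mult.left_commute[of _ d])

lemma column_eq_0:
  assumes "square_summable N b" "(\<Sum>\<^sub>\<infinity>i\<in>N. b i * b i) = 0" "i \<in> N"
  shows "b i = 0"
  using nonneg_infsum_le_0D[of "\<lambda>i. b i * b i" N i] assms square_summable_mult[OF assms(1,1)] by simp

text \<open>The off-diagonal entries of each summand are bounded by the geometric mean of the
  diagonal entries of its Gram matrix, hence by their arithmetic mean. The arithmetic means add up
  to 1, and so do the off-diagonal entries up to sign; therefore equality holds in every
  summand.\<close>

lemma rotation_combination:
  assumes pq: "p \<noteq> q" and comb: "nc_comb real_space contractions {p, q} (rotation p q) m Ns xs \<alpha>" and i: "i < m"
  obtains r where "0 < r" "mat_prod (Ns i) (adj (\<alpha> i)) (\<alpha> i) = (\<lambda>k l. r * id_mat {p, q} k l)"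
    "conjug real_space (Ns i) (\<alpha> i) (xs i) = (\<lambda>k l. r * rotation p q k l)"
proof -
  define g where "g j = mat_prod (Ns j) (adj (\<alpha> j)) (\<alpha> j)" for j
  define y where "y j = conjug real_space (Ns j) (\<alpha> j) (xs j)" for j
  have xs: "xs j \<in> level contractions (Ns j)" and \<alpha>: "\<alpha> j \<in> scalar_mats (Ns j) {p, q}" "\<alpha> j \<noteq> (\<lambda>_ _. 0)"
    if "j < m" for j using comb that by (simp_all add: nc_comb_def)
  note sq = scalar_mats_square_summable(1)[OF \<alpha>(1)]
  have sum_g: "(\<Sum>j<m. g j k l) = id_mat {p, q} k l" for k l
    using comb by (simp add: nc_comb_def g_def fun_eq_iff)
  have sum_y: "(\<Sum>j<m. y j k l) = rotation p q k l" for k l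
    using comb by (simp add: nc_comb_def y_def fun_eq_iff)
  have g_sym: "g j k l = g j l k" for j k l
    by (simp add: g_def mat_prod_def adj_def cj_real_def mult.commute)
  have g_nonneg: "0 \<le> g j k k" for j k
    by (simp add: g_def mat_prod_def adj_def cj_real_def infsum_nonneg)
  have y_le: "\<bar>t * s * y j p p + t * s' * y j p q + t' * s * y j q p + t' * s' * y j q q\<bar> \<le>
      sqrt (g j p p * t\<^sup>2 + 2 * g j p q * t * t' + g j q q * t'\<^sup>2) *
      sqrt (g j p p * s\<^sup>2 + 2 * g j p q * s * s' + g j q q * s'\<^sup>2)" if j: "j < m" for j t t' s s'
  proof -
    have norm: "l2_norm (Ns j) (\<lambda>i. \<Sum>k\<in>{p, q}. (if k = p then t else t') * \<alpha> j i k) =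
        sqrt (g j p p * t\<^sup>2 + 2 * g j p q * t * t' + g j q q * t'\<^sup>2)" for t t'
    proof (rule real_sqrt_unique[symmetric])
      show "(l2_norm (Ns j) (\<lambda>i. \<Sum>k\<in>{p, q}. (if k = p then t else t') * \<alpha> j i k))\<^sup>2 =
          g j p p * t\<^sup>2 + 2 * g j p q * t * t' + g j q q * t'\<^sup>2"
        unfolding l2_norm_columns_power2[where b = "\<alpha> j", OF sq[OF j]] g_def[symmetric]
        using pq g_sym[of j q p] by (simp add: power2_eq_square algebra_simps)
    qed simp
    have "(\<Sum>k\<in>{p, q}. \<Sum>l\<in>{p, q}. (if k = p then t else t') * (if l = p then s else s') * y j k l) =
        t * s * y j p p + t * s' * y j p q + t' * s * y j q p + t' * s' * y j q q"
      using pq by (simp add: algebra_simps)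
    then show ?thesis
      using conjug_contraction_form_le[where b = "\<alpha> j", OF xs[OF j] sq[OF j], where F = "{p, q}"
          and G = "{p, q}" and t = "\<lambda>k. if k = p then t else t'" and s = "\<lambda>k. if k = p then s else s'"]
      unfolding norm y_def[symmetric] by simp
  qed
  have bd: "\<bar>y j q p\<bar> \<le> sqrt (g j q q) * sqrt (g j p p)" "\<bar>y j p q\<bar> \<le> sqrt (g j q q) * sqrt (g j p p)"
    if "j < m" for j
    using y_le[OF that, of 0 1 0 1] y_le[OF that, of 1 0 1 0] by (simp_all add: mult.commute)
  have amgm: "sqrt (g j q q) * sqrt (g j p p) \<le> (g j q q + g j p p) / 2" for j
    using arith_geo_mean_sqrt[OF g_nonneg g_nonneg, of j q j p] by (simp add: real_sqrt_mult)
  have sum_mean: "(\<Sum>j<m. (g j q q + g j p p) / 2) = 1"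
    using sum_g[of p p] sum_g[of q q] by (simp add: sum_divide_distrib[symmetric] sum.distrib id_mat_def)
  have qp: "y j q p = (g j q q + g j p p) / 2" if "j < m" for j
  proof (rule sum_mono_inv[of "\<lambda>j. y j q p" "{..<m}"])
    show "(\<Sum>j<m. y j q p) = (\<Sum>j<m. (g j q q + g j p p) / 2)"
      unfolding sum_y sum_mean by (simp add: rotation_def)
    show "y j q p \<le> (g j q q + g j p p) / 2" if "j \<in> {..<m}" for j
      using bd(1)[of j] amgm[of j] that by simp
  qed (use that in auto)
  have pq': "- y j p q = (g j q q + g j p p) / 2" if "j < m" for j
  proof (rule sum_mono_inv[of "\<lambda>j. - y j p q" "{..<m}"])
    show "(\<Sum>j<m. - y j p q) = (\<Sum>j<m. (g j q q + g j p p) / 2)"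
      unfolding sum_mean sum_negf sum_y using pq by (simp add: rotation_def)
    show "- y j p q \<le> (g j q q + g j p p) / 2" if "j \<in> {..<m}" for j
      using bd(2)[of j] amgm[of j] that by simp
  qed (use that in auto)
  define r where "r = g i p p"
  have gq: "g i q q = r"
  proof -
    \<comment> \<open>Equality of the geometric and the arithmetic mean forces equal diagonal
      entries.\<close>
    have "(g i q q + g i p p) / 2 \<le> sqrt (g i q q) * sqrt (g i p p)"
      using bd(1)[OF i] qp[OF i] by linarith
    then have "(sqrt (g i q q) - sqrt (g i p p))\<^sup>2 \<le> 0"
      using g_nonneg[of i p] g_nonneg[of i q] by (simp add: power2_diff)
    then show ?thesis by (simp add: r_def)
  qed
  have entries: "y i q p = r" "y i p q = - r"
    using qp[OF i] pq'[OF i] gq by (simp_all add: r_def)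
  have ext: "g i p q = 0" "y i p p = 0" "y i q q = 0"
    by (rule extremal_compression[of r "y i p p" "y i q q" "g i p q"];
      use y_le[OF i] g_nonneg[of i p] in \<open>simp add: entries gq r_def[symmetric]\<close>)+
  have col: "\<alpha> i j k = 0" if "k \<notin> {p, q}" for j k
    using scalar_mats_outside[OF \<alpha>(1)[OF i]] that by blast
  \<comment> \<open>If r were zero both columns of \<open>\<alpha> i\<close> would vanish, while the
    coefficients of a combination are nonzero.\<close>
  have "r \<noteq> 0"
  proof
    assume "r = 0"
    then have "(\<Sum>\<^sub>\<infinity>j\<in>Ns i. \<alpha> i j k * \<alpha> i j k) = 0" if "k \<in> {p, q}" for k
      using that gq by (auto simp: g_def r_def mat_prod_def adj_def cj_real_def)
    then have "\<alpha> i j k = 0" if "k \<in> {p, q}" "j \<in> Ns i" for j k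
      using column_eq_0[where b = "\<lambda>j. \<alpha> i j k", OF sq[OF i]] that by blast
    then have "\<alpha> i j k = 0" for j k
      using scalar_mats_outside[OF \<alpha>(1)[OF i], of j k] by blast
    then show False using \<alpha>(2)[OF i] by (auto simp: fun_eq_iff)
  qed
  then have "0 < r" using g_nonneg[of i p] by (simp add: r_def)
  moreover have "g i k l = r * id_mat {p, q} k l" for k l
  proof (cases "k \<in> {p, q} \<and> l \<in> {p, q}")
    case True
    then show ?thesis using ext(1) g_sym[of i p q] gq pq by (auto simp: id_mat_def r_def)
  next
    case False
    then show ?thesis
      by (auto simp: id_mat_def g_def mat_prod_def adj_def cj_real_def col)
  qed
  moreover have "y i k l = r * rotation p q k l" for k l
  proof (cases "k \<in> {p, q} \<and> l \<in> {p, q}")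
    case True
    then show ?thesis using ext entries pq by (auto simp: rotation_def)
  next
    case False
    then have "y i k l = 0"
      unfolding y_def conjug_real_eq_form[where b = "\<alpha> i", OF level_contractions_mats[OF xs[OF i]] sq[OF i]]
      by (auto simp: form_def col)
    with False show ?thesis by (auto simp: rotation_def)
  qed
  ultimately show ?thesis
    by (intro that[of r]) (simp_all add: g_def y_def fun_eq_iff)
qed

lemma pure_rotation:
  assumes pq: "p \<noteq> q"
  shows "pure real_space contractions ({p, q}, rotation p q)"
  unfolding pure_def prod.case
proof (intro conjI allI impI rotation_mem_contractions pq)
  fix m Ns xs \<alpha> i
  assume comb: "nc_comb real_space contractions {p, q} (rotation p q) m Ns xs \<alpha>" and i: "i < m"
  obtain r where r: "0 < r" "mat_prod (Ns i) (adj (\<alpha> i)) (\<alpha> i) = (\<lambda>k l. r * id_mat {p, q} k l)"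
    "conjug real_space (Ns i) (\<alpha> i) (xs i) = (\<lambda>k l. r * rotation p q k l)"
    by (rule rotation_combination[OF pq comb i]) (rule that)
  have xs: "xs i \<in> mats real_space (Ns i)" and \<alpha>: "\<alpha> i \<in> scalar_mats (Ns i) {p, q}"
    using comb i level_contractions_mats by (auto simp: nc_comb_def)
  \<comment> \<open>The Gram matrix of \<open>\<alpha> i\<close> is r times the identity, so
    dividing by the square root of r gives an isometry.\<close>
  define c where "c = sqrt r"
  have c: "0 < c" "1 / c * (1 / c) * r = 1" using r(1) by (simp_all add: c_def)
  define \<beta> where "\<beta> = (\<lambda>k l. 1 / c * \<alpha> i k l)"
  have \<beta>: "\<beta> \<in> scalar_mats (Ns i) {p, q}"
    unfolding \<beta>_def by (rule scalar_mats_cmult[OF \<alpha>])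
  have "mat_prod (Ns i) (adj \<beta>) \<beta> k l = 1 / c * (1 / c) * mat_prod (Ns i) (adj (\<alpha> i)) (\<alpha> i) k l" for k l
    unfolding mat_prod_def \<beta>_def adj_def cj_real_def
    by (subst infsum_cmult_right'[symmetric]) (simp add: mult_ac)
  then have "mat_prod (Ns i) (adj \<beta>) \<beta> = id_mat {p, q}"
    unfolding r(2) mult.assoc[symmetric] c(2) by auto
  moreover have "conjug real_space (Ns i) \<beta> (xs i) k l =
      1 / c * (1 / c) * conjug real_space (Ns i) (\<alpha> i) (xs i) k l" for k l
    unfolding conjug_real_eq_form[where b = \<beta>, OF xs scalar_mats_square_summable(1)[OF \<beta>]]
      conjug_real_eq_form[where b = "\<alpha> i", OF xs scalar_mats_square_summable(1)[OF \<alpha>]]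
    unfolding \<beta>_def by (rule form_cmult)
  then have "conjug real_space (Ns i) \<beta> (xs i) = rotation p q"
    unfolding r(3) mult.assoc[symmetric] c(2) by auto
  ultimately have "pure_factor real_space {p, q} (rotation p q) (Ns i) (xs i) (\<alpha> i) c \<beta>"
    using \<beta> c(1) by (simp add: pure_factor_def isometries_def \<beta>_def)
  then show "\<exists>c \<beta>. pure_factor real_space {p, q} (rotation p q) (Ns i) (xs i) (\<alpha> i) c \<beta>"
    by blast
qed

text \<open>The columns u and v of \<beta> are unit vectors at which the contraction attains its
  norm: it sends u to v and v to -u, and its transpose acts on them as the inverse. So the span of u
  and v is a reducing subspace, which is the commutation to be shown.\<close>

lemma nc_extreme_rotation:
  assumes pq: "p \<noteq> q"
  shows "nc_extreme real_space contractions ({p, q}, rotation p q)"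
  unfolding nc_extreme_def prod.case
proof (intro conjI allI impI pure_rotation pq)
  fix m Ns xs \<alpha> i c \<beta>
  assume comb: "nc_comb real_space contractions {p, q} (rotation p q) m Ns xs \<alpha>" and i: "i < m"
    and f: "pure_factor real_space {p, q} (rotation p q) (Ns i) (xs i) (\<alpha> i) c \<beta>"
  have xs: "xs i \<in> level contractions (Ns i)" using comb i by (simp add: nc_comb_def)
  then have X: "form_bound (Ns i) (xs i) 1" by (simp add: level_contractions_iff)
  have \<beta>: "\<beta> \<in> scalar_mats (Ns i) {p, q}" "mat_prod (Ns i) (adj \<beta>) \<beta> = id_mat {p, q}"
    and conj: "conjug real_space (Ns i) \<beta> (xs i) = rotation p q"
    using f by (simp_all add: pure_factor_def isometries_def)
  note sq = scalar_mats_square_summable(1)[OF \<beta>(1)]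
  define u where "u k = \<beta> k p" for k
  define v where "v k = \<beta> k q" for k
  have uv: "square_summable (Ns i) u" "square_summable (Ns i) v" "square_summable (Ns i) (\<lambda>k. - u k)"
    using sq square_summable_cmult[OF sq, of "- 1"] by (simp_all add: u_def[abs_def] v_def[abs_def])
  have norms: "l2_norm (Ns i) u = 1" "l2_norm (Ns i) v = 1" "l2_norm (Ns i) (\<lambda>k. - u k) = 1"
    using fun_cong[OF fun_cong[OF \<beta>(2)], of p p] fun_cong[OF fun_cong[OF \<beta>(2)], of q q]
    by (simp_all add: l2_norm_def u_def v_def mat_prod_def adj_def cj_real_def id_mat_def power2_eq_square)
  have form: "form (Ns i) (xs i) (\<lambda>i. \<beta> i k) (\<lambda>j. \<beta> j l) = rotation p q k l" for k l
    unfolding conj[symmetric] by (rule conjug_real_eq_form[where b = \<beta>, OF level_contractions_mats[OF xs] sq, symmetric])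
  have "form (Ns i) (xs i) v u = 1"
    using form[of q p] by (simp add: u_def[abs_def] v_def[abs_def] rotation_def)
  note vu = contraction_attains[OF X uv(1) norms(1) uv(2) norms(2) this]
  \<comment> \<open>The sign is moved to the left vector so that the form takes the value one
    again.\<close>
  have "form (Ns i) (xs i) (\<lambda>k. - u k) v = 1"
    using form[of p q] form_cmult[of "Ns i" "xs i" "- 1" u 1 v] pq
    by (simp add: u_def[abs_def] v_def[abs_def] rotation_def)
  note uv' = contraction_attains[OF X uv(2) norms(2) uv(3) norms(3) this]
  have outside: "u k = 0" "v k = 0" "xs i k l = 0" "xs i l k = 0" if "k \<notin> Ns i" for k l
    using that scalar_mats_outside[OF \<beta>(1), of k] xs by (auto simp: u_def v_def level_contractions_iff)
  have row: "(\<Sum>\<^sub>\<infinity>j\<in>Ns i. u j * xs i k j) = v k" "(\<Sum>\<^sub>\<infinity>j\<in>Ns i. v j * xs i k j) = - u k"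
    and col: "(\<Sum>\<^sub>\<infinity>j\<in>Ns i. v j * xs i j k) = u k" "(\<Sum>\<^sub>\<infinity>j\<in>Ns i. u j * xs i j k) = - v k" for k
  proof -
    have "(\<Sum>\<^sub>\<infinity>j\<in>Ns i. u j * xs i j k) = - (\<Sum>\<^sub>\<infinity>j\<in>Ns i. - u j * xs i j k)"
      by (simp add: infsum_uminus)
    then show "(\<Sum>\<^sub>\<infinity>j\<in>Ns i. u j * xs i j k) = - v k"
      using uv'(2)[of k] outside[of k] by (cases "k \<in> Ns i") simp_all
  qed (use vu uv' outside in \<open>cases "k \<in> Ns i"; simp\<close>)+
  \<comment> \<open>The range projection is u u^T + v v^T; both products below then equal v u^T - u
    v^T.\<close>
  have P: "mat_prod {p, q} \<beta> (adj \<beta>) k l = u k * u l + v k * v l" for k l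
    using pq by (simp add: mat_prod_def adj_def cj_real_def u_def v_def)
  have fb: "form_bound (Ns i) (\<lambda>k l. xs i l k) 1" by (rule form_bound_transpose[OF X])
  have hs: "(\<lambda>j. u j * xs i k j) summable_on Ns i" "(\<lambda>j. v j * xs i k j) summable_on Ns i"
    "(\<lambda>j. u j * xs i j k) summable_on Ns i" "(\<lambda>j. v j * xs i j k) summable_on Ns i" for k
    using form_bound_row_summable[OF X zero_le_one uv(1), of k] form_bound_row_summable[OF X zero_le_one uv(2), of k]
      form_bound_row_summable[OF fb zero_le_one uv(1), of k] form_bound_row_summable[OF fb zero_le_one uv(2), of k]
      outside[of k] by (cases "k \<in> Ns i"; simp)+
  have "lmult real_space (Ns i) (mat_prod {p, q} \<beta> (adj \<beta>)) (xs i) k l = u k * (- v l) + v k * u l" for k l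
  proof -
    have "((\<lambda>j. mat_prod {p, q} \<beta> (adj \<beta>) k j * xs i j l) has_sum (u k * (- v l) + v k * u l)) (Ns i)"
      using has_sum_add[OF has_sum_cmult_right[OF has_sum_infsum[OF hs(3)], of "u k"]
          has_sum_cmult_right[OF has_sum_infsum[OF hs(4)], of "v k"]]
      unfolding P col by (simp add: algebra_simps)
    from has_sum_unique[OF _ this] show ?thesis
      using predual_lmult[where a = "mat_prod {p, q} \<beta> (adj \<beta>)" and k = k and l = l,
          OF dual_operator_space_real level_contractions_mats[OF xs]
          range_projection_square_summable(2)[OF \<beta>(1)] ident_mem_predual] by simp
  qed
  moreover have "rmult real_space (Ns i) (xs i) (mat_prod {p, q} \<beta> (adj \<beta>)) k l = u l * v k + v l * (- u k)" for k l
  proof -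
    have "((\<lambda>j. mat_prod {p, q} \<beta> (adj \<beta>) j l * xs i k j) has_sum (u l * v k + v l * (- u k))) (Ns i)"
      using has_sum_add[OF has_sum_cmult_right[OF has_sum_infsum[OF hs(1)], of "u l"]
          has_sum_cmult_right[OF has_sum_infsum[OF hs(2)], of "v l"]]
      unfolding P row by (simp add: algebra_simps)
    from has_sum_unique[OF _ this] show ?thesis
      using predual_rmult[where b = "mat_prod {p, q} \<beta> (adj \<beta>)" and k = k and l = l,
          OF dual_operator_space_real level_contractions_mats[OF xs]
          range_projection_square_summable(1)[OF \<beta>(1)] ident_mem_predual] by simp
  qed
  ultimately show "lmult real_space (Ns i) (mat_prod {p, q} \<beta> (adj \<beta>)) (xs i) =
      rmult real_space (Ns i) (xs i) (mat_prod {p, q} \<beta> (adj \<beta>))"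
    by (simp add: fun_eq_iff mult.commute)
qed

section \<open>Failure of purity over the complex numbers\<close>

text \<open>The spectral projection of the rotation for its eigenvalue \<open>e = \<plusminus>\<i>\<close>.\<close>

definition spectral_proj :: "complex \<Rightarrow> 'k \<Rightarrow> 'k \<Rightarrow> 'k \<Rightarrow> 'k \<Rightarrow> complex" where
  "spectral_proj e p q = (\<lambda>i j. if i = p \<and> j = p \<or> i = q \<and> j = q then 1 / 2
     else if i = p \<and> j = q then e / 2 else if i = q \<and> j = p then - e / 2 else 0)"

lemma finite_scalar_mats:
  fixes a :: "'k \<Rightarrow> 'k \<Rightarrow> 'f::rc_field"
  assumes fin: "finite M" "finite N" and outside: "\<And>i j. i \<notin> M \<or> j \<notin> N \<Longrightarrow> a i j = 0"
  shows "a \<in> scalar_mats M N"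
proof (rule scalar_matsI[OF outside])
  let ?C = "\<Sum>i\<in>M. \<Sum>j\<in>N. norm (a i j)"
  fix F G assume F: "finite F" "F \<subseteq> M" and G: "finite G" "G \<subseteq> N"
  have C: "0 \<le> ?C" by (intro sum_nonneg norm_ge_zero)
  have "L2_set (\<lambda>i. norm (\<Sum>j\<in>G. a i j * \<xi> j)) F \<le> ?C * L2_set (\<lambda>j. norm (\<xi> j)) G" for \<xi>
  proof -
    have "L2_set (\<lambda>i. norm (\<Sum>j\<in>G. a i j * \<xi> j)) F \<le> (\<Sum>i\<in>F. norm (\<Sum>j\<in>G. a i j * \<xi> j))"
      by (rule L2_set_le_sum) simp
    also have "\<dots> \<le> (\<Sum>i\<in>F. \<Sum>j\<in>G. norm (a i j) * L2_set (\<lambda>j. norm (\<xi> j)) G)"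
    proof (rule sum_mono)
      fix i
      show "norm (\<Sum>j\<in>G. a i j * \<xi> j) \<le> (\<Sum>j\<in>G. norm (a i j) * L2_set (\<lambda>j. norm (\<xi> j)) G)"
      proof (rule sum_norm_le)
        fix j assume "j \<in> G"
        then show "norm (a i j * \<xi> j) \<le> norm (a i j) * L2_set (\<lambda>j. norm (\<xi> j)) G"
          unfolding norm_mult by (intro mult_left_mono member_le_L2_set G(1)) simp_all
      qed
    qed
    also have "\<dots> = (\<Sum>i\<in>F. \<Sum>j\<in>G. norm (a i j)) * L2_set (\<lambda>j. norm (\<xi> j)) G"
      by (simp only: sum_distrib_right)
    also have "\<dots> \<le> ?C * L2_set (\<lambda>j. norm (\<xi> j)) G"
    proof (rule mult_right_mono)
      have "(\<Sum>i\<in>F. \<Sum>j\<in>G. norm (a i j)) \<le> (\<Sum>i\<in>F. \<Sum>j\<in>N. norm (a i j))"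
        by (intro sum_mono sum_mono2 fin G) simp
      also have "\<dots> \<le> ?C" by (intro sum_mono2 fin F sum_nonneg) simp
      finally show "(\<Sum>i\<in>F. \<Sum>j\<in>G. norm (a i j)) \<le> ?C" .
    qed simp
    finally show ?thesis .
  qed
  with C show "op_bound F G a ?C" by (simp add: op_bound_def)
qed

lemma ws_sum_cx_finite:
  assumes E: "dual_operator_space E" and "finite A"
  shows "ws_sum (cx_space E) f A = (\<Sum>a\<in>A. f a)"
proof -
  have "ws_sum (cx_space E) (\<lambda>a. (fst (f a), snd (f a))) A = (\<Sum>a\<in>A. fst (f a), \<Sum>a\<in>A. snd (f a))"
    using \<open>finite A\<close> by (intro ws_sum_cx[OF E]) (simp_all add: predual_sum[OF E])
  also have "\<dots> = (\<Sum>a\<in>A. f a)" by (intro prod_eqI) (simp_all add: fst_sum snd_sum)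
  finally show ?thesis by simp
qed

lemma spectral_proj_entries:
  assumes "p \<noteq> q"
  shows "spectral_proj e p q p p = 1 / 2" "spectral_proj e p q p q = e / 2"
    "spectral_proj e p q q p = - e / 2" "spectral_proj e p q q q = 1 / 2"
    and "k \<notin> {p, q} \<Longrightarrow> spectral_proj e p q k l = 0" "l \<notin> {p, q} \<Longrightarrow> spectral_proj e p q k l = 0"
  using assms by (auto simp: spectral_proj_def)

text \<open>The matrix is an orthogonal projection: \<open>cnj e = - e\<close> makes it self-adjoint
  and \<open>e * e = - 1\<close> makes it idempotent.\<close>

lemma spectral_proj_gram:
  assumes pq: "p \<noteq> q" and e: "e = \<i> \<or> e = - \<i>"
  shows "mat_prod {p, q} (adj (spectral_proj e p q)) (spectral_proj e p q) k l = spectral_proj e p q k l"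
proof -
  let ?P = "spectral_proj e p q"
  note P = spectral_proj_entries[OF pq]
  have *: "mat_prod {p, q} (adj ?P) ?P k l = cnj (?P p k) * ?P p l + cnj (?P q k) * ?P q l"
    using pq by (simp add: mat_prod_def adj_def cj_complex_def)
  consider "k = p" | "k = q" | "k \<notin> {p, q}" by blast
  then show ?thesis
  proof cases
    case 1
    consider "l = p" | "l = q" | "l \<notin> {p, q}" by blast
    then show ?thesis using e 1 unfolding * by cases (auto simp: P)
  next
    case 2
    consider "l = p" | "l = q" | "l \<notin> {p, q}" by blast
    then show ?thesis using e 2 unfolding * by cases (auto simp: P)
  next
    case 3
    then show ?thesis unfolding * by (simp add: P(5,6))
  qed
qed

text \<open>The range of the projection P is the eigenspace of the rotation J for e, so P J P = e P;
  the pair on the right is the complex number \<open>e * P k l\<close> in the coordinates of the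
  complexified line.\<close>

lemma conjug_spectral_proj:
  assumes pq: "p \<noteq> q" and e: "e = \<i> \<or> e = - \<i>"
  shows "conjug (cx_space real_space) {p, q} (spectral_proj e p q) (real_mat (rotation p q)) k l =
    (Re (e * spectral_proj e p q k l), Im (e * spectral_proj e p q k l))"
proof -
  let ?P = "spectral_proj e p q"
  note P = spectral_proj_entries[OF pq]
  have scal: "scal (cx_space real_space) c (x, y) = (Re c * x - Im c * y, Re c * y + Im c * x)" for c x y
    by (simp add: cx_space_def)
  have J: "real_mat (rotation p q) p p = (0, 0)" "real_mat (rotation p q) p q = (- 1, 0)"
    "real_mat (rotation p q) q p = (1, 0)" "real_mat (rotation p q) q q = (0, 0)"
    using pq by (simp_all add: real_mat_def rotation_def)
  have *: "conjug (cx_space real_space) {p, q} ?P (real_mat (rotation p q)) k l =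
      (let z = cnj (?P q k) * ?P p l - cnj (?P p k) * ?P q l in (Re z, Im z))"
    using pq unfolding conjug_def lmult_def rmult_def
    by (simp add: ws_sum_cx_finite[OF dual_operator_space_real] J scal adj_def cj_complex_def Let_def
        algebra_simps)
  consider "k = p" | "k = q" | "k \<notin> {p, q}" by blast
  then show ?thesis
  proof cases
    case 1
    consider "l = p" | "l = q" | "l \<notin> {p, q}" by blast
    then show ?thesis using e 1 unfolding * by cases (auto simp: P Let_def)
  next
    case 2
    consider "l = p" | "l = q" | "l \<notin> {p, q}" by blast
    then show ?thesis using e 2 unfolding * by cases (auto simp: P Let_def)
  next
    case 3
    then show ?thesis unfolding * by (simp add: P(5,6))
  qed
qed

lemma spectral_proj_sum:
  assumes pq: "p \<noteq> q"
  shows "spectral_proj \<i> p q k l + spectral_proj (- \<i>) p q k l = id_mat {p, q} k l"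
proof -
  consider "k = p" | "k = q" | "k \<notin> {p, q}" by blast
  then show ?thesis
  proof cases
    case 1
    consider "l = p" | "l = q" | "l \<notin> {p, q}" by blast
    then show ?thesis using pq 1 by cases (auto simp: spectral_proj_entries[OF pq] id_mat_def)
  next
    case 2
    consider "l = p" | "l = q" | "l \<notin> {p, q}" by blast
    then show ?thesis using pq 2 by cases (auto simp: spectral_proj_entries[OF pq] id_mat_def)
  next
    case 3
    then show ?thesis by (auto simp: spectral_proj_entries[OF pq] id_mat_def)
  qed
qed

lemma spectral_proj_sum_eigenvalue:
  assumes pq: "p \<noteq> q"
  shows "(Re (\<i> * spectral_proj \<i> p q k l), Im (\<i> * spectral_proj \<i> p q k l)) +
    (Re (- \<i> * spectral_proj (- \<i>) p q k l), Im (- \<i> * spectral_proj (- \<i>) p q k l)) =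
    real_mat (rotation p q) k l"
proof -
  consider "k = p" | "k = q" | "k \<notin> {p, q}" by blast
  then show ?thesis
  proof cases
    case 1
    consider "l = p" | "l = q" | "l \<notin> {p, q}" by blast
    then show ?thesis using pq 1 by cases (auto simp: spectral_proj_entries[OF pq] real_mat_def rotation_def zero_prod_def)
  next
    case 2
    consider "l = p" | "l = q" | "l \<notin> {p, q}" by blast
    then show ?thesis using pq 2 by cases (auto simp: spectral_proj_entries[OF pq] real_mat_def rotation_def zero_prod_def)
  next
    case 3
    then show ?thesis by (auto simp: spectral_proj_entries[OF pq] real_mat_def rotation_def zero_prod_def)
  qed
qed

lemma not_pure_cx_rotation:
  fixes p q :: 'k
  assumes inf: "infinite (UNIV :: 'k set)" and pq: "p \<noteq> q"
  shows "\<not> pure (cx_space real_space) (cx_set real_space contractions) ({p, q}, real_mat (rotation p q))"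
proof
  let ?J = "real_mat (rotation p q)" and ?P = "\<lambda>e. spectral_proj e p q"
  assume pure: "pure (cx_space real_space) (cx_set real_space contractions) ({p, q}, ?J)"
  define e where "e n = (if n = 0 then \<i> else - \<i>)" for n :: nat
  have J: "?J \<in> level (cx_set real_space contractions) {p, q}"
    using real_mat_cx_set[OF dual_operator_space_real inf nc_convex_contractions rotation_mem_contractions[OF pq]]
    by (simp add: level_def)
  have e: "e n = \<i> \<or> e n = - \<i>" for n by (simp add: e_def)
  note prod = spectral_proj_gram[OF pq e] and conj = conjug_spectral_proj[OF pq e]
  have two: "(\<Sum>n<2. f n) = f 0 + f 1" for f :: "nat \<Rightarrow> 'z::comm_monoid_add"
    by (simp add: numeral_2_eq_2)
  have "nc_comb (cx_space real_space) (cx_set real_space contractions) {p, q} ?J 2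
      (\<lambda>_. {p, q}) (\<lambda>_. ?J) (\<lambda>n. ?P (e n))"
    unfolding nc_comb_def
  proof (intro conjI allI impI J)
    show "?P (e n) \<in> scalar_mats {p, q} {p, q}" for n
    proof (rule finite_scalar_mats)
      show "?P (e n) i j = 0" if "i \<notin> {p, q} \<or> j \<notin> {p, q}" for i j
        using that spectral_proj_entries(5,6)[OF pq] by (elim disjE)
    qed simp_all
    show "?P (e n) \<noteq> (\<lambda>_ _. 0)" for n
    proof
      assume "?P (e n) = (\<lambda>_ _. 0)"
      from fun_cong[OF fun_cong[OF this], of p p] show False by (simp add: spectral_proj_def)
    qed
    show "(\<lambda>k l. \<Sum>n<2. mat_prod {p, q} (adj (?P (e n))) (?P (e n)) k l) = id_mat {p, q}"
    proof (intro ext)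
      show "(\<Sum>n<2. mat_prod {p, q} (adj (?P (e n))) (?P (e n)) k l) = id_mat {p, q} k l" for k l
        unfolding prod two using spectral_proj_sum[OF pq, of k l] by (simp add: e_def)
    qed
    show "?J = (\<lambda>k l. \<Sum>n<2. conjug (cx_space real_space) {p, q} (?P (e n)) ?J k l)"
    proof (intro ext)
      show "?J k l = (\<Sum>n<2. conjug (cx_space real_space) {p, q} (?P (e n)) ?J k l)" for k l
        unfolding conj two using spectral_proj_sum_eigenvalue[OF pq, of k l] by (simp add: e_def)
    qed
  qed
  from pure[unfolded pure_def prod.case, THEN conjunct2, rule_format, OF this, of 0]
  obtain c \<beta> where f: "pure_factor (cx_space real_space) {p, q} ?J {p, q} ?J (?P \<i>) c \<beta>"
    by (auto simp: e_def)
  then have "?P \<i> = (\<lambda>k l. of_real c * \<beta> k l)"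
    by (simp add: pure_factor_def)
  then have P: "?P \<i> k l = of_real c * \<beta> k l" for k l
    by (rule fun_cong[OF fun_cong])
  \<comment> \<open>The columns of a multiple of an isometry are orthogonal, but those of the rank
    one projection have inner product i / 2.\<close>
  have "mat_prod {p, q} (adj \<beta>) \<beta> p q = 0"
    using f pq by (simp add: pure_factor_def isometries_def id_mat_def)
  then have "cnj (\<beta> p p) * \<beta> p q + cnj (\<beta> q p) * \<beta> q q = 0"
    using pq by (simp add: mat_prod_def adj_def cj_complex_def)
  then have "of_real c * of_real c * (cnj (\<beta> p p) * \<beta> p q + cnj (\<beta> q p) * \<beta> q q) = 0"
    by simp
  then have "cnj (?P \<i> p p) * ?P \<i> p q + cnj (?P \<i> q p) * ?P \<i> q q = 0"
    unfolding P by (simp add: algebra_simps)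
  then show False using pq by (simp add: spectral_proj_def complex_eq_iff)
qed

lemma pure_nc_extreme_descend:
  fixes E :: "(real, 'e::ab_group_add) opspace" and K :: "('k, 'e) graded_set"
  assumes inf: "infinite (UNIV :: 'k set)" and EK: "dual_operator_space E \<and> compact_nc_convex E K"
  shows "(\<forall>x\<in>K. pure (cx_space E) (cx_set E K) (cx_incl x) \<longrightarrow> pure E K x) \<and>
    (\<forall>x\<in>K. nc_extreme (cx_space E) (cx_set E K) (cx_incl x) \<longrightarrow> nc_extreme E K x) \<and>
    {x \<in> K. cx_incl x \<in> nc_boundary (cx_space E) (cx_set E K)} \<subseteq> nc_boundary E K"
proof -
  have E: "dual_operator_space E" and K: "nc_convex E K"
    using EK by (simp_all add: compact_nc_convex_def)
  have "pure E K x" if "x \<in> K" "pure (cx_space E) (cx_set E K) (cx_incl x)" for x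
    using that pure_cx_imp_pure[OF E inf K] by (cases x) (simp add: cx_incl_eq)
  moreover have "nc_extreme E K x" if "x \<in> K" "nc_extreme (cx_space E) (cx_set E K) (cx_incl x)" for x
    using that nc_extreme_cx_imp_nc_extreme[OF E inf K] by (cases x) (simp add: cx_incl_eq)
  ultimately show ?thesis unfolding nc_boundary_def by blast
qed

theorem lemma3p1:
  assumes "infinite (UNIV :: 'k set)"
  shows
    "(\<forall>(E :: (real, 'e::ab_group_add) opspace) (K :: ('k, 'e) graded_set).
        dual_operator_space E \<and> compact_nc_convex E K \<longrightarrow>
        (\<forall>x\<in>K. pure (cx_space E) (cx_set E K) (cx_incl x) \<longrightarrow> pure E K x) \<and>
        (\<forall>x\<in>K. nc_extreme (cx_space E) (cx_set E K) (cx_incl x) \<longrightarrow> nc_extreme E K x) \<and>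
        {x \<in> K. cx_incl x \<in> nc_boundary (cx_space E) (cx_set E K)} \<subseteq> nc_boundary E K) \<and>
     (\<exists>(E :: (real, real) opspace) (K :: ('k, real) graded_set).
        dual_operator_space E \<and> compact_nc_convex E K \<and>
        (\<exists>x\<in>K. pure E K x \<and> \<not> pure (cx_space E) (cx_set E K) (cx_incl x))) \<and>
     (\<exists>(E :: (real, real) opspace) (K :: ('k, real) graded_set).
        dual_operator_space E \<and> compact_nc_convex E K \<and>
        (\<exists>x\<in>K. nc_extreme E K x \<and> \<not> nc_extreme (cx_space E) (cx_set E K) (cx_incl x))) \<and>
     (\<exists>(E :: (real, real) opspace) (K :: ('k, real) graded_set).
        dual_operator_space E \<and> compact_nc_convex E K \<and>
        {x \<in> K. cx_incl x \<in> nc_boundary (cx_space E) (cx_set E K)} \<subset> nc_boundary E K)"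
proof -
  note descent = pure_nc_extreme_descend[OF assms]
  obtain p q :: 'k where pq: "p \<noteq> q"
    using assms by (metis finite.emptyI finite_insert UNIV_eq_I insertI1)
  let ?K = "contractions :: ('k, real) graded_set" and ?x = "({p, q}, rotation p q)"
  have K: "dual_operator_space real_space \<and> compact_nc_convex real_space ?K"
    by (simp add: dual_operator_space_real compact_nc_convex_contractions)
  have x: "?x \<in> ?K" by (rule rotation_mem_contractions[OF pq])
  have not_pure: "\<not> pure (cx_space real_space) (cx_set real_space ?K) (cx_incl ?x)"
    unfolding cx_incl_eq by (rule not_pure_cx_rotation[OF assms pq])
  \<comment> \<open>Nc extremality includes purity, so the same point refutes both converses and
    makes the inclusion proper.\<close>
  then have not_extreme: "\<not> nc_extreme (cx_space real_space) (cx_set real_space ?K) (cx_incl ?x)"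
    by (simp add: nc_extreme_def cx_incl_eq)
  have "{x \<in> ?K. cx_incl x \<in> nc_boundary (cx_space real_space) (cx_set real_space ?K)} \<subset>
      nc_boundary real_space ?K"
  proof (rule psubsetI)
    show "{x \<in> ?K. cx_incl x \<in> nc_boundary (cx_space real_space) (cx_set real_space ?K)} \<subseteq>
        nc_boundary real_space ?K"
      using descent[OF K] by (elim conjE)
    have "?x \<in> nc_boundary real_space ?K"
      using nc_extreme_rotation[OF pq] by (simp add: nc_boundary_def)
    moreover have "?x \<notin> {x \<in> ?K. cx_incl x \<in> nc_boundary (cx_space real_space) (cx_set real_space ?K)}"
      using not_extreme by (simp add: nc_boundary_def)
    ultimately show "{x \<in> ?K. cx_incl x \<in> nc_boundary (cx_space real_space) (cx_set real_space ?K)} \<noteq>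
        nc_boundary real_space ?K"
      by metis
  qed
  with descent K x pure_rotation[OF pq] not_pure nc_extreme_rotation[OF pq] not_extreme show ?thesis
    by blast
qed

end
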